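(* Let $D$ be an integral domain that is not a field. The following conditions are equivalent: (i) $D[X]$ is $w$-stable; (ii) $\mathrm{Na}(D,v)$ is stable; (iii) $D[X]$ has $t$-finite character and $D_M(X)$ is stable for each $M\in t\text{-Max}(D)$. Moreover, under any one of these conditions, $D$ is $w$-stable.
   Context: For an integral domain $D$ with field of fractions $K$, "ideal" means fractional ideal, an integral ideal is an ideal contained in $D$, and $\mathcal{F}(D)$ is the set of nonzero ideals. For ideals $I,J$, $(J:I)=\{x\in K: xI\subseteq J\}$. For $I\in\mathcal F(D)$: $I^v=(D:(D:I))$; $I^t=\bigcup\{J^v: J\in\mathcal F(D)\text{ finitely generated}, J\subseteq I\}$; $I$ is a $t$-ideal if $I=I^t$; a $t$-maximal ideal is an ideal maximal among the proper integral $t$-ideals (it is prime), and $t\text{-Max}(D)$ is the set of these; $I^w=\bigcap_{M\in t\text{-Max}(D)}ID_M$, equivalently $I^w=\bigcup\{(I:J): J\text{ finitely generated},(D:J)=D\}$. These are defined for every domain (e.g. $D[X]$). $D$ has $t$-finite character if each nonzero element lies in at most finitely many $t$-maximal ideals. For $I\in\mathcal F(D)$ put $E(I)=(I:I)$. $I$ is stable if $I(E(I):I)=E(I)$; $D$ is stable if every nonzero ideal is stable. $I$ is $w$-stable if, with $E=E(I^w)$, $(I^w(E:I^w))^w=E$ ($w$ being the $w$-operation of $D$); $D$ is $w$-stable if every nonzero ideal is $w$-stable. $X$ is an indeterminate, $c(h)$ is the ideal of $D$ generated by the coefficients of $h\in D[X]$. $\mathrm{Na}(D,v)=D[X]_{N(v)}$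 with $N(v)=\{h\in D[X]: h\neq0,\ c(h)^v=D\}$. For a domain $R$, the Nagata ring is $R(X)=R[X]_S$ with $S=\{h\in R[X]: c(h)=R\}$; $D_M(X)$ is the Nagata ring of the localization $D_M$. *)

theory Defs
  imports "HOL-Computational_Algebra.Polynomial_Factorial"
begin

text \<open>
  An integral domain is represented as a subring \<open>R\<close> of its field of fractions, and the
  field of fractions is a whole type of class \<open>field\<close>. So a domain \<open>D\<close> with
  field of fractions \<open>K\<close> is a set \<open>D :: 'k set\<close>, where \<open>'k\<close> plays the
  role of \<open>K\<close>; its localizations are further sets of type \<open>'k set\<close>, while
  \<open>D[X]\<close> and its rings of fractions are sets of type \<open>'k poly fract set\<close>, the
  type \<open>'k poly fract\<close> being the rational function field \<open>K(X)\<close>. The lemmas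
  \<open>domain_with_quotient_field \<dots>\<close> below confirm that the ambient type is the field of
  fractions of \<open>D[X]\<close> and of rings of fractions by multiplicative sets;
  an arbitrary domain of class \<open>idom\<close> is covered
  through its canonical image in its type of fractions.
\<close>

definition subring_of_field :: "'k::field set \<Rightarrow> bool" where
  "subring_of_field R \<longleftrightarrow>
     0 \<in> R \<and> 1 \<in> R \<and> (\<forall>x\<in>R. \<forall>y\<in>R. x + y \<in> R \<and> x * y \<in> R) \<and> (\<forall>x\<in>R. - x \<in> R)"

definition domain_with_quotient_field :: "'k::field set \<Rightarrow> bool" where
  "domain_with_quotient_field R \<longleftrightarrow>
     subring_of_field R \<and> (\<forall>x. \<exists>a\<in>R. \<exists>b\<in>R. b \<noteq> 0 \<and> x = a / b)"

definition is_subfield :: "'k::field set \<Rightarrow> bool" where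
  "is_subfield R \<longleftrightarrow> subring_of_field R \<and> (\<forall>x\<in>R. x \<noteq> 0 \<longrightarrow> inverse x \<in> R)"


subsection \<open>Fractional ideals\<close>

definition is_submodule :: "'k::field set \<Rightarrow> 'k set \<Rightarrow> bool" where
  "is_submodule R I \<longleftrightarrow>
     0 \<in> I \<and> (\<forall>x\<in>I. \<forall>y\<in>I. x + y \<in> I) \<and> (\<forall>r\<in>R. \<forall>x\<in>I. r * x \<in> I)"

definition fractional_ideal :: "'k::field set \<Rightarrow> 'k set \<Rightarrow> bool" where
  "fractional_ideal R I \<longleftrightarrow>
     is_submodule R I \<and> (\<exists>d\<in>R. d \<noteq> 0 \<and> (\<forall>x\<in>I. d * x \<in> R))"

text \<open>The set \<open>\<F>(R)\<close> of nonzero (fractional) ideals.\<close>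

definition nonzero_ideals :: "'k::field set \<Rightarrow> 'k set set" where
  "nonzero_ideals R = {I. fractional_ideal R I \<and> I \<noteq> {0}}"

definition ideal_generated :: "'k::field set \<Rightarrow> 'k set \<Rightarrow> 'k set" where
  "ideal_generated R A = (is_submodule R) hull A"

definition finitely_generated :: "'k::field set \<Rightarrow> 'k set \<Rightarrow> bool" where
  "finitely_generated R I \<longleftrightarrow> (\<exists>A. finite A \<and> I = ideal_generated R A)"

definition ideal_colon :: "'k::field set \<Rightarrow> 'k set \<Rightarrow> 'k set" where
  "ideal_colon J I = {x. \<forall>y\<in>I. x * y \<in> J}"

text \<open>
  Finite sums of products. This gives the product of two ideals, and also the extension
  \<open>I D\<^sub>M\<close> of an ideal \<open>I\<close> to an overring \<open>D\<^sub>M\<close>.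
\<close>

definition ideal_product :: "'k::field set \<Rightarrow> 'k set \<Rightarrow> 'k set" where
  "ideal_product I J =
     {\<Sum>i<n. f i * g i | (n::nat) f g. (\<forall>i<n. f i \<in> I) \<and> (\<forall>i<n. g i \<in> J)}"

text \<open>
  If \<open>S\<close> is multiplicative, \<open>fractions_with A S\<close> is the ring of fractions \<open>A\<^sub>S\<close>. Since
  \<open>a / 0 = 0\<close> in a field type, \<open>0 \<notin> S\<close> is needed; this holds in all uses below.
\<close>

definition fractions_with :: "'k::field set \<Rightarrow> 'k set \<Rightarrow> 'k set" where
  "fractions_with A S = {a / s | a s. a \<in> A \<and> s \<in> S}"

definition localization :: "'k::field set \<Rightarrow> 'k set \<Rightarrow> 'k set" where
  "localization R M = fractions_with R (R - M)"


subsection \<open>The operations \<open>v\<close>, \<open>t\<close> and \<open>w\<close>\<close>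

definition v_op :: "'k::field set \<Rightarrow> 'k set \<Rightarrow> 'k set" where
  "v_op R I = ideal_colon R (ideal_colon R I)"

definition t_op :: "'k::field set \<Rightarrow> 'k set \<Rightarrow> 'k set" where
  "t_op R I = \<Union>{v_op R J | J. J \<in> nonzero_ideals R \<and> finitely_generated R J \<and> J \<subseteq> I}"

definition proper_integral_t_ideal :: "'k::field set \<Rightarrow> 'k set \<Rightarrow> bool" where
  "proper_integral_t_ideal R I \<longleftrightarrow> I \<in> nonzero_ideals R \<and> I \<subset> R \<and> t_op R I = I"

definition t_Max :: "'k::field set \<Rightarrow> 'k set set" where
  "t_Max R = {M. proper_integral_t_ideal R M \<and>
                 (\<forall>I. proper_integral_t_ideal R I \<and> M \<subseteq> I \<longrightarrow> I = M)}"

definition w_op :: "'k::field set \<Rightarrow> 'k set \<Rightarrow> 'k set" where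
  "w_op R I = (\<Inter>M\<in>t_Max R. ideal_product I (localization R M))"

definition t_finite_character :: "'k::field set \<Rightarrow> bool" where
  "t_finite_character R \<longleftrightarrow> (\<forall>x\<in>R. x \<noteq> 0 \<longrightarrow> finite {M \<in> t_Max R. x \<in> M})"


subsection \<open>Stability and \<open>w\<close>-stability\<close>

definition endo_ring :: "'k::field set \<Rightarrow> 'k set" where
  "endo_ring I = ideal_colon I I"

definition stable_ideal :: "'k::field set \<Rightarrow> bool" where
  "stable_ideal I \<longleftrightarrow> ideal_product I (ideal_colon (endo_ring I) I) = endo_ring I"

definition stable_domain :: "'k::field set \<Rightarrow> bool" where
  "stable_domain R \<longleftrightarrow> (\<forall>I\<in>nonzero_ideals R. stable_ideal I)"

definition w_stable_ideal :: "'k::field set \<Rightarrow> 'k set \<Rightarrow> bool" where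
  "w_stable_ideal R I \<longleftrightarrow>
     (let E = endo_ring (w_op R I)
      in w_op R (ideal_product (w_op R I) (ideal_colon E (w_op R I))) = E)"

definition w_stable_domain :: "'k::field set \<Rightarrow> bool" where
  "w_stable_domain R \<longleftrightarrow> (\<forall>I\<in>nonzero_ideals R. w_stable_ideal R I)"


subsection \<open>Polynomial rings and Nagata rings\<close>

definition polys_over :: "'k::field set \<Rightarrow> 'k poly set" where
  "polys_over R = {p. \<forall>i. coeff p i \<in> R}"

definition polynomial_ring :: "'k::field set \<Rightarrow> 'k poly fract set" where
  "polynomial_ring R = to_fract ` polys_over R"

definition content_ideal :: "'k::field set \<Rightarrow> 'k poly \<Rightarrow> 'k set" where
  "content_ideal R h = ideal_generated R (set (coeffs h))"

definition N_v :: "'k::field set \<Rightarrow> 'k poly set" where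
  "N_v R = {h \<in> polys_over R. h \<noteq> 0 \<and> v_op R (content_ideal R h) = R}"

definition Na_v :: "'k::field set \<Rightarrow> 'k poly fract set" where
  "Na_v R = fractions_with (polynomial_ring R) (to_fract ` N_v R)"

definition Nagata_ring :: "'k::field set \<Rightarrow> 'k poly fract set" where
  "Nagata_ring R =
     fractions_with (polynomial_ring R) (to_fract ` {h \<in> polys_over R. content_ideal R h = R})"


subsection \<open>The ambient types are fields of fractions\<close>

lemma domain_with_quotient_field_to_fract:
  "domain_with_quotient_field (range (to_fract :: 'a::idom \<Rightarrow> 'a fract))"
proof -
  have "\<exists>a\<in>range to_fract. \<exists>b\<in>range to_fract. b \<noteq> 0 \<and> x = a / b" for x :: "'a fract"
  proof (cases x)
    case (Fract a b)
    then have "x = to_fract a / to_fract b"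
      by (simp add: to_fract_def)
    then show ?thesis using Fract by auto
  qed
  moreover have "subring_of_field (range (to_fract :: 'a \<Rightarrow> 'a fract))"
    unfolding subring_of_field_def
    by (auto simp flip: to_fract_add to_fract_mult to_fract_uminus to_fract_0 to_fract_1)
  ultimately show ?thesis
    by (simp add: domain_with_quotient_field_def)
qed

lemma subring_of_field_sum:
  assumes "subring_of_field R" "\<And>i. i \<in> A \<Longrightarrow> f i \<in> R"
  shows "sum f A \<in> R"
  using assms(2) by (induction A rule: infinite_finite_induct)
    (use assms(1) in \<open>auto simp: subring_of_field_def\<close>)

lemma clear_denominators:
  fixes p :: "'k::field poly"
  assumes R: "domain_with_quotient_field R"
  shows "\<exists>d\<in>R. d \<noteq> 0 \<and> smult d p \<in> polys_over R"
proof (induction p)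
  case 0
  show ?case using R
    by (auto simp: domain_with_quotient_field_def subring_of_field_def polys_over_def
             intro!: bexI[of _ 1])
next
  case (pCons c p)
  then obtain d where d: "d \<in> R" "d \<noteq> 0" "smult d p \<in> polys_over R" by blast
  obtain a b where ab: "a \<in> R" "b \<in> R" "b \<noteq> 0" "c = a / b"
    using R unfolding domain_with_quotient_field_def by blast
  have mult: "x * y \<in> R" if "x \<in> R" "y \<in> R" for x y
    using R that by (auto simp: domain_with_quotient_field_def subring_of_field_def)
  have "coeff (smult (d * b) (pCons c p)) i \<in> R" for i
  proof (cases i)
    case 0
    then show ?thesis using ab d mult[of d a] by simp
  next
    case (Suc j)
    have "b * coeff (smult d p) j \<in> R"
      using ab d mult by (simp add: polys_over_def)
    then show ?thesis using Suc by (simp add: ac_simps)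
  qed
  then show ?case using ab d mult
    by (intro bexI[of _ "d * b"]) (auto simp: polys_over_def)
qed

lemma domain_with_quotient_field_polynomial_ring:
  fixes R :: "'k::field set"
  assumes R: "domain_with_quotient_field R"
  shows "domain_with_quotient_field (polynomial_ring R)"
proof -
  have sR: "subring_of_field R"
    using R by (simp add: domain_with_quotient_field_def)
  have closed: "p + q \<in> polys_over R" "p * q \<in> polys_over R" "- p \<in> polys_over R"
    if "p \<in> polys_over R" "q \<in> polys_over R" for p q
    using that sR
    by (auto simp: polys_over_def coeff_mult subring_of_field_def
             intro!: subring_of_field_sum[OF sR])
  have units: "0 \<in> polys_over R" "1 \<in> polys_over R"
    using sR by (auto simp: polys_over_def subring_of_field_def coeff_1)
  have "subring_of_field (polynomial_ring R)"
    unfolding subring_of_field_def polynomial_ring_def using closed units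
    by (auto simp flip: to_fract_add to_fract_mult to_fract_uminus to_fract_0 to_fract_1)
  moreover have "\<exists>a\<in>polynomial_ring R. \<exists>b\<in>polynomial_ring R. b \<noteq> 0 \<and> x = a / b" for x
  proof (cases x)
    case (Fract p q)
    obtain d where d: "d \<in> R" "d \<noteq> 0" "smult d p \<in> polys_over R"
      using clear_denominators[OF R] by blast
    obtain e where e: "e \<in> R" "e \<noteq> 0" "smult e q \<in> polys_over R"
      using clear_denominators[OF R] by blast
    have const: "[:c:] \<in> polys_over R" if "c \<in> R" for c
      using that sR by (auto simp: polys_over_def subring_of_field_def coeff_pCons split: nat.split)
    have "[:e:] * smult d p \<in> polys_over R" "[:d:] * smult e q \<in> polys_over R"
      using closed(2) const d e by blast+
    moreover have "x = to_fract ([:e:] * smult d p) / to_fract ([:d:] * smult e q)"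
      using Fract d e by (simp add: to_fract_def eq_fract mult.commute)
    moreover have "to_fract ([:d:] * smult e q) \<noteq> 0"
      using Fract d e by simp
    ultimately show ?thesis unfolding polynomial_ring_def by blast
  qed
  ultimately show ?thesis
    by (simp add: domain_with_quotient_field_def)
qed

lemma domain_with_quotient_field_fractions_with:
  fixes R :: "'k::field set"
  assumes R: "domain_with_quotient_field R"
    and S: "S \<subseteq> R" "1 \<in> S" "0 \<notin> S" "\<And>s t. s \<in> S \<Longrightarrow> t \<in> S \<Longrightarrow> s * t \<in> S"
  shows "domain_with_quotient_field (fractions_with R S)"
proof -
  have sR: "subring_of_field R"
    using R by (simp add: domain_with_quotient_field_def)
  have incl: "R \<subseteq> fractions_with R S"
    unfolding fractions_with_def using S(2) by force
  have *: "x + y \<in> fractions_with R S" "x * y \<in> fractions_with R S" "- x \<in> fractions_with R S"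
    if xy: "x \<in> fractions_with R S" "y \<in> fractions_with R S" for x y
  proof -
    obtain a s b t where ab: "a \<in> R" "s \<in> S" "x = a / s" "b \<in> R" "t \<in> S" "y = b / t"
      using xy unfolding fractions_with_def by blast
    have nz: "s \<noteq> 0" "t \<noteq> 0" using ab S(3) by auto
    have "a * t + b * s \<in> R" "a * b \<in> R" "- a \<in> R" "s * t \<in> S"
      using sR ab S by (auto simp: subring_of_field_def subset_iff)
    moreover have "x + y = (a * t + b * s) / (s * t)" "x * y = (a * b) / (s * t)" "- x = (- a) / s"
      using ab nz by (simp_all add: field_simps)
    ultimately show "x + y \<in> fractions_with R S" "x * y \<in> fractions_with R S"
      "- x \<in> fractions_with R S"
      using ab(2) unfolding fractions_with_def by blast+
  qed
  then have "subring_of_field (fractions_with R S)"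
    using incl sR by (auto simp: subring_of_field_def)
  then show ?thesis
    using R incl unfolding domain_with_quotient_field_def by blast
qed

end

theory Submission
  imports Defs
begin

text \<open>
  Call a finite set \<open>A\<close> of elements of a domain \<open>R\<close> Glaz--Vasconcelos if \<open>(R : A) = R\<close>. By Zorn's
  lemma an ideal without such a subset lies in a maximal \<open>t\<close>-ideal, so \<open>x \<in> w_op R I\<close> if and only if
  \<open>x A \<subseteq> I\<close> for some such \<open>A\<close>. In \<open>D[X]\<close>, the ideal generated by \<open>A\<close> meets \<open>N_v D\<close>, and conversely a
  nonzero constant together with an element of \<open>N_v D\<close> is Glaz--Vasconcelos. Since \<open>I\<close> is stable if
  and only if \<open>1 \<in> I (E(I) : I)\<close>, this transfers \<open>w\<close>-stability of \<open>D[X]\<close> to stability of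
  \<open>Na(D,v)\<close> and back. Taking coefficients gives \<open>w\<close>-stability of \<open>D\<close>.

  Stability passes to the localizations \<open>D\<^sub>M(X)\<close> of \<open>Na(D,v)\<close>. A stable domain has finite character,
  since otherwise the sum of the modules \<open>(R : M\<^sup>2)\<close> over infinitely many maximal ideals \<open>M\<close> containing a
  common nonzero element would be a fractional ideal that is not stable. The maximal \<open>t\<close>-ideals of
  \<open>D[X]\<close> are the extensions of those of \<open>D\<close> and some uppers to zero, and a nonzero polynomial lies
  in only finitely many of the latter. Conversely, under finite character the endomorphism ring and the
  inverse of an ideal localize well when all localizations are stable, so local stability implies
  stability.
\<close>

section \<open>Products, quotients and endomorphism rings of modules\<close>

text \<open>Finite character rests on the modules \<open>(R : M\<^sup>2)\<close> because
  \<open>(R : M)\<close> gives no contradiction: for a maximal ideal \<open>M\<close> that is not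
  invertible, \<open>M (R : M) = M\<close>, so \<open>(R : M)\<close> is already the ring
  \<open>(M : M)\<close>. One more division by a stable \<open>M\<close> never yields a ring.

  The obstacle in descending from localizations is that endomorphism rings and colon modules may
  fail to commute with localization without finiteness. A relation 1 = sum a_i e_i, with a_i in an
  ideal and e_i in its inverse, supplies it: y = sum a_i (e_i y) makes the ideal finitely generated
  over its endomorphism ring. For this reason stability is kept in the form of membership of 1.

  The obstacle in returning to \<open>D[X]\<close> is that a maximal \<open>t\<close>-ideal without
  nonzero constants contains an element of \<open>N_v D\<close> and becomes invisible in
  \<open>Na(D,v)\<close>; a constant has to be found to control it.\<close>

lemma ideal_product_memI: "a \<in> I \<Longrightarrow> b \<in> J \<Longrightarrow> a * b \<in> ideal_product I J"
  unfolding ideal_product_def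
  by (rule CollectI, rule exI[of _ 1], rule exI[of _ "\<lambda>_. a"], rule exI[of _ "\<lambda>_. b"]) simp

lemma ideal_product_0: "0 \<in> ideal_product I J"
  unfolding ideal_product_def by (rule CollectI, rule exI[of _ 0]) simp

lemma ideal_product_subset:
  assumes "0 \<in> N" "\<And>x y. x \<in> N \<Longrightarrow> y \<in> N \<Longrightarrow> x + y \<in> N"
    and "\<And>a b. a \<in> I \<Longrightarrow> b \<in> J \<Longrightarrow> a * b \<in> N"
  shows "ideal_product I J \<subseteq> N"
proof
  fix x assume "x \<in> ideal_product I J"
  then obtain n :: nat and f g where x: "x = (\<Sum>i<n. f i * g i)" "\<forall>i<n. f i \<in> I" "\<forall>i<n. g i \<in> J"
    unfolding ideal_product_def by blast
  have "(\<Sum>i<k. f i * g i) \<in> N" if "k \<le> n" for k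
    using that by (induction k) (use assms x in auto)
  with x show "x \<in> N" by auto
qed

lemma ideal_product_mono:
  "I \<subseteq> I' \<Longrightarrow> J \<subseteq> J' \<Longrightarrow> ideal_product I J \<subseteq> ideal_product I' J'"
  unfolding ideal_product_def by blast

lemma ideal_product_add:
  assumes "x \<in> ideal_product I J" "y \<in> ideal_product I J"
  shows "x + y \<in> ideal_product I J"
proof -
  obtain n :: nat and f g where x: "x = (\<Sum>i<n. f i * g i)" "\<forall>i<n. f i \<in> I" "\<forall>i<n. g i \<in> J"
    using assms(1) unfolding ideal_product_def by blast
  have "x + (\<Sum>i<m. f' i * g' i) \<in> ideal_product I J"
    if "\<forall>i<m. f' i \<in> I" "\<forall>i<m. g' i \<in> J" for m :: nat and f' g'
    using that
  proof (induction m)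
    case 0
    then show ?case using assms(1) by simp
  next
    case (Suc m)
    then have "x + (\<Sum>i<m. f' i * g' i) \<in> ideal_product I J" by auto
    then obtain n :: nat and f g where n: "x + (\<Sum>i<m. f' i * g' i) = (\<Sum>i<n. f i * g i)"
      "\<forall>i<n. f i \<in> I" "\<forall>i<n. g i \<in> J"
      unfolding ideal_product_def by blast
    have "(\<Sum>i<n. (f(n := f' m)) i * (g(n := g' m)) i) = (\<Sum>i<n. f i * g i)"
      by (rule sum.cong) auto
    then have "x + (\<Sum>i<Suc m. f' i * g' i)
        = (\<Sum>i<Suc n. (f(n := f' m)) i * (g(n := g' m)) i)"
      using n(1) by (simp add: add.assoc[symmetric])
    moreover have "\<forall>i<Suc n. (f(n := f' m)) i \<in> I" "\<forall>i<Suc n. (g(n := g' m)) i \<in> J"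
      using n(2,3) Suc.prems by (auto simp: less_Suc_eq)
    ultimately show ?case unfolding ideal_product_def by blast
  qed
  moreover obtain m :: nat and f' g' where "y = (\<Sum>i<m. f' i * g' i)"
      "\<forall>i<m. f' i \<in> I" "\<forall>i<m. g' i \<in> J"
    using assms(2) unfolding ideal_product_def by blast
  ultimately show ?thesis by blast
qed

lemma ideal_product_scale:
  assumes "\<And>a. a \<in> I \<Longrightarrow> r * a \<in> I" "x \<in> ideal_product I J"
  shows "r * x \<in> ideal_product I J"
proof -
  have "ideal_product I J \<subseteq> {x. r * x \<in> ideal_product I J}"
    using assms(1)
    by (intro ideal_product_subset)
      (auto simp: ideal_product_0 ideal_product_add distrib_left mult.assoc[symmetric]
        intro: ideal_product_memI)
  with assms(2) show ?thesis by blast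
qed

lemma ideal_product_scaled:
  fixes g :: "'k::field"
  assumes "g \<noteq> 0" "\<And>a. a \<in> I \<Longrightarrow> g * a \<in> I'" "\<And>b. b \<in> J \<Longrightarrow> b / g \<in> J'"
  shows "ideal_product I J \<subseteq> ideal_product I' J'"
proof (intro ideal_product_subset ideal_product_0 ideal_product_add)
  fix a b assume "a \<in> I" "b \<in> J"
  then have "(g * a) * (b / g) \<in> ideal_product I' J'"
    using assms by (intro ideal_product_memI) auto
  then show "a * b \<in> ideal_product I' J'" using assms(1) by (simp add: ac_simps)
qed

lemma submodule_0: "is_submodule R I \<Longrightarrow> 0 \<in> I"
  and submodule_add: "is_submodule R I \<Longrightarrow> x \<in> I \<Longrightarrow> y \<in> I \<Longrightarrow> x + y \<in> I"
  and submodule_scale: "is_submodule R I \<Longrightarrow> r \<in> R \<Longrightarrow> x \<in> I \<Longrightarrow> r * x \<in> I"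
  by (auto simp: is_submodule_def)

lemma submodule_scale_right: "is_submodule R I \<Longrightarrow> r \<in> R \<Longrightarrow> x \<in> I \<Longrightarrow> x * r \<in> I"
  by (metis mult.commute submodule_scale)

lemma submodule_sum:
  "is_submodule R I \<Longrightarrow> (\<And>i. i \<in> A \<Longrightarrow> f i \<in> I) \<Longrightarrow> sum f A \<in> I"
  by (induction A rule: infinite_finite_induct) (auto simp: submodule_0 submodule_add)

lemma submodule_ideal_product:
  "is_submodule R I \<Longrightarrow> is_submodule R (ideal_product I J)"
  by (auto simp: is_submodule_def ideal_product_0 ideal_product_add intro: ideal_product_scale)

lemma submodule_ideal_colon:
  assumes "is_submodule R J"
  shows "is_submodule R (ideal_colon J I)"
  using assms by (auto simp: is_submodule_def ideal_colon_def distrib_right mult.assoc)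

lemma nonzero_ideals_submodule: "I \<in> nonzero_ideals R \<Longrightarrow> is_submodule R I"
  by (auto simp: nonzero_ideals_def fractional_ideal_def)

lemma nonzero_ideals_obtain:
  assumes "I \<in> nonzero_ideals R"
  obtains x d where "x \<in> I" "x \<noteq> 0" "d \<in> R" "d \<noteq> 0" "\<And>y. y \<in> I \<Longrightarrow> d * y \<in> R"
proof -
  have "0 \<in> I" "I \<noteq> {0}" "\<exists>d\<in>R. d \<noteq> 0 \<and> (\<forall>x\<in>I. d * x \<in> R)"
    using assms by (auto simp: nonzero_ideals_def fractional_ideal_def is_submodule_def)
  then show thesis using that by blast
qed

lemma nonzero_idealsI:
  assumes "is_submodule R I" "x \<in> I" "x \<noteq> 0" "d \<in> R" "d \<noteq> 0" "\<And>y. y \<in> I \<Longrightarrow> d * y \<in> R"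
  shows "I \<in> nonzero_ideals R"
  using assms by (auto simp: nonzero_ideals_def fractional_ideal_def)

lemma one_in_endo: "1 \<in> endo_ring I"
  by (simp add: endo_ring_def ideal_colon_def)

lemma endo_ring_iff: "x \<in> endo_ring I \<longleftrightarrow> (\<forall>y\<in>I. x * y \<in> I)"
  by (simp add: endo_ring_def ideal_colon_def)

lemma colon_endo_iff:
  "e \<in> ideal_colon (endo_ring I) I \<longleftrightarrow> (\<forall>x\<in>I. \<forall>y\<in>I. e * x * y \<in> I)"
  by (simp add: endo_ring_iff ideal_colon_def)

lemma product_colon_endo_subset:
  assumes "is_submodule R I"
  shows "ideal_product I (ideal_colon (endo_ring I) I) \<subseteq> endo_ring I"
  using assms
  by (intro ideal_product_subset)
    (auto simp: endo_ring_iff is_submodule_def distrib_left distrib_right ideal_colon_def ac_simps)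

lemma product_colon_endo_scale:
  assumes "e \<in> endo_ring I" "x \<in> ideal_product I (ideal_colon (endo_ring I) I)"
  shows "e * x \<in> ideal_product I (ideal_colon (endo_ring I) I)"
  using assms by (auto intro: ideal_product_scale simp: endo_ring_iff)

text \<open>The product \<open>I (E : I)\<close> is closed under multiplication by \<open>E\<close>,
  so it is all of \<open>E\<close> as soon as it contains 1. Stability is proved and used through
  this test.\<close>

lemma stable_ideal_iff:
  assumes "is_submodule R I"
  shows "stable_ideal I \<longleftrightarrow> 1 \<in> ideal_product I (ideal_colon (endo_ring I) I)"
proof
  assume "stable_ideal I"
  then show "1 \<in> ideal_product I (ideal_colon (endo_ring I) I)"
    by (simp add: stable_ideal_def one_in_endo)
next
  assume "1 \<in> ideal_product I (ideal_colon (endo_ring I) I)"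
  then have "endo_ring I \<subseteq> ideal_product I (ideal_colon (endo_ring I) I)"
    using product_colon_endo_scale[of _ I 1] by auto
  with product_colon_endo_subset[OF assms] show "stable_ideal I"
    by (auto simp: stable_ideal_def)
qed

text \<open>Here \<open>I\<close> generates \<open>J\<close> over \<open>T\<close>. Denominators
  \<open>s\<close> and \<open>t\<close> clear the two arguments of an element of the colon module
  and are divided out again in \<open>T\<close>. This inclusion carries 1 from \<open>I\<close> to
  \<open>J\<close> without any finiteness.\<close>

lemma product_colon_endo_fractions:
  fixes J :: "'k::field set"
  assumes J: "is_submodule T J" and I: "I \<subseteq> J"
    and fr: "\<And>y. y \<in> J \<Longrightarrow> \<exists>s. s \<noteq> 0 \<and> 1 / s \<in> T \<and> s * y \<in> I"
  shows "ideal_product I (ideal_colon (endo_ring I) I)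
    \<subseteq> ideal_product J (ideal_colon (endo_ring J) J)"
proof (rule ideal_product_mono[OF I], rule subsetI)
  fix e assume e: "e \<in> ideal_colon (endo_ring I) I"
  have "e * x * y \<in> J" if "x \<in> J" "y \<in> J" for x y
  proof -
    obtain s t where st: "s \<noteq> 0" "1 / s \<in> T" "s * x \<in> I" "t \<noteq> 0" "1 / t \<in> T" "t * y \<in> I"
      using fr[OF \<open>x \<in> J\<close>] fr[OF \<open>y \<in> J\<close>] by blast
    then have "e * (s * x) * (t * y) \<in> J"
      using e I unfolding colon_endo_iff by blast
    then have "1 / s * (1 / t * (e * (s * x) * (t * y))) \<in> J"
      using st J by (blast intro: submodule_scale)
    then show ?thesis using st by (simp add: field_simps)
  qed
  then show "e \<in> ideal_colon (endo_ring J) J" by (simp add: colon_endo_iff)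
qed

lemma endo_ring_scaled:
  fixes g :: "'k::field"
  assumes "g \<noteq> 0"
  shows "endo_ring ((*) g ` I) = endo_ring I"
proof -
  have "x * (g * y) \<in> (*) g ` I \<longleftrightarrow> x * y \<in> I" for x y
    using assms by (subst mult.left_commute) (auto simp: image_iff)
  then show ?thesis by (auto simp: endo_ring_iff)
qed

text \<open>A factor \<open>g\<close> cancels against \<open>1 / g\<close> in the colon module, so
  an ideal may be scaled into a convenient position before its stability is tested.\<close>

lemma product_colon_endo_scaled:
  fixes g :: "'k::field"
  assumes g: "g \<noteq> 0"
  shows "ideal_product ((*) g ` I) (ideal_colon (endo_ring ((*) g ` I)) ((*) g ` I))
    = ideal_product I (ideal_colon (endo_ring I) I)"
    (is "?L = ?R")
proof
  have c: "b / g \<in> ideal_colon E ((*) g ` I)" if "b \<in> ideal_colon E I" for b E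
    using that g by (auto simp: ideal_colon_def)
  have d: "b / (1 / g) \<in> ideal_colon E I" if "b \<in> ideal_colon E ((*) g ` I)" for b E
    using that by (auto simp: ideal_colon_def mult.assoc)
  show "?R \<subseteq> ?L"
    unfolding endo_ring_scaled[OF g] by (rule ideal_product_scaled[OF g]) (auto intro: c)
  show "?L \<subseteq> ?R"
    unfolding endo_ring_scaled[OF g]
    by (rule ideal_product_scaled[of "1 / g"], use g in simp, use g in force, rule d)
qed

lemma submodule_scaled:
  assumes "is_submodule R I"
  shows "is_submodule R ((*) g ` I)"
  unfolding is_submodule_def
proof (intro conjI ballI)
  show "0 \<in> (*) g ` I" using submodule_0[OF assms] by (force simp: image_iff)
next
  fix x y assume "x \<in> (*) g ` I" "y \<in> (*) g ` I"
  then show "x + y \<in> (*) g ` I"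
    using submodule_add[OF assms] by (auto simp: distrib_left[symmetric])
next
  fix r x assume "r \<in> R" "x \<in> (*) g ` I"
  then show "r * x \<in> (*) g ` I"
    using submodule_scale[OF assms] by (auto simp: mult.left_commute)
qed

section \<open>Subrings of a field, modules of fractions and primes\<close>

locale field_subring =
  fixes R :: "'k::field set"
  assumes subring: "subring_of_field R"
begin

lemma R_0 [simp, intro]: "0 \<in> R" and R_1 [simp, intro]: "1 \<in> R"
  and R_add: "x \<in> R \<Longrightarrow> y \<in> R \<Longrightarrow> x + y \<in> R"
  and R_mult: "x \<in> R \<Longrightarrow> y \<in> R \<Longrightarrow> x * y \<in> R"
  and R_uminus: "x \<in> R \<Longrightarrow> - x \<in> R"
  using subring by (auto simp: subring_of_field_def)

lemma R_power: "x \<in> R \<Longrightarrow> x ^ n \<in> R"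
  by (induction n) (auto simp: R_mult)

lemma submodule_R: "is_submodule R R"
  by (auto simp: is_submodule_def R_add R_mult)

lemma submodule_uminus: "is_submodule R I \<Longrightarrow> x \<in> I \<Longrightarrow> - x \<in> I"
  using submodule_scale[of R I "-1" x] R_uminus[OF R_1] by simp

lemma submodule_diff: "is_submodule R I \<Longrightarrow> x \<in> I \<Longrightarrow> y \<in> I \<Longrightarrow> x - y \<in> I"
  using submodule_add[of R I x "-y"] submodule_uminus by simp

lemma submodule_fractions_with:
  assumes I: "is_submodule R I" and S: "S \<subseteq> R" "1 \<in> S" "0 \<notin> S" "\<And>s t. s \<in> S \<Longrightarrow> t \<in> S \<Longrightarrow> s * t \<in> S"
  shows "is_submodule (fractions_with R S) (fractions_with I S)"
proof -
  have add: "x + y \<in> fractions_with I S" if "x \<in> fractions_with I S" "y \<in> fractions_with I S" for x y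
  proof -
    obtain a s b t where ab: "a \<in> I" "s \<in> S" "x = a / s" "b \<in> I" "t \<in> S" "y = b / t"
      using \<open>x \<in> _\<close> \<open>y \<in> _\<close> unfolding fractions_with_def by blast
    have nz: "s \<noteq> 0" "t \<noteq> 0" using ab S(3) by auto
    have "t * a + s * b \<in> I"
      using I ab S by (blast intro: submodule_add submodule_scale)
    moreover have "x + y = (t * a + s * b) / (s * t)"
      using ab nz by (simp add: field_simps)
    ultimately show ?thesis using ab S unfolding fractions_with_def by blast
  qed
  have scale: "r * x \<in> fractions_with I S" if "r \<in> fractions_with R S" "x \<in> fractions_with I S" for r x
  proof -
    obtain a s b t where ab: "a \<in> R" "s \<in> S" "r = a / s" "b \<in> I" "t \<in> S" "x = b / t"
      using \<open>r \<in> _\<close> \<open>x \<in> _\<close> unfolding fractions_with_def by blast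
    have "a * b \<in> I"
      using I ab S by (blast intro: submodule_scale)
    moreover have "r * x = (a * b) / (s * t)"
      using ab by simp
    ultimately show ?thesis using ab S unfolding fractions_with_def by blast
  qed
  have "0 \<in> fractions_with I S"
    using submodule_0[OF I] S(2) unfolding fractions_with_def by force
  with add scale show ?thesis unfolding is_submodule_def by blast
qed

lemma subring_fractions_with:
  assumes S: "S \<subseteq> R" "1 \<in> S" "0 \<notin> S" "\<And>s t. s \<in> S \<Longrightarrow> t \<in> S \<Longrightarrow> s * t \<in> S"
  shows "subring_of_field (fractions_with R S)"
proof -
  have sub: "is_submodule (fractions_with R S) (fractions_with R S)"
    by (rule submodule_fractions_with[OF submodule_R S])
  have "1 / 1 \<in> fractions_with R S" using S(2) R_1 unfolding fractions_with_def by blast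
  then have "1 \<in> fractions_with R S" by simp
  moreover have "- x \<in> fractions_with R S" if "x \<in> fractions_with R S" for x
  proof -
    obtain a s where "a \<in> R" "s \<in> S" "x = a / s" using \<open>x \<in> _\<close> unfolding fractions_with_def by blast
    then have "- a \<in> R" "s \<in> S" "- x = (- a) / s" using R_uminus by simp_all
    then show ?thesis unfolding fractions_with_def by blast
  qed
  ultimately show ?thesis using sub unfolding subring_of_field_def is_submodule_def by blast
qed

end

lemma fractions_with_incl: "1 \<in> S \<Longrightarrow> I \<subseteq> fractions_with I S"
  unfolding fractions_with_def by force

definition prime_ideal_of :: "'k::field set \<Rightarrow> 'k set \<Rightarrow> bool" where
  "prime_ideal_of R M \<longleftrightarrow> is_submodule R M \<and> M \<subseteq> R \<and> 1 \<notin> M \<and>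
     (\<forall>a\<in>R. \<forall>b\<in>R. a * b \<in> M \<longrightarrow> a \<in> M \<or> b \<in> M)"

context field_subring
begin

lemma prime_compl:
  assumes "prime_ideal_of R M"
  shows "R - M \<subseteq> R" "1 \<in> R - M" "0 \<notin> R - M" "\<And>s t. s \<in> R - M \<Longrightarrow> t \<in> R - M \<Longrightarrow> s * t \<in> R - M"
proof -
  have M: "0 \<in> M" "1 \<notin> M" "\<And>a b. a \<in> R \<Longrightarrow> b \<in> R \<Longrightarrow> a * b \<in> M \<Longrightarrow> a \<in> M \<or> b \<in> M"
    using assms submodule_0[of R M] by (simp_all add: prime_ideal_of_def)
  show "R - M \<subseteq> R" "1 \<in> R - M" "0 \<notin> R - M" using M by simp_all
  show "s * t \<in> R - M" if "s \<in> R - M" "t \<in> R - M" for s t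
    using M(3)[of s t] R_mult[of s t] that by blast
qed

lemma product_localization:
  assumes "prime_ideal_of R M" and I: "is_submodule R I"
  shows "ideal_product I (localization R M) = fractions_with I (R - M)"
proof
  note S = prime_compl[OF assms(1)]
  have sub: "is_submodule (localization R M) (fractions_with I (R - M))"
    unfolding localization_def by (rule submodule_fractions_with[OF I S])
  have "I \<subseteq> fractions_with I (R - M)"
    using S(2) by (rule fractions_with_incl)
  with sub show "ideal_product I (localization R M) \<subseteq> fractions_with I (R - M)"
    by (intro ideal_product_subset) (auto intro: submodule_0 submodule_add submodule_scale_right)
  show "fractions_with I (R - M) \<subseteq> ideal_product I (localization R M)"
  proof
    fix x assume "x \<in> fractions_with I (R - M)"
    then obtain a s where x: "x = a * (1 / s)" "a \<in> I" "s \<in> R - M"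
      unfolding fractions_with_def by auto
    have "1 / s \<in> localization R M"
      unfolding localization_def fractions_with_def using x by blast
    with x show "x \<in> ideal_product I (localization R M)"
      by (auto intro: ideal_product_memI simp del: times_divide_eq_right)
  qed
qed

lemma mem_fractions_prime:
  assumes "prime_ideal_of R M" and I: "is_submodule R I"
  shows "x \<in> fractions_with I (R - M) \<longleftrightarrow> (\<exists>s\<in>R - M. s * x \<in> I)"
proof
  assume "x \<in> fractions_with I (R - M)"
  then obtain a s where "x = a / s" "a \<in> I" "s \<in> R - M" unfolding fractions_with_def by blast
  moreover have "s \<noteq> 0" using \<open>s \<in> R - M\<close> prime_compl(3)[OF assms(1)] by auto
  ultimately show "\<exists>s\<in>R - M. s * x \<in> I" by (intro bexI[of _ s]) auto
next
  assume "\<exists>s\<in>R - M. s * x \<in> I"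
  then obtain s where s: "s \<in> R - M" "s * x \<in> I" by blast
  moreover have "s \<noteq> 0" using s prime_compl(3)[OF assms(1)] by auto
  then have "x = (s * x) / s" by simp
  ultimately show "x \<in> fractions_with I (R - M)" unfolding fractions_with_def by blast
qed

lemma submodule_adjoin:
  assumes M: "is_submodule R M"
  shows "is_submodule R {x + r * a | x r. x \<in> M \<and> r \<in> R}"
proof -
  let ?N = "{x + r * a | x r. x \<in> M \<and> r \<in> R}"
  have "x + y \<in> ?N" if xy: "x \<in> ?N" "y \<in> ?N" for x y
  proof -
    obtain u r where "x = u + r * a" "u \<in> M" "r \<in> R" using xy(1) by blast
    moreover obtain v s where "y = v + s * a" "v \<in> M" "s \<in> R" using xy(2) by blast
    ultimately have "x + y = (u + v) + (r + s) * a" "u + v \<in> M" "r + s \<in> R"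
      using M by (auto simp: algebra_simps submodule_add R_add)
    then show ?thesis by blast
  qed
  moreover have "r * x \<in> ?N" if rx: "r \<in> R" "x \<in> ?N" for r x
  proof -
    obtain u s where "x = u + s * a" "u \<in> M" "s \<in> R" using rx(2) by blast
    then have "r * x = r * u + (r * s) * a" "r * u \<in> M" "r * s \<in> R"
      using M rx(1) by (auto simp: algebra_simps R_mult intro: submodule_scale)
    then show ?thesis by blast
  qed
  moreover have "0 + 0 * a \<in> ?N" using submodule_0[OF M] R_0 by blast
  ultimately show ?thesis unfolding is_submodule_def by simp
qed

end

section \<open>Maximal \<open>t\<close>-ideals and the \<open>w\<close>-operation\<close>

text \<open>Finite sets stand in for the ideals that they generate, since a colon module depends
  only on generators. As \<open>A \<subseteq> R\<close>, the colon module contains \<open>R\<close>,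
  and only the other inclusion is spelled out.\<close>

definition GV :: "'k::field set \<Rightarrow> 'k set \<Rightarrow> bool" where
  "GV R A \<longleftrightarrow> finite A \<and> A \<subseteq> R \<and> (\<forall>x. (\<forall>a\<in>A. x * a \<in> R) \<longrightarrow> x \<in> R)"

lemma is_submodule_ideal_generated: "is_submodule R (ideal_generated R A)"
  unfolding ideal_generated_def by (rule hull_in) (auto simp: is_submodule_def)

lemma ideal_generated_superset: "A \<subseteq> ideal_generated R A"
  unfolding ideal_generated_def by (rule hull_subset)

lemma ideal_generated_least: "is_submodule R I \<Longrightarrow> A \<subseteq> I \<Longrightarrow> ideal_generated R A \<subseteq> I"
  unfolding ideal_generated_def by (rule hull_minimal)

lemma ideal_colon_ideal_generated:
  assumes "is_submodule R J"
  shows "ideal_colon J (ideal_generated R A) = ideal_colon J A"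
proof
  show "ideal_colon J (ideal_generated R A) \<subseteq> ideal_colon J A"
    using ideal_generated_superset[of A R] by (auto simp: ideal_colon_def)
  show "ideal_colon J A \<subseteq> ideal_colon J (ideal_generated R A)"
  proof
    fix x assume "x \<in> ideal_colon J A"
    moreover have "is_submodule R {y. x * y \<in> J}"
      using assms by (auto simp: is_submodule_def distrib_left mult.left_commute)
    ultimately have "ideal_generated R A \<subseteq> {y. x * y \<in> J}"
      by (intro ideal_generated_least) (auto simp: ideal_colon_def)
    then show "x \<in> ideal_colon J (ideal_generated R A)" by (auto simp: ideal_colon_def)
  qed
qed

lemma v_op_iff: "y \<in> v_op R A \<longleftrightarrow> (\<forall>z. (\<forall>a\<in>A. z * a \<in> R) \<longrightarrow> y * z \<in> R)"
  by (auto simp: v_op_def ideal_colon_def)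

locale nonfield_domain = field_subring R for R :: "'k::field set" +
  assumes quotients: "\<exists>a\<in>R. \<exists>b\<in>R. b \<noteq> 0 \<and> x = a / b"
    and nonfield: "\<not> is_subfield R"
begin

lemma v_op_ideal_generated: "v_op R (ideal_generated R A) = v_op R A"
  unfolding v_op_def by (simp add: ideal_colon_ideal_generated submodule_R)

lemma subset_v_op: "A \<subseteq> v_op R A"
  by (metis mult.commute subsetI v_op_iff)

lemma v_op_mono: "A \<subseteq> B \<Longrightarrow> v_op R A \<subseteq> v_op R B"
  unfolding v_op_def ideal_colon_def by blast

lemma submodule_v_op: "is_submodule R (v_op R A)"
  unfolding v_op_def by (rule submodule_ideal_colon[OF submodule_R])

lemma GV_one: "GV R {1}"
  by (auto simp: GV_def)

lemma GV_iff_v_op: "finite A \<Longrightarrow> A \<subseteq> R \<Longrightarrow> GV R A \<longleftrightarrow> 1 \<in> v_op R A"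
  by (auto simp: v_op_iff GV_def)

lemma t_op_iff:
  assumes I: "I \<in> nonzero_ideals R"
  shows "y \<in> t_op R I \<longleftrightarrow> (\<exists>A. finite A \<and> A \<subseteq> I \<and> y \<in> v_op R A)"
proof
  assume "y \<in> t_op R I"
  then obtain A where "finite A" "ideal_generated R A \<subseteq> I" "y \<in> v_op R (ideal_generated R A)"
    unfolding t_op_def finitely_generated_def by blast
  then show "\<exists>A. finite A \<and> A \<subseteq> I \<and> y \<in> v_op R A"
    using ideal_generated_superset[of A R] v_op_ideal_generated by blast
next
  assume "\<exists>A. finite A \<and> A \<subseteq> I \<and> y \<in> v_op R A"
  then obtain A where A: "finite A" "A \<subseteq> I" "y \<in> v_op R A" by blast
  obtain x d where x: "x \<in> I" "x \<noteq> 0" "d \<in> R" "d \<noteq> 0" "\<And>y. y \<in> I \<Longrightarrow> d * y \<in> R"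
    using nonzero_ideals_obtain[OF I] by metis
  \<comment> \<open>\<open>t_op\<close> is built from nonzero ideals; adjoining \<open>x\<close>
    makes the ideal nonzero, and \<open>v_op\<close> can only grow.\<close>
  define B where "B = ideal_generated R (insert x A)"
  have BI: "B \<subseteq> I"
    unfolding B_def using A x nonzero_ideals_submodule[OF I] by (intro ideal_generated_least) auto
  have "x \<in> B" unfolding B_def using ideal_generated_superset[of "insert x A" R] by auto
  with x BI have "B \<in> nonzero_ideals R"
    by (intro nonzero_idealsI[of R B x d]) (auto simp: B_def is_submodule_ideal_generated)
  moreover have "y \<in> v_op R B"
    using A(3) v_op_mono[of A "insert x A"] by (auto simp: B_def v_op_ideal_generated)
  moreover have "finitely_generated R B"
    unfolding finitely_generated_def B_def using A(1) by blast
  ultimately show "y \<in> t_op R I" unfolding t_op_def using BI by blast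
qed

lemma subset_t_op: "I \<in> nonzero_ideals R \<Longrightarrow> I \<subseteq> t_op R I"
  using subset_v_op t_op_iff by (metis empty_subsetI finite.emptyI finite_insert insert_subset subsetI)

lemma finite_subset_t_op:
  assumes I: "I \<in> nonzero_ideals R" and B: "finite B" "B \<subseteq> t_op R I"
  shows "\<exists>A. finite A \<and> A \<subseteq> I \<and> B \<subseteq> v_op R A"
  using B
proof (induction B)
  case empty
  then show ?case by (intro exI[of _ "{}"]) auto
next
  case (insert b B)
  then obtain A A' where "finite A" "A \<subseteq> I" "B \<subseteq> v_op R A" "finite A'" "A' \<subseteq> I" "b \<in> v_op R A'"
    using t_op_iff[OF I] by auto
  then show ?case using v_op_mono[of A "A \<union> A'"] v_op_mono[of A' "A \<union> A'"]
    by (intro exI[of _ "A \<union> A'"]) auto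
qed

lemma submodule_t_op:
  assumes I: "I \<in> nonzero_ideals R"
  shows "is_submodule R (t_op R I)"
  unfolding is_submodule_def
proof (intro conjI ballI)
  show "0 \<in> t_op R I"
    using subset_t_op[OF I] nonzero_ideals_submodule[OF I] by (auto simp: is_submodule_def)
next
  fix x y assume "x \<in> t_op R I" "y \<in> t_op R I"
  then obtain A where "finite A" "A \<subseteq> I" "{x, y} \<subseteq> v_op R A"
    using finite_subset_t_op[OF I, of "{x, y}"] by auto
  then show "x + y \<in> t_op R I"
    using submodule_add[OF submodule_v_op, of x A y] t_op_iff[OF I] by auto
next
  fix r x assume "r \<in> R" "x \<in> t_op R I"
  then show "r * x \<in> t_op R I"
    using submodule_scale[OF submodule_v_op] t_op_iff[OF I] by meson
qed

lemma proper_t_ideal_no_GV: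
  assumes "proper_integral_t_ideal R I" "A \<subseteq> I"
  shows "\<not> GV R A"
proof
  assume A: "GV R A"
  have I: "I \<in> nonzero_ideals R" "I \<subset> R" "t_op R I = I"
    using assms by (auto simp: proper_integral_t_ideal_def)
  have "1 \<in> v_op R A" using A by (auto simp: v_op_iff GV_def)
  then have "1 \<in> I" using t_op_iff[OF I(1), of 1] I A assms(2) by (auto simp: GV_def)
  then have "R \<subseteq> I"
    using submodule_scale[OF nonzero_ideals_submodule[OF I(1)], of _ 1] by auto
  with I(2) show False by blast
qed

lemma integral_nonzero_idealsI:
  "is_submodule R I \<Longrightarrow> I \<subseteq> R \<Longrightarrow> x \<in> I \<Longrightarrow> x \<noteq> 0 \<Longrightarrow> I \<in> nonzero_ideals R"
  by (rule nonzero_idealsI[of R I x 1]) auto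

text \<open>Zorn's lemma applies because the generators of a Glaz--Vasconcelos ideal are finite in number.\<close>
lemma GV_or_t_Max:
  assumes I: "is_submodule R I" "I \<subseteq> R" "x \<in> I" "x \<noteq> 0"
  shows "(\<exists>A\<subseteq>I. GV R A) \<or> (\<exists>M\<in>t_Max R. I \<subseteq> M)"
proof (rule disjCI)
  assume noM: "\<not> (\<exists>M\<in>t_Max R. I \<subseteq> M)"
  show "\<exists>A\<subseteq>I. GV R A"
  proof (rule ccontr)
    assume noA: "\<not> (\<exists>A\<subseteq>I. GV R A)"
    define S where "S = {J. is_submodule R J \<and> J \<subseteq> R \<and> I \<subseteq> J \<and> \<not> (\<exists>A\<subseteq>J. GV R A)}"
    have "I \<in> S" using I noA by (simp add: S_def)
    have "\<Union>C \<in> S" if C: "C \<in> chains S" "C \<noteq> {}" for C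
    proof -
      have CS: "\<And>J. J \<in> C \<Longrightarrow> is_submodule R J \<and> J \<subseteq> R \<and> I \<subseteq> J \<and> \<not> (\<exists>A\<subseteq>J. GV R A)"
        using C by (auto simp: chains_def S_def)
      have tot: "\<And>J J'. J \<in> C \<Longrightarrow> J' \<in> C \<Longrightarrow> J \<subseteq> J' \<or> J' \<subseteq> J"
        using C by (auto simp: chains_def chain_subset_def)
      have "x + y \<in> \<Union>C" if xy: "x \<in> \<Union>C" "y \<in> \<Union>C" for x y
      proof -
        obtain J J' where J: "J \<in> C" "x \<in> J" "J' \<in> C" "y \<in> J'" using xy by blast
        obtain L where "L \<in> C" "x \<in> L" "y \<in> L" using tot[OF J(1,3)] J by blast
        then show ?thesis using CS submodule_add[of R L x y] by blast
      qed
      moreover have "0 \<in> \<Union>C" using C(2) CS submodule_0 by blast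
      moreover have "r * x \<in> \<Union>C" if "r \<in> R" "x \<in> \<Union>C" for r x
        using that CS submodule_scale[of R _ r x] by blast
      ultimately have "is_submodule R (\<Union>C)" unfolding is_submodule_def by blast
      moreover have "\<not> (\<exists>A\<subseteq>\<Union>C. GV R A)"
      proof
        assume "\<exists>A\<subseteq>\<Union>C. GV R A"
        then obtain A where A: "A \<subseteq> \<Union>C" "GV R A" by blast
        have "finite B \<Longrightarrow> B \<subseteq> \<Union>C \<Longrightarrow> \<exists>J\<in>C. B \<subseteq> J" for B
        proof (induction B rule: finite_induct)
          case empty
          then show ?case using C(2) by blast
        next
          case (insert b B)
          then obtain J J' where "J \<in> C" "B \<subseteq> J" "J' \<in> C" "b \<in> J'" by blast
          then show ?case using tot[of J J'] by blast
        qed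
        moreover have "finite A" using A by (simp add: GV_def)
        ultimately obtain J where "J \<in> C" "A \<subseteq> J" using A(1) by blast
        with CS A(2) show False by blast
      qed
      ultimately show ?thesis using C(2) CS unfolding S_def by blast
    qed
    then have "\<exists>U\<in>S. \<forall>X\<in>C. X \<subseteq> U" if "C \<in> chains S" for C
      using that \<open>I \<in> S\<close> by (cases "C = {}") (auto intro!: bexI[of _ "\<Union>C"])
    then have "\<exists>M\<in>S. \<forall>X\<in>S. M \<subseteq> X \<longrightarrow> X = M" by (intro Zorn_Lemma2) blast
    then obtain M where M: "M \<in> S" "\<And>J. J \<in> S \<Longrightarrow> M \<subseteq> J \<Longrightarrow> J = M"
      by blast
    have sub: "is_submodule R M" "M \<subseteq> R" "I \<subseteq> M" and noGV: "\<And>A. A \<subseteq> M \<Longrightarrow> \<not> GV R A"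
      using M(1) by (auto simp: S_def)
    have nz: "M \<in> nonzero_ideals R"
      using sub(3) I by (intro integral_nonzero_idealsI[OF sub(1,2), of x]) blast+
    \<comment> \<open>A Glaz-Vasconcelos set \<open>B\<close> in the \<open>t\<close>-closure lies
      in \<open>v_op R A\<close> for a finite \<open>A\<close> in \<open>M\<close>. Each multiplier
      of \<open>A\<close> into \<open>R\<close> is then one of \<open>B\<close>, so \<open>A\<close>
      would be Glaz-Vasconcelos too. Maximality now makes \<open>M\<close> a
      \<open>t\<close>-ideal.\<close>
    have "t_op R M \<in> S"
    proof -
      have "\<not> GV R B" if B: "B \<subseteq> t_op R M" for B
      proof
        assume "GV R B"
        then obtain A where A: "finite A" "A \<subseteq> M" "B \<subseteq> v_op R A"
          using finite_subset_t_op[OF nz _ B] unfolding GV_def by blast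
        have "x \<in> R" if "\<forall>a\<in>A. x * a \<in> R" for x
        proof -
          have "x * b \<in> R" if "b \<in> B" for b
            using A(3) that \<open>\<forall>a\<in>A. x * a \<in> R\<close> v_op_iff[of b R A] by (metis mult.commute subsetD)
          then show ?thesis using \<open>GV R B\<close> by (simp add: GV_def)
        qed
        then have "GV R A" using A sub by (auto simp: GV_def)
        with noGV A show False by blast
      qed
      moreover have "t_op R M \<subseteq> R"
      proof
        fix y assume "y \<in> t_op R M"
        then obtain A where "A \<subseteq> M" "y \<in> v_op R A" using t_op_iff[OF nz] by blast
        then have "y * 1 \<in> R" using sub unfolding v_op_iff by (metis mult_1 subsetD)
        then show "y \<in> R" by simp
      qed
      ultimately show ?thesis
        using subset_t_op[OF nz] submodule_t_op[OF nz] sub unfolding S_def by blast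
    qed
    then have tM: "t_op R M = M" using M(2) subset_t_op[OF nz] by blast
    have "1 \<notin> M" using noGV[of "{1}"] GV_one by auto
    then have pM: "proper_integral_t_ideal R M"
      using nz tM sub R_1 unfolding proper_integral_t_ideal_def by blast
    have "J = M" if J: "proper_integral_t_ideal R J" "M \<subseteq> J" for J
    proof (rule M(2)[OF _ J(2)])
      show "J \<in> S"
        using J proper_t_ideal_no_GV[OF J(1)] sub nonzero_ideals_submodule[of J]
        unfolding S_def proper_integral_t_ideal_def by blast
    qed
    with pM have "M \<in> t_Max R" unfolding t_Max_def by blast
    with noM sub show False by blast
  qed
qed

lemma t_Max_proper: "M \<in> t_Max R \<Longrightarrow> proper_integral_t_ideal R M"
  by (simp add: t_Max_def)

lemma t_Max_maximal: "M \<in> t_Max R \<Longrightarrow> proper_integral_t_ideal R I \<Longrightarrow> M \<subseteq> I \<Longrightarrow> I = M"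
  by (simp add: t_Max_def)

lemma t_Max_antichain: "M \<in> t_Max R \<Longrightarrow> N \<in> t_Max R \<Longrightarrow> M \<subseteq> N \<Longrightarrow> M = N"
  using t_Max_maximal t_Max_proper by metis

lemma t_Max_no_GV: "M \<in> t_Max R \<Longrightarrow> A \<subseteq> M \<Longrightarrow> \<not> GV R A"
  using proper_t_ideal_no_GV t_Max_proper by blast

lemma t_Max_submodule: "M \<in> t_Max R \<Longrightarrow> is_submodule R M"
  and t_Max_subset: "M \<in> t_Max R \<Longrightarrow> M \<subseteq> R"
  and t_Max_nonzero: "M \<in> t_Max R \<Longrightarrow> \<exists>x\<in>M. x \<noteq> 0"
  using nonzero_ideals_submodule[of M R] nonzero_ideals_obtain[of M R]
  by (auto simp: t_Max_def proper_integral_t_ideal_def)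

text \<open>If \<open>a\<close> is outside \<open>M\<close>, maximality forces a Glaz-Vasconcelos
  set \<open>A\<close> into \<open>M + R a\<close>. Multiplication by \<open>b\<close> sends
  \<open>A\<close> into \<open>M\<close>, while \<open>b\<close> stays in \<open>v_op\<close> of the
  resulting set, hence in the \<open>t\<close>-ideal \<open>M\<close>.\<close>

lemma t_Max_prime:
  assumes M: "M \<in> t_Max R"
  shows "prime_ideal_of R M"
proof -
  have sub: "is_submodule R M" "M \<subseteq> R" by (rule t_Max_submodule[OF M], rule t_Max_subset[OF M])
  have nz: "M \<in> nonzero_ideals R" and tM: "t_op R M = M"
    using t_Max_proper[OF M] by (auto simp: proper_integral_t_ideal_def)
  obtain m where m: "m \<in> M" "m \<noteq> 0" using t_Max_nonzero[OF M] by blast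
  have "b \<in> M" if ab: "a \<in> R" "b \<in> R" "a * b \<in> M" "a \<notin> M" for a b
  proof -
    define N where "N = {x + r * a | x r. x \<in> M \<and> r \<in> R}"
    have MN: "x \<in> N" if "x \<in> M" for x
      using that unfolding N_def by (intro CollectI exI[of _ x] exI[of _ 0]) auto
    have N: "is_submodule R N" unfolding N_def by (rule submodule_adjoin[OF sub(1)])
    have "a \<in> N" using submodule_0[OF sub(1)] unfolding N_def
      by (intro CollectI exI[of _ 0] exI[of _ 1]) auto
    have "N \<subseteq> R" using sub ab unfolding N_def by (auto intro!: R_add R_mult)
    have "\<not> (\<exists>M'\<in>t_Max R. N \<subseteq> M')"
      using t_Max_antichain[OF M] MN \<open>a \<in> N\<close> ab(4) by blast
    then obtain A where A: "A \<subseteq> N" "GV R A"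
      using GV_or_t_Max[OF N \<open>N \<subseteq> R\<close> MN[OF m(1)] m(2)] by blast
    have "b * y \<in> M" if "y \<in> N" for y
    proof -
      obtain u s where "y = u + s * a" "u \<in> M" "s \<in> R" using \<open>y \<in> N\<close> unfolding N_def by blast
      moreover from this have "b * u + s * (a * b) \<in> M"
        using sub ab by (intro submodule_add) (auto intro: submodule_scale)
      ultimately show ?thesis by (simp add: algebra_simps)
    qed
    then have "(*) b ` A \<subseteq> M" using A by auto
    moreover have "b \<in> v_op R ((*) b ` A)"
      unfolding v_op_iff
    proof (intro allI impI)
      fix z assume "\<forall>x\<in>(*) b ` A. z * x \<in> R"
      then have "\<forall>x\<in>A. (b * z) * x \<in> R" by (auto simp: ac_simps)
      then show "b * z \<in> R" using A(2) by (auto simp: GV_def)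
    qed
    moreover have "finite ((*) b ` A)" using A(2) by (auto simp: GV_def)
    ultimately show ?thesis using t_op_iff[OF nz] tM by blast
  qed
  moreover have "1 \<notin> M" using t_Max_no_GV[OF M, of "{1}"] GV_one by auto
  ultimately show ?thesis using sub unfolding prime_ideal_of_def by blast
qed

lemma principal_no_GV:
  assumes "y \<in> R" "1 / y \<notin> R" "A \<subseteq> (*) y ` R"
  shows "\<not> GV R A"
proof (cases "y = 0")
  case True
  with assms show ?thesis by simp
next
  case False
  then have "\<forall>a\<in>A. (1 / y) * a \<in> R" using assms by auto
  with assms show ?thesis unfolding GV_def by blast
qed

text \<open>A nonzero nonunit \<open>y\<close> exists because \<open>R\<close> is not a field, and
  \<open>1 / y\<close> shows that \<open>y R\<close> contains no Glaz-Vasconcelos set.\<close>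

lemma t_Max_nonempty: "t_Max R \<noteq> {}"
proof -
  obtain y where y: "y \<in> R" "y \<noteq> 0" "1 / y \<notin> R"
    using nonfield subring by (auto simp: is_subfield_def inverse_eq_divide)
  have "is_submodule R ((*) y ` R)" by (rule submodule_scaled[OF submodule_R])
  moreover have "(*) y ` R \<subseteq> R" "y * 1 \<in> (*) y ` R" using y R_mult by auto
  ultimately show ?thesis
    using GV_or_t_Max[of "(*) y ` R" y] principal_no_GV[OF y(1,3)] y by auto
qed

section \<open>The w-operation and w-stability\<close>

lemma w_op_iff_local:
  assumes "is_submodule R I"
  shows "x \<in> w_op R I \<longleftrightarrow> (\<forall>M\<in>t_Max R. \<exists>s\<in>R - M. s * x \<in> I)"
  unfolding w_op_def using product_localization[OF t_Max_prime assms]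
    mem_fractions_prime[OF t_Max_prime assms] by auto

lemma w_op_iff:
  assumes I: "is_submodule R I"
  shows "x \<in> w_op R I \<longleftrightarrow> (\<exists>A. GV R A \<and> (\<forall>a\<in>A. a * x \<in> I))"
proof
  assume "\<exists>A. GV R A \<and> (\<forall>a\<in>A. a * x \<in> I)"
  then obtain A where A: "GV R A" "\<forall>a\<in>A. a * x \<in> I" by blast
  have "\<exists>s\<in>R - M. s * x \<in> I" if M: "M \<in> t_Max R" for M
  proof -
    have "\<not> A \<subseteq> M" "A \<subseteq> R" using t_Max_no_GV[OF M] A(1) by (auto simp: GV_def)
    then show ?thesis using A(2) by blast
  qed
  then show "x \<in> w_op R I" unfolding w_op_iff_local[OF I] by blast
next
  assume x: "x \<in> w_op R I"
  define B where "B = {r \<in> R. r * x \<in> I}"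
  have B: "is_submodule R B" "B \<subseteq> R"
    using I by (auto simp: B_def is_submodule_def R_add R_mult distrib_right mult.assoc)
  have noM: "\<not> (\<exists>M\<in>t_Max R. B \<subseteq> M)"
    using x unfolding w_op_iff_local[OF I] B_def by blast
  \<comment> \<open>\<open>GV_or_t_Max\<close> asks for a nonzero element of \<open>B\<close>; it
    exists because \<open>B\<close> is not inside \<open>M\<close>, whereas 0 is.\<close>
  obtain M where M: "M \<in> t_Max R" using t_Max_nonempty by blast
  then have "\<not> B \<subseteq> M" "0 \<in> M" using noM submodule_0[OF t_Max_submodule] by blast+
  then obtain y where "y \<in> B" "y \<noteq> 0" by blast
  then obtain A where "A \<subseteq> B" "GV R A" using GV_or_t_Max[OF B] noM by blast
  then show "\<exists>A. GV R A \<and> (\<forall>a\<in>A. a * x \<in> I)" unfolding B_def by blast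
qed

lemma w_op_superset: "is_submodule R I \<Longrightarrow> I \<subseteq> w_op R I"
  using GV_one by (metis mult_1 singletonD subsetI w_op_iff)

lemma w_op_mono: "is_submodule R I \<Longrightarrow> is_submodule R J \<Longrightarrow> I \<subseteq> J \<Longrightarrow> w_op R I \<subseteq> w_op R J"
  using w_op_iff by (metis subsetD subsetI)

lemma w_op_R: "w_op R R = R"
  using w_op_superset[OF submodule_R]
  by (auto simp: w_op_iff[OF submodule_R] GV_def mult.commute)

text \<open>Multipliers outside a prime can be multiplied together, so the local description avoids
  products of Glaz-Vasconcelos sets. Idempotence below uses the same device.\<close>

lemma submodule_w_op: assumes I: "is_submodule R I" shows "is_submodule R (w_op R I)"
proof -
  have "x + y \<in> w_op R I" if xy: "x \<in> w_op R I" "y \<in> w_op R I" for x y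
    unfolding w_op_iff_local[OF I]
  proof
    fix M assume M: "M \<in> t_Max R"
    obtain s t where st: "s \<in> R - M" "s * x \<in> I" "t \<in> R - M" "t * y \<in> I"
      using xy M unfolding w_op_iff_local[OF I] by blast
    then have "t * (s * x) + s * (t * y) \<in> I"
      using I by (blast intro: submodule_add submodule_scale)
    then have "(s * t) * (x + y) \<in> I" by (simp add: algebra_simps)
    then show "\<exists>s\<in>R - M. s * (x + y) \<in> I"
      using prime_compl(4)[OF t_Max_prime[OF M]] st by blast
  qed
  moreover have "r * x \<in> w_op R I" if "r \<in> R" "x \<in> w_op R I" for r x
    using that submodule_scale[OF I \<open>r \<in> R\<close>] unfolding w_op_iff[OF I] by (metis mult.left_commute)
  ultimately show ?thesis
    using submodule_0[OF I] w_op_superset[OF I] unfolding is_submodule_def by blast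
qed

lemma w_op_idem: assumes I: "is_submodule R I" shows "w_op R (w_op R I) = w_op R I"
proof
  show "w_op R (w_op R I) \<subseteq> w_op R I"
  proof
    fix x assume x: "x \<in> w_op R (w_op R I)"
    show "x \<in> w_op R I"
      unfolding w_op_iff_local[OF I]
    proof
      fix M assume M: "M \<in> t_Max R"
      obtain s where s: "s \<in> R - M" "s * x \<in> w_op R I"
        using x M unfolding w_op_iff_local[OF submodule_w_op[OF I]] by blast
      then obtain t where t: "t \<in> R - M" "t * (s * x) \<in> I"
        using M unfolding w_op_iff_local[OF I] by blast
      then show "\<exists>s\<in>R - M. s * x \<in> I"
        using prime_compl(4)[OF t_Max_prime[OF M] t(1) s(1)] by (metis mult.assoc)
    qed
  qed
  show "w_op R I \<subseteq> w_op R (w_op R I)" by (rule w_op_superset[OF submodule_w_op[OF I]])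
qed

text \<open>Each maximal \<open>t\<close>-ideal is prime and misses an element of the Glaz--Vasconcelos set, hence all
  powers of it.\<close>
lemma w_op_powersI:
  assumes I: "is_submodule R I" and A: "GV R A" "\<And>a. a \<in> A \<Longrightarrow> \<exists>k. a ^ k * x \<in> I"
  shows "x \<in> w_op R I"
  unfolding w_op_iff_local[OF I]
proof
  fix M assume M: "M \<in> t_Max R"
  have "\<not> A \<subseteq> M" "A \<subseteq> R" using t_Max_no_GV[OF M] A(1) by (auto simp: GV_def)
  then obtain a where a: "a \<in> A" "a \<in> R - M" by blast
  have "a ^ k \<in> R - M" for k
    using prime_compl[OF t_Max_prime[OF M]] a by (induction k) auto
  then show "\<exists>s\<in>R - M. s * x \<in> I" using A(2)[OF a(1)] by blast
qed

text \<open>The endomorphism ring of the \<open>w\<close>-closed module \<open>W\<close> is itself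
  \<open>w\<close>-closed, which bounds the closure of the product from above. Conversely, a
  Glaz-Vasconcelos set inside the product stays there after multiplication by any
  endomorphism.\<close>

lemma w_stable_ideal_iff:
  assumes I: "is_submodule R I"
  defines "W \<equiv> w_op R I"
  shows "w_stable_ideal R I \<longleftrightarrow> 1 \<in> w_op R (ideal_product W (ideal_colon (endo_ring W) W))"
proof -
  let ?A = "ideal_product W (ideal_colon (endo_ring W) W)" and ?E = "endo_ring W"
  have W: "is_submodule R W" unfolding W_def by (rule submodule_w_op[OF I])
  have A: "is_submodule R ?A" by (rule submodule_ideal_product[OF W])
  have E: "is_submodule R ?E" unfolding endo_ring_def by (rule submodule_ideal_colon[OF W])
  have "w_op R ?E \<subseteq> ?E"
  proof
    fix x assume "x \<in> w_op R ?E"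
    then obtain B where B: "GV R B" "\<And>b. b \<in> B \<Longrightarrow> b * x \<in> ?E" unfolding w_op_iff[OF E] by blast
    have "x * y \<in> w_op R W" if "y \<in> W" for y
      unfolding w_op_iff[OF W] using B that by (metis endo_ring_iff mult.assoc)
    then show "x \<in> ?E" unfolding endo_ring_iff using w_op_idem[OF I] W_def by auto
  qed
  then have 1: "w_op R ?A \<subseteq> ?E"
    using w_op_mono[OF A E product_colon_endo_subset[OF W]] by blast
  show ?thesis
  proof
    assume "w_stable_ideal R I"
    then show "1 \<in> w_op R ?A" unfolding w_stable_ideal_def Let_def W_def using one_in_endo by blast
  next
    assume "1 \<in> w_op R ?A"
    then obtain B where B: "GV R B" "\<And>b. b \<in> B \<Longrightarrow> b \<in> ?A" unfolding w_op_iff[OF A] by auto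
    have "e \<in> w_op R ?A" if "e \<in> ?E" for e
      unfolding w_op_iff[OF A] using B product_colon_endo_scale[OF that] by (metis mult.commute)
    with 1 show "w_stable_ideal R I" unfolding w_stable_ideal_def Let_def W_def by blast
  qed
qed

end

section \<open>Polynomial rings\<close>

lemma polys_over_add:
  "is_submodule R N \<Longrightarrow> p \<in> polys_over N \<Longrightarrow> q \<in> polys_over N \<Longrightarrow> p + q \<in> polys_over N"
  by (simp add: polys_over_def submodule_add)

lemma polys_over_mult:
  "is_submodule R N \<Longrightarrow> p \<in> polys_over R \<Longrightarrow> q \<in> polys_over N \<Longrightarrow> p * q \<in> polys_over N"
  by (auto simp: polys_over_def coeff_mult intro!: submodule_sum submodule_scale)

lemma polys_over_smult:
  "is_submodule R N \<Longrightarrow> c \<in> R \<Longrightarrow> q \<in> polys_over N \<Longrightarrow> smult c q \<in> polys_over N"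
  by (auto simp: polys_over_def intro: submodule_scale)

lemma polys_over_0: "is_submodule R N \<Longrightarrow> 0 \<in> polys_over N"
  by (simp add: polys_over_def submodule_0)

lemma polys_over_mono: "N \<subseteq> N' \<Longrightarrow> polys_over N \<subseteq> polys_over N'"
  by (auto simp: polys_over_def)

lemma polys_over_iff_coeffs: "0 \<in> N \<Longrightarrow> p \<in> polys_over N \<longleftrightarrow> set (coeffs p) \<subseteq> N"
proof -
  assume "0 \<in> N"
  then have "set (coeffs p) \<subseteq> N \<longleftrightarrow> range (coeff p) \<subseteq> N" by (simp add: range_coeff)
  then show ?thesis by (auto simp: polys_over_def)
qed

lemma polys_over_const: "is_submodule R N \<Longrightarrow> [:c:] \<in> polys_over N \<longleftrightarrow> c \<in> N"
  by (auto simp: polys_over_iff_coeffs submodule_0 cCons_def)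

lemma to_fract_mem_polynomial_ring [simp]: "to_fract p \<in> polynomial_ring N \<longleftrightarrow> p \<in> polys_over N"
  by (auto simp: polynomial_ring_def)

lemma polynomial_ring_mono: "N \<subseteq> N' \<Longrightarrow> polynomial_ring N \<subseteq> polynomial_ring N'"
  unfolding polynomial_ring_def using polys_over_mono by blast

lemma to_fract_divide_const:
  fixes z :: "'a::field poly fract"
  assumes "z * to_fract [:a:] = to_fract p" "a \<noteq> 0"
  shows "z = to_fract (smult (1 / a) p)"
proof -
  have "to_fract (smult (1 / a) p) * to_fract [:a:] = to_fract p"
    using assms(2) unfolding to_fract_mult[symmetric] by simp
  with assms show ?thesis by (metis mult_cancel_right pCons_eq_0_iff to_fract_eq_0_iff)
qed

lemma submodule_polynomial_ring:
  assumes "is_submodule R N"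
  shows "is_submodule (polynomial_ring R) (polynomial_ring N)"
  unfolding is_submodule_def
proof (intro conjI ballI)
  show "0 \<in> polynomial_ring N"
    using polys_over_0[OF assms] unfolding polynomial_ring_def by (metis imageI to_fract_0)
next
  fix x y assume "x \<in> polynomial_ring N" "y \<in> polynomial_ring N"
  then show "x + y \<in> polynomial_ring N"
    using polys_over_add[OF assms] by (auto simp: polynomial_ring_def simp flip: to_fract_add)
next
  fix x y assume "x \<in> polynomial_ring R" "y \<in> polynomial_ring N"
  then show "x * y \<in> polynomial_ring N"
    using polys_over_mult[OF assms] by (auto simp: polynomial_ring_def simp flip: to_fract_mult)
qed

section \<open>A weak Dedekind-Mertens lemma\<close>

context field_subring
begin

lemma polys_over_diff:
  "is_submodule R N \<Longrightarrow> p \<in> polys_over N \<Longrightarrow> q \<in> polys_over N \<Longrightarrow> p - q \<in> polys_over N"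
  by (simp add: polys_over_def submodule_diff)

lemma polys_over_monom: "is_submodule R N \<Longrightarrow> c \<in> N \<Longrightarrow> monom c n \<in> polys_over N"
  by (auto simp: polys_over_def submodule_0)

text \<open>Induction on the degree of \<open>z\<close>: the top coefficient \<open>a * b\<close> of
  \<open>h * z\<close> lies in \<open>N\<close>, so the leading term of \<open>z\<close> can be
  removed at the cost of one factor \<open>a\<close>. The bound \<open>n\<close> is strict, with
  zero listed separately, because the zero polynomial has degree 0.\<close>

lemma dedekind_mertens_lead:
  assumes N: "is_submodule R N" and h: "h \<in> polys_over R"
  shows "h * z \<in> polys_over N \<Longrightarrow> z = 0 \<or> degree z < n
    \<Longrightarrow> \<exists>k. smult (lead_coeff h ^ k) z \<in> polys_over N"
proof (induction n arbitrary: z)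
  case 0
  then show ?case using polys_over_0[OF N] by auto
next
  case (Suc n)
  define a b m where "a = lead_coeff h" and "b = lead_coeff z" and "m = degree z"
  have aR: "a \<in> R" using h by (simp add: a_def polys_over_def)
  have ab: "a * b \<in> N"
    using Suc.prems(1) coeff_mult_degree_sum[of h z] by (metis (no_types, lifting) a_def b_def mem_Collect_eq polys_over_def)
  define z' where "z' = smult a z - monom (a * b) m"
  have M: "monom (a * b) m \<in> polys_over N" by (rule polys_over_monom[OF N ab])
  have "h * z' = smult a (h * z) - h * monom (a * b) m"
    by (simp add: z'_def right_diff_distrib)
  then have "h * z' \<in> polys_over N"
    using polys_over_diff[OF N polys_over_smult[OF N aR Suc.prems(1)] polys_over_mult[OF N h M]] by simp
  moreover have "z' = 0 \<or> degree z' < n"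
  proof (rule disjCI)
    assume nz: "\<not> degree z' < n"
    have "coeff z' i = 0" if "i \<ge> n" for i
    proof -
      have "coeff z i = 0" if "i \<noteq> m"
        using that Suc.prems(2) \<open>i \<ge> n\<close> by (intro coeff_eq_0) (auto simp: m_def)
      then show ?thesis by (auto simp: z'_def b_def m_def)
    qed
    then show "z' = 0"
      using nz by (metis leading_coeff_0_iff linorder_not_less)
  qed
  ultimately obtain k where k: "smult (a ^ k) z' \<in> polys_over N"
    using Suc.IH a_def by blast
  have "smult (a ^ k) z' + smult (a ^ k) (monom (a * b) m) \<in> polys_over N"
    by (intro polys_over_add[OF N] k polys_over_smult[OF N] M R_power aR)
  then have "smult (a ^ Suc k) z \<in> polys_over N"
    by (simp add: z'_def smult_diff_right mult.commute)
  then show ?case unfolding a_def by blast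
qed

text \<open>Induction on the degree of \<open>h\<close>. With its leading term removed,
  \<open>h' * y\<close> still lies over \<open>N\<close> once \<open>h * y\<close> and
  \<open>a * y\<close> do. For \<open>y = c^l a^t z\<close> the induction hypothesis trades one
  factor \<open>a\<close> for factors \<open>c\<close>, until no \<open>a\<close> is left. The
  exponent is not tracked, since \<open>w_op_powersI\<close> accepts any power.\<close>

lemma dedekind_mertens:
  assumes N: "is_submodule R N" and "h \<in> polys_over R" "h * z \<in> polys_over N"
  shows "\<exists>k. smult (coeff h i ^ k) z \<in> polys_over N"
proof -
  have "\<exists>k. smult (coeff h i ^ k) z \<in> polys_over N"
    if "h \<in> polys_over R" "h * z \<in> polys_over N" "h = 0 \<or> degree h < n" for n h z
    using that
  proof (induction n arbitrary: h z)
    case 0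
    then show ?case using polys_over_0[OF N] by (auto intro: exI[of _ 1])
  next
    case (Suc n)
    note outer_IH = Suc.IH and outer_prems = Suc.prems
    define a m where "a = lead_coeff h" and "m = degree h"
    define h' where "h' = h - monom a m"
    have aR: "a \<in> R" using Suc.prems(1) by (simp add: a_def polys_over_def)
    have h'R: "h' \<in> polys_over R"
      unfolding h'_def by (intro polys_over_diff[OF submodule_R] Suc.prems polys_over_monom[OF submodule_R] aR)
    have h'n: "h' = 0 \<or> degree h' < n"
    proof (rule disjCI)
      assume nz: "\<not> degree h' < n"
      have "coeff h' i = 0" if "i \<ge> n" for i
      proof -
        have "coeff h i = 0" if "i \<noteq> m"
          using that Suc.prems(3) \<open>i \<ge> n\<close> by (intro coeff_eq_0) (auto simp: m_def)
        then show ?thesis by (auto simp: h'_def a_def m_def)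
      qed
      then show "h' = 0"
        using nz by (metis leading_coeff_0_iff linorder_not_less)
    qed
    obtain k where k: "smult (a ^ k) z \<in> polys_over N"
      using dedekind_mertens_lead[OF N Suc.prems(1,2), of "Suc (degree z)"] a_def by auto
    show ?case
    proof (cases "i = m")
      case True
      then show ?thesis using k unfolding a_def m_def by blast
    next
      case False
      define c where "c = coeff h i"
      have cR: "c \<in> R" using Suc.prems(1) by (simp add: c_def polys_over_def)
      have ch': "coeff h' i = c" using False by (simp add: h'_def c_def)
      have "\<exists>l. smult (c ^ l * a ^ t) z \<in> polys_over N \<Longrightarrow> \<exists>l. smult (c ^ l) z \<in> polys_over N" for t
      proof (induction t)
        case 0
        then show ?case by simp
      next
        case (Suc t)
        then obtain l where l: "smult (c ^ l * a ^ Suc t) z \<in> polys_over N" by blast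
        define y where "y = smult (c ^ l * a ^ t) z"
        have "h' * y = smult (c ^ l * a ^ t) (h * z) - monom 1 m * smult (c ^ l * a ^ Suc t) z"
        proof -
          have "monom a m = smult a (monom 1 m)" by (simp add: smult_monom)
          then show ?thesis
            by (simp add: h'_def y_def smult_diff_right algebra_simps)
        qed
        moreover have "c ^ l * a ^ t \<in> R" by (intro R_mult R_power cR aR)
        ultimately have "h' * y \<in> polys_over N"
          using polys_over_diff[OF N polys_over_smult[OF N _ outer_prems(2)]
              polys_over_mult[OF N polys_over_monom[OF submodule_R R_1] l]] by simp
        then obtain l' where "smult (c ^ l') y \<in> polys_over N"
          using outer_IH[OF h'R _ h'n] ch' by metis
        then have "smult (c ^ (l' + l) * a ^ t) z \<in> polys_over N"
          by (simp add: y_def power_add mult.assoc)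
        then show ?case using Suc.IH by blast
      qed
      moreover have "\<exists>l. smult (c ^ l * a ^ k) z \<in> polys_over N" using k by (intro exI[of _ 0]) simp
      ultimately show ?thesis unfolding c_def by blast
    qed
  qed
  from this[of h z "Suc (degree h)"] assms show ?thesis by simp
qed

end

context nonfield_domain
begin

lemma dwqf: "domain_with_quotient_field R"
  unfolding domain_with_quotient_field_def using subring quotients by blast

lemma one_in_polys_over: "1 \<in> polys_over R"
  by (auto simp: polys_over_def coeff_1)

lemma nonfield_domain_polynomial_ring: "nonfield_domain (polynomial_ring R)"
proof -
  have dq: "domain_with_quotient_field (polynomial_ring R)"
    by (rule domain_with_quotient_field_polynomial_ring[OF dwqf])
  have "\<not> is_subfield (polynomial_ring R)"
  proof
    assume F: "is_subfield (polynomial_ring R)"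
    have "to_fract [:0, 1:] \<in> polynomial_ring R"
      by (auto simp: polys_over_def coeff_pCons split: nat.split)
    then have "inverse (to_fract [:0, 1:]) \<in> polynomial_ring R"
      using F unfolding is_subfield_def by (metis one_neq_zero pCons_eq_0_iff to_fract_eq_0_iff)
    then obtain p :: "'k poly" where "inverse (to_fract [:0, 1:]) = to_fract p"
      unfolding polynomial_ring_def by blast
    then have "to_fract ([:0, 1:] * p) = 1"
      unfolding to_fract_mult by (metis one_neq_zero pCons_eq_0_iff to_fract_eq_0_iff right_inverse)
    then have "[:0, 1:] * p = 1" by (metis to_fract_1 to_fract_eq_iff)
    then show False by (metis dvdI is_unit_pCons_iff zero_neq_one pCons_eq_iff one_pCons pCons_0_0)
  qed
  with dq show ?thesis
    unfolding domain_with_quotient_field_def nonfield_domain_def nonfield_domain_axioms_def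
      field_subring_def by blast
qed

lemma N_v_iff: "h \<in> N_v R \<longleftrightarrow> GV R (set (coeffs h))"
proof -
  have R_coeffs: "h \<in> polys_over R \<longleftrightarrow> set (coeffs h) \<subseteq> R"
    by (rule polys_over_iff_coeffs[OF R_0])
  have "h \<noteq> 0" if "GV R (set (coeffs h))"
  proof
    \<comment> \<open>The zero polynomial has no coefficients, and the empty set is Glaz-Vasconcelos
      only if \<open>R\<close> is the whole field.\<close>
    assume "h = 0"
    with that have "x \<in> R" for x by (simp add: GV_def)
    with subring nonfield show False by (simp add: is_subfield_def)
  qed
  moreover have "v_op R (set (coeffs h)) = R" if "GV R (set (coeffs h))"
  proof
    show "v_op R (set (coeffs h)) \<subseteq> R"
    proof
      fix x assume "x \<in> v_op R (set (coeffs h))"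
      then have "x * 1 \<in> R" using that unfolding v_op_iff GV_def by (metis mult_1 subsetD)
      then show "x \<in> R" by simp
    qed
    have "1 \<in> v_op R (set (coeffs h))" using that GV_iff_v_op GV_def by metis
    then show "R \<subseteq> v_op R (set (coeffs h))"
      using submodule_scale[OF submodule_v_op, of _ 1] by auto
  qed
  ultimately show ?thesis
    unfolding N_v_def content_ideal_def v_op_ideal_generated
    using R_coeffs GV_iff_v_op[of "set (coeffs h)"] by (auto simp: GV_def)
qed

lemma GV_coeffsI:
  assumes "GV R B" "B \<subseteq> range (coeff p)" "p \<in> polys_over R"
  shows "GV R (set (coeffs p))"
proof -
  have "x \<in> R" if "\<forall>a\<in>set (coeffs p). x * a \<in> R" for x
  proof -
    have "\<forall>a\<in>B. x * a \<in> R" using that assms(2) by (auto simp: range_coeff)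
    then show ?thesis using assms(1) by (simp add: GV_def)
  qed
  moreover have "set (coeffs p) \<subseteq> R" using assms(3) by (simp add: polys_over_iff_coeffs)
  ultimately show ?thesis by (simp add: GV_def)
qed

lemma N_v_polys: "h \<in> N_v R \<Longrightarrow> h \<in> polys_over R" and N_v_nonzero: "h \<in> N_v R \<Longrightarrow> h \<noteq> 0"
  by (auto simp: N_v_def)

text \<open>By Dedekind-Mertens some power of each coefficient of \<open>h\<close> moves
  \<open>z\<close> over \<open>N\<close>, and these coefficients form a Glaz-Vasconcelos set. For a
  \<open>w\<close>-closed \<open>N\<close> this permits division by \<open>h\<close>.\<close>

lemma w_op_coeffs:
  assumes N: "is_submodule R N" and h: "h \<in> N_v R" and "h * z \<in> polys_over N"
  shows "z \<in> polys_over (w_op R N)"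
proof -
  have "coeff z i \<in> w_op R N" for i
  proof (rule w_op_powersI[OF N])
    show "GV R (set (coeffs h))" using h by (simp add: N_v_iff)
    fix a assume "a \<in> set (coeffs h)"
    then obtain j where j: "a = coeff h j" using range_coeff[of h] by (metis imageE insertI2)
    obtain k where "smult (a ^ k) z \<in> polys_over N"
      unfolding j using dedekind_mertens[OF N N_v_polys[OF h] assms(3)] by blast
    then have "coeff (smult (a ^ k) z) i \<in> N" unfolding polys_over_def by blast
    then show "\<exists>k. a ^ k * coeff z i \<in> N" by auto
  qed
  then show ?thesis by (simp add: polys_over_def)
qed

lemma N_v_one: "1 \<in> N_v R"
  by (simp add: N_v_iff GV_one)

lemma N_v_not_in_t_Max: "M \<in> t_Max R \<Longrightarrow> h \<in> N_v R \<Longrightarrow> h \<notin> polys_over M"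
  using t_Max_no_GV[of M "set (coeffs h)"] submodule_0[OF t_Max_submodule]
  by (auto simp: N_v_iff polys_over_iff_coeffs)

text \<open>The coefficients of the elements of an ideal of \<open>R[X]\<close> form an ideal, since shifting by powers of
  the indeterminate aligns any two of them.\<close>
lemma N_v_or_t_Max:
  assumes A: "is_submodule (polynomial_ring R) A" "A \<subseteq> polynomial_ring R"
    and p: "to_fract p \<in> A" "p \<noteq> 0"
  shows "(\<exists>h\<in>N_v R. to_fract h \<in> A) \<or> (\<exists>M\<in>t_Max R. A \<subseteq> polynomial_ring M)"
proof -
  define C where "C = {coeff p i | p i. to_fract p \<in> A}"
  have shift: "to_fract (monom 1 n * p) \<in> A" if "to_fract p \<in> A" for p n
    unfolding to_fract_mult
    using that A(1) polys_over_monom[OF submodule_R R_1]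
    by (intro submodule_scale[OF A(1)]) auto
  have padd: "to_fract (p + q) \<in> A" if "to_fract p \<in> A" "to_fract q \<in> A" for p q
    unfolding to_fract_add using that submodule_add[OF A(1)] by blast
  have "x + y \<in> C" if "x \<in> C" "y \<in> C" for x y
  proof -
    obtain p i where p: "x = coeff p i" "to_fract p \<in> A" using \<open>x \<in> C\<close> unfolding C_def by blast
    obtain q j where q: "y = coeff q j" "to_fract q \<in> A" using \<open>y \<in> C\<close> unfolding C_def by blast
    have "x + y = coeff (monom 1 j * p + monom 1 i * q) (i + j)"
      using p q by (simp add: coeff_monom_mult)
    with padd[OF shift[OF p(2)] shift[OF q(2)]] show ?thesis unfolding C_def by blast
  qed
  moreover have "r * x \<in> C" if "r \<in> R" "x \<in> C" for r x
  proof -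
    obtain p i where p: "x = coeff p i" "to_fract p \<in> A" using \<open>x \<in> C\<close> unfolding C_def by blast
    have "to_fract ([:r:] * p) \<in> A"
      unfolding to_fract_mult using p(2) \<open>r \<in> R\<close>
      by (intro submodule_scale[OF A(1)]) (auto simp: polys_over_const[OF submodule_R])
    moreover have "r * x = coeff ([:r:] * p) i" using p by simp
    ultimately show ?thesis unfolding C_def by blast
  qed
  moreover have "0 \<in> C"
    using p(1) coeff_eq_0[of p "Suc (degree p)"] unfolding C_def by force
  ultimately have sub: "is_submodule R C" unfolding is_submodule_def by blast
  have CR: "C \<subseteq> R" using A(2) by (auto simp: C_def polys_over_def)
  have "lead_coeff p \<in> C" "lead_coeff p \<noteq> 0" using p unfolding C_def by auto
  from GV_or_t_Max[OF sub CR this] show ?thesis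
  proof
    assume "\<exists>B\<subseteq>C. GV R B"
    then obtain B where B: "B \<subseteq> C" "GV R B" by blast
    have "\<exists>q. to_fract q \<in> A \<and> B' \<subseteq> range (coeff q)" if "finite B'" "B' \<subseteq> C" for B'
      using that
    proof (induction B' rule: finite_induct)
      case empty
      then show ?case using p(1) by blast
    next
      case (insert b B')
      then obtain q where q: "to_fract q \<in> A" "B' \<subseteq> range (coeff q)" by blast
      obtain r j where r: "b = coeff r j" "to_fract r \<in> A" using insert.prems unfolding C_def by blast
      \<comment> \<open>A shift past the degree of \<open>q\<close> keeps the coefficients of
        \<open>q\<close> and \<open>r\<close> apart, so that one element of \<open>A\<close>
        collects both.\<close>
      define n where "n = Suc (degree q)"
      define s where "s = q + monom 1 n * r"
      have "coeff s (n + j) = b"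
        using r coeff_eq_0[of q "n + j"] by (simp add: s_def n_def coeff_monom_mult)
      moreover have "coeff q i \<in> range (coeff s)" for i
      proof (cases "i < n")
        case True
        then have "coeff s i = coeff q i" by (simp add: s_def coeff_monom_mult)
        then show ?thesis by (metis rangeI)
      next
        case False
        then have "coeff q i = 0" by (intro coeff_eq_0) (simp add: n_def)
        then show ?thesis using range_coeff[of s] by simp
      qed
      ultimately have "insert b B' \<subseteq> range (coeff s)" using q(2) by auto
      moreover have "to_fract s \<in> A" unfolding s_def by (intro padd shift q r)
      ultimately show ?case by blast
    qed
    moreover have "finite B" using B by (simp add: GV_def)
    ultimately obtain q where q: "to_fract q \<in> A" "B \<subseteq> range (coeff q)" using B(1) by blast
    then have "q \<in> N_v R" unfolding N_v_iff using A(2) by (intro GV_coeffsI[OF B(2)]) auto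
    with q show ?thesis by blast
  next
    assume "\<exists>M\<in>t_Max R. C \<subseteq> M"
    then obtain M where M: "M \<in> t_Max R" "C \<subseteq> M" by blast
    have "A \<subseteq> polynomial_ring M"
    proof
      fix x assume "x \<in> A"
      then obtain q where "x = to_fract q" "to_fract q \<in> A" using A(2) by (auto simp: polynomial_ring_def)
      then show "x \<in> polynomial_ring M" using M(2) by (auto simp: C_def polys_over_def)
    qed
    with M show ?thesis by blast
  qed
qed

text \<open>A constant that multiplies all coefficients of members of \<open>B\<close> into
  \<open>R\<close> multiplies \<open>B\<close> into the polynomial ring, hence lies in
  \<open>R\<close>. So these coefficients would form a Glaz-Vasconcelos set inside
  \<open>M\<close>.\<close>

lemma GV_polynomial_ring_coeffs:
  assumes "GV (polynomial_ring R) B" "B \<subseteq> polynomial_ring M" "M \<in> t_Max R"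
  shows False
proof -
  define C where "C = \<Union>((\<lambda>p. set (coeffs p)) ` (to_fract -` B))"
  have "finite (to_fract -` B :: 'k poly set)"
    using assms(1) by (intro finite_vimageI) (auto simp: GV_def inj_on_def)
  then have "finite C" by (auto simp: C_def)
  have coeffs: "set (coeffs p) \<subseteq> M" if "to_fract p \<in> B" for p
    using that assms(2) submodule_0[OF t_Max_submodule[OF assms(3)]]
    by (auto simp: polys_over_iff_coeffs[symmetric])
  then have CM: "C \<subseteq> M" by (auto simp: C_def)
  have "x \<in> R" if x: "\<forall>a\<in>C. x * a \<in> R" for x
  proof -
    have "to_fract [:x:] * b \<in> polynomial_ring R" if b: "b \<in> B" for b
    proof -
      obtain p where p: "b = to_fract p" using b assms(2) by (auto simp: polynomial_ring_def)
      have "x * coeff p i \<in> R" for i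
      proof (cases "coeff p i = 0")
        case False
        then have "coeff p i \<in> C"
          unfolding C_def using p b range_coeff[of p] by (auto intro!: bexI[of _ p])
        with x show ?thesis by blast
      qed simp
      then show ?thesis unfolding p to_fract_mult[symmetric] by (simp add: polys_over_def)
    qed
    then have "to_fract [:x:] \<in> polynomial_ring R" using assms(1) unfolding GV_def by blast
    then show ?thesis by (simp add: polys_over_const[OF submodule_R])
  qed
  with \<open>finite C\<close> CM t_Max_subset[OF assms(3)] have "GV R C" by (auto simp: GV_def)
  with t_Max_no_GV[OF assms(3) CM] show False by blast
qed

lemma GV_polynomial_ring_N_v:
  assumes A: "is_submodule (polynomial_ring R) A" "A \<subseteq> polynomial_ring R"
    and B: "GV (polynomial_ring R) B" "B \<subseteq> A"
  shows "\<exists>h\<in>N_v R. to_fract h \<in> A"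
proof -
  have *: "\<not> A \<subseteq> polynomial_ring M" if "M \<in> t_Max R" for M
    using GV_polynomial_ring_coeffs[OF B(1) _ that] B(2) by blast
  obtain M where M: "M \<in> t_Max R" using t_Max_nonempty by blast
  have "0 \<in> polynomial_ring M"
    using submodule_0[OF submodule_polynomial_ring[OF t_Max_submodule[OF M]]] .
  with *[OF M] obtain x where "x \<in> A" "x \<noteq> 0" by blast
  then obtain p where "to_fract p \<in> A" "p \<noteq> 0" using A(2) by (auto simp: polynomial_ring_def)
  with N_v_or_t_Max[OF A] * show ?thesis by blast
qed

text \<open>Division by the constant \<open>a\<close> shows that a multiplier \<open>z\<close> is a
  polynomial over the field; the condition at \<open>h\<close> then puts its coefficients into
  \<open>w_op R R = R\<close>.\<close>

lemma GV_const_N_v: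
  assumes a: "a \<in> R" "a \<noteq> 0" and h: "h \<in> N_v R"
  shows "GV (polynomial_ring R) {to_fract [:a:], to_fract h}"
  unfolding GV_def
proof (intro conjI allI impI)
  show "{to_fract [:a:], to_fract h} \<subseteq> polynomial_ring R"
    using a N_v_polys[OF h] by (simp add: polys_over_const[OF submodule_R])
  fix z assume z: "\<forall>b\<in>{to_fract [:a:], to_fract h}. z * b \<in> polynomial_ring R"
  then obtain p where "z * to_fract [:a:] = to_fract p" by (auto simp: polynomial_ring_def)
  from to_fract_divide_const[OF this a(2)] obtain q where q: "z = to_fract q" by blast
  have "to_fract (h * q) \<in> polynomial_ring R"
    using z unfolding q to_fract_mult by (simp add: mult.commute)
  then have "h * q \<in> polys_over R" unfolding to_fract_mem_polynomial_ring .
  then have "q \<in> polys_over R"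
    using w_op_coeffs[OF submodule_R h, of q] by (simp add: w_op_R)
  then show "z \<in> polynomial_ring R" by (simp add: q)
qed simp

text \<open>Division with remainder in \<open>K[X]\<close>, with denominators cleared.\<close>
lemma least_degree_dvd:
  assumes A: "is_submodule (polynomial_ring R) A" and "to_fract p0 \<in> A" "p0 \<noteq> 0"
  shows "\<exists>p. p \<noteq> 0 \<and> to_fract p \<in> A \<and> (\<forall>g. to_fract g \<in> A \<longrightarrow> p dvd g)"
proof -
  obtain p where p: "p \<noteq> 0" "to_fract p \<in> A"
    and least: "\<And>g. g \<noteq> 0 \<Longrightarrow> to_fract g \<in> A \<Longrightarrow> degree p \<le> degree g"
    using ex_has_least_nat[of "\<lambda>p. p \<noteq> 0 \<and> to_fract p \<in> A" p0 degree] assms by blast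
  have "p dvd g" if g: "to_fract g \<in> A" for g
  proof -
    obtain d where d: "d \<in> R" "d \<noteq> 0" "smult d (g div p) \<in> polys_over R"
      using clear_denominators[OF dwqf] by blast
    have "to_fract ([:d:] * g + [:-1:] * (smult d (g div p) * p)) \<in> A"
      unfolding to_fract_add to_fract_mult
      using d g p R_uminus[OF R_1] polys_over_const[OF submodule_R]
      by (intro submodule_add[OF A] submodule_scale[OF A]) auto
    moreover have "[:d:] * g + [:-1:] * (smult d (g div p) * p) = smult d (g mod p)"
      by (simp add: minus_div_mult_eq_mod[symmetric] smult_diff_right)
    ultimately have "to_fract (smult d (g mod p)) \<in> A" by (simp only:)
    moreover have "degree (g mod p) < degree p \<or> g mod p = 0"
      using degree_mod_less[OF p(1)] by auto
    ultimately have "g mod p = 0" using least[of "smult d (g mod p)"] d by force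
    then show ?thesis by (simp add: mod_eq_0_iff_dvd)
  qed
  with p show ?thesis by blast
qed

section \<open>Stability of \<open>Na_v\<close> and \<open>w\<close>-stability\<close>

lemma common_denominator:
  assumes "finite Q"
  shows "\<exists>d\<in>R. d \<noteq> 0 \<and> (\<forall>q\<in>Q. smult d q \<in> polys_over R)"
  using assms
proof (induction Q rule: finite_induct)
  case empty
  then show ?case by (intro bexI[of _ 1]) auto
next
  case (insert q Q)
  then obtain d where d: "d \<in> R" "d \<noteq> 0" "\<And>q. q \<in> Q \<Longrightarrow> smult d q \<in> polys_over R" by blast
  obtain e where e: "e \<in> R" "e \<noteq> 0" "smult e q \<in> polys_over R"
    using clear_denominators[OF dwqf] by blast
  have "smult (d * e) q \<in> polys_over R"
    using polys_over_smult[OF submodule_R d(1) e(3)] by simp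
  moreover have "smult (d * e) r \<in> polys_over R" if "r \<in> Q" for r
    using polys_over_smult[OF submodule_R e(1) d(3)[OF that]] by (simp add: mult.commute)
  ultimately show ?case using d e R_mult by (intro bexI[of _ "d * e"]) auto
qed

text \<open>A constant \<open>x\<close> that multiplies the coefficients of \<open>g * h\<close>
  into \<open>R\<close> puts \<open>g * (h * [:x:])\<close> over \<open>R\<close>;
  \<open>w_op_coeffs\<close> divides out \<open>g\<close> and then \<open>h\<close>.\<close>

lemma N_v_mult:
  assumes "g \<in> N_v R" "h \<in> N_v R"
  shows "g * h \<in> N_v R"
proof -
  have gh: "g * h \<in> polys_over R"
    using polys_over_mult[OF submodule_R] assms N_v_polys by blast
  have "x \<in> R" if x: "\<forall>a\<in>set (coeffs (g * h)). x * a \<in> R" for x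
  proof -
    have "x * a \<in> R" if "a \<in> range (coeff (g * h))" for a
      using that x by (auto simp: range_coeff)
    then have "g * (h * [:x:]) \<in> polys_over R" by (auto simp: polys_over_def mult.assoc[symmetric])
    then have "[:x:] \<in> polys_over R"
      using w_op_coeffs[OF submodule_R assms(1)] w_op_coeffs[OF submodule_R assms(2)] w_op_R by metis
    then show ?thesis by (simp add: polys_over_const[OF submodule_R])
  qed
  with gh show ?thesis by (simp add: N_v_iff GV_def polys_over_iff_coeffs)
qed

lemma N_v_fract:
  shows "to_fract ` N_v R \<subseteq> polynomial_ring R" "1 \<in> to_fract ` N_v R" "0 \<notin> to_fract ` N_v R"
    "\<And>s t. s \<in> to_fract ` N_v R \<Longrightarrow> t \<in> to_fract ` N_v R \<Longrightarrow> s * t \<in> to_fract ` N_v R"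
proof -
  show "to_fract ` N_v R \<subseteq> polynomial_ring R" using N_v_polys by auto
  show "1 \<in> to_fract ` N_v R" using N_v_one by (metis image_eqI to_fract_1)
  show "0 \<notin> to_fract ` N_v R" using N_v_nonzero by auto
  show "s * t \<in> to_fract ` N_v R" if st: "s \<in> to_fract ` N_v R" "t \<in> to_fract ` N_v R" for s t
  proof -
    obtain g h where "s = to_fract g" "t = to_fract h" "g \<in> N_v R" "h \<in> N_v R" using st by blast
    then show ?thesis using N_v_mult[of g h] by (metis image_eqI to_fract_mult)
  qed
qed

lemma mem_fractions_N_v:
  assumes "is_submodule (polynomial_ring R) I"
  shows "z \<in> fractions_with I (to_fract ` N_v R) \<longleftrightarrow> (\<exists>h\<in>N_v R. to_fract h * z \<in> I)"
proof
  assume "z \<in> fractions_with I (to_fract ` N_v R)"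
  then obtain a h where "z = a / to_fract h" "a \<in> I" "h \<in> N_v R"
    unfolding fractions_with_def by blast
  then show "\<exists>h\<in>N_v R. to_fract h * z \<in> I" using N_v_nonzero by (intro bexI[of _ h]) auto
next
  assume "\<exists>h\<in>N_v R. to_fract h * z \<in> I"
  then obtain h where h: "h \<in> N_v R" "to_fract h * z \<in> I" by blast
  then have "z = (to_fract h * z) / to_fract h" using N_v_nonzero by simp
  with h show "z \<in> fractions_with I (to_fract ` N_v R)" unfolding fractions_with_def by blast
qed

lemma field_subring_polynomial_ring: "field_subring (polynomial_ring R)"
  using nonfield_domain_polynomial_ring by (simp add: nonfield_domain_def)

lemma mem_Na_v: "z \<in> Na_v R \<longleftrightarrow> (\<exists>h\<in>N_v R. to_fract h * z \<in> polynomial_ring R)"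
  unfolding Na_v_def by (rule mem_fractions_N_v[OF submodule_polynomial_ring[OF submodule_R]])

lemma field_subring_Na_v: "field_subring (Na_v R)"
  unfolding Na_v_def field_subring_def
  by (rule field_subring.subring_fractions_with[OF field_subring_polynomial_ring N_v_fract])

lemma submodule_Na_v:
  "is_submodule (polynomial_ring R) I
    \<Longrightarrow> is_submodule (Na_v R) (fractions_with I (to_fract ` N_v R))"
  unfolding Na_v_def
  by (rule field_subring.submodule_fractions_with[OF field_subring_polynomial_ring _ N_v_fract])

lemma polynomial_ring_subset_Na_v: "polynomial_ring R \<subseteq> Na_v R"
  unfolding Na_v_def by (rule fractions_with_incl[OF N_v_fract(2)])

lemma submodule_restrict: "is_submodule T I \<Longrightarrow> R' \<subseteq> T \<Longrightarrow> is_submodule R' I"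
  unfolding is_submodule_def by blast

lemma inverse_N_v: "h \<in> N_v R \<Longrightarrow> 1 / to_fract h \<in> Na_v R"
  unfolding mem_Na_v using N_v_nonzero one_in_polys_over
  by (intro bexI[of _ h]) (auto simp: polynomial_ring_def intro: image_eqI[of _ _ 1])

lemma Na_v_divide:
  assumes "is_submodule (Na_v R) J" "h \<in> N_v R" "to_fract h * z \<in> J"
  shows "z \<in> J"
proof -
  have "1 / to_fract h * (to_fract h * z) \<in> J"
    by (rule submodule_scale[OF assms(1) inverse_N_v[OF assms(2)] assms(3)])
  then show ?thesis using N_v_nonzero[OF assms(2)] by simp
qed

text \<open>The multipliers of \<open>x\<close> into \<open>J\<close> form an ideal that contains a
  Glaz-Vasconcelos set, hence meets \<open>N_v R\<close>, whose elements are units of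
  \<open>Na_v R\<close>. So modules over \<open>Na_v R\<close> absorb the
  \<open>w\<close>-operation.\<close>

lemma w_op_subset_Na_v:
  assumes J: "is_submodule (Na_v R) J" and I: "is_submodule (polynomial_ring R) I" "I \<subseteq> J"
  shows "w_op (polynomial_ring R) I \<subseteq> J"
proof
  interpret P: nonfield_domain "polynomial_ring R" by (rule nonfield_domain_polynomial_ring)
  fix x assume "x \<in> w_op (polynomial_ring R) I"
  then obtain B where B: "GV (polynomial_ring R) B" "\<And>b. b \<in> B \<Longrightarrow> b * x \<in> I"
    unfolding P.w_op_iff[OF I(1)] by blast
  define A where "A = {r \<in> polynomial_ring R. r * x \<in> J}"
  have JP: "is_submodule (polynomial_ring R) J"
    by (rule submodule_restrict[OF J polynomial_ring_subset_Na_v])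
  have "is_submodule (polynomial_ring R) A"
    using JP by (auto simp: A_def is_submodule_def P.R_add P.R_mult distrib_right mult.assoc)
  moreover have "B \<subseteq> A" using B I(2) by (auto simp: A_def GV_def)
  ultimately obtain h where "h \<in> N_v R" "to_fract h \<in> A"
    using GV_polynomial_ring_N_v[of A B] B(1) by (auto simp: A_def)
  then show "x \<in> J" using Na_v_divide[OF J] by (auto simp: A_def)
qed

lemma Na_v_ideal_denominator:
  assumes J: "J \<in> nonzero_ideals (Na_v R)"
  obtains p where "p \<noteq> 0" "p \<in> polys_over R" "\<And>y. y \<in> J \<Longrightarrow> to_fract p * y \<in> Na_v R"
proof -
  interpret N: field_subring "Na_v R" by (rule field_subring_Na_v)
  obtain x d where d: "d \<in> Na_v R" "d \<noteq> 0" "\<And>y. y \<in> J \<Longrightarrow> d * y \<in> Na_v R"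
    using nonzero_ideals_obtain[OF J] by metis
  obtain h where h: "h \<in> N_v R" "to_fract h * d \<in> polynomial_ring R" using d(1) mem_Na_v by blast
  then obtain p where p: "to_fract h * d = to_fract p" "p \<in> polys_over R"
    by (auto simp: polynomial_ring_def)
  have "to_fract h \<in> Na_v R" using N_v_fract(1) h(1) polynomial_ring_subset_Na_v by blast
  then have "to_fract p * y \<in> Na_v R" if "y \<in> J" for y
    using N.R_mult[OF _ d(3)[OF that]] by (simp add: p(1)[symmetric] mult.assoc)
  moreover have "p \<noteq> 0" using p(1) d(2) N_v_nonzero[OF h(1)] by auto
  ultimately show thesis using that p(2) by blast
qed

text \<open>A fixed \<open>p\<close> clears \<open>J\<close> into \<open>Na_v R\<close>. The part
  \<open>I\<close> of \<open>J\<close> that \<open>p\<close> sends into the polynomial ring is a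
  fractional ideal generating \<open>J\<close> over \<open>Na_v R\<close>. Its
  \<open>w\<close>-closure stays in \<open>J\<close>, and \<open>A'\<close> absorbs the
  \<open>w\<close> in front of the product.\<close>

lemma w_stable_imp_stable_Na_v:
  assumes ws: "w_stable_domain (polynomial_ring R)"
  shows "stable_domain (Na_v R)"
  unfolding stable_domain_def
proof
  interpret P: nonfield_domain "polynomial_ring R" by (rule nonfield_domain_polynomial_ring)
  fix J assume J: "J \<in> nonzero_ideals (Na_v R)"
  have Jsub: "is_submodule (Na_v R) J" by (rule nonzero_ideals_submodule[OF J])
  have JP: "is_submodule (polynomial_ring R) J"
    by (rule submodule_restrict[OF Jsub polynomial_ring_subset_Na_v])
  obtain p where p: "p \<noteq> 0" "p \<in> polys_over R" "\<And>y. y \<in> J \<Longrightarrow> to_fract p * y \<in> Na_v R"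
    using Na_v_ideal_denominator[OF J] by blast
  define I where "I = {y \<in> J. to_fract p * y \<in> polynomial_ring R}"
  have I: "is_submodule (polynomial_ring R) I"
    using JP unfolding I_def is_submodule_def
    by (auto simp: distrib_left mult.left_commute[of "to_fract p"] P.R_add P.R_mult)
  have fr: "\<exists>h\<in>N_v R. to_fract h * y \<in> I" if y: "y \<in> J" for y
  proof -
    obtain h where h: "h \<in> N_v R" "to_fract h * (to_fract p * y) \<in> polynomial_ring R"
      using p(3)[OF y] mem_Na_v by blast
    moreover have "to_fract h * y \<in> J"
      using submodule_scale[OF JP _ y] N_v_fract(1) h(1) by blast
    ultimately show ?thesis unfolding I_def by (auto simp: mult.left_commute)
  qed
  obtain y0 where "y0 \<in> J" "y0 \<noteq> 0" using nonzero_ideals_obtain[OF J] by metis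
  with fr obtain g where g: "g \<in> N_v R" "to_fract g * y0 \<in> I" by blast
  have "I \<in> nonzero_ideals (polynomial_ring R)"
    by (rule nonzero_idealsI[OF I g(2), of "to_fract p"])
      (use p \<open>y0 \<noteq> 0\<close> N_v_nonzero[OF g(1)] in \<open>auto simp: I_def\<close>)
  then have "w_stable_ideal (polynomial_ring R) I" using ws by (simp add: w_stable_domain_def)
  define W where "W = w_op (polynomial_ring R) I"
  define A where "A = ideal_product W (ideal_colon (endo_ring W) W)"
  define A' where "A' = ideal_product J (ideal_colon (endo_ring J) J)"
  have W: "is_submodule (polynomial_ring R) W" unfolding W_def by (rule P.submodule_w_op[OF I])
  have "1 \<in> w_op (polynomial_ring R) A"
    using \<open>w_stable_ideal _ I\<close> P.w_stable_ideal_iff[OF I] by (simp add: A_def W_def)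
  moreover have WJ: "W \<subseteq> J"
    unfolding W_def by (rule w_op_subset_Na_v[OF Jsub I]) (auto simp: I_def)
  have "A \<subseteq> A'"
    unfolding A_def A'_def
  proof (rule product_colon_endo_fractions[OF Jsub WJ])
    fix y assume "y \<in> J"
    then obtain h where "h \<in> N_v R" "to_fract h * y \<in> I" using fr by blast
    then show "\<exists>s. s \<noteq> 0 \<and> 1 / s \<in> Na_v R \<and> s * y \<in> W"
      using inverse_N_v N_v_nonzero P.w_op_superset[OF I] W_def
      by (intro exI[of _ "to_fract h"]) auto
  qed
  moreover have "is_submodule (Na_v R) A'"
    unfolding A'_def by (rule submodule_ideal_product[OF Jsub])
  ultimately have "1 \<in> A'"
    using w_op_subset_Na_v[of A' A] submodule_ideal_product[OF W] unfolding A_def by blast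
  then show "stable_ideal J" using stable_ideal_iff[OF Jsub] by (simp add: A'_def)
qed

text \<open>The condition extends from \<open>I\<close> to its \<open>w\<close>-closure one argument
  at a time: a Glaz-Vasconcelos set that pushes the argument into \<open>I\<close> pushes the value
  into the \<open>w\<close>-closed module \<open>w_op R I\<close>.\<close>

lemma colon_endo_w_op:
  assumes I: "is_submodule R I"
    and e: "\<And>x y. x \<in> I \<Longrightarrow> y \<in> I \<Longrightarrow> e * x * y \<in> w_op R I"
  shows "e \<in> ideal_colon (endo_ring (w_op R I)) (w_op R I)"
proof -
  have W: "is_submodule R (w_op R I)" by (rule submodule_w_op[OF I])
  have lift: "c * x \<in> w_op R I" if "\<And>y. y \<in> I \<Longrightarrow> c * y \<in> w_op R I" "x \<in> w_op R I" for c x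
  proof -
    obtain B where B: "GV R B" "\<And>b. b \<in> B \<Longrightarrow> b * x \<in> I"
      using \<open>x \<in> w_op R I\<close> unfolding w_op_iff[OF I] by blast
    then have "\<And>b. b \<in> B \<Longrightarrow> b * (c * x) \<in> w_op R I" using that(1) by (metis mult.left_commute)
    with B(1) have "c * x \<in> w_op R (w_op R I)" unfolding w_op_iff[OF W] by blast
    then show ?thesis by (simp add: w_op_idem[OF I])
  qed
  have "e * x * y \<in> w_op R I" if "x \<in> I" "y \<in> w_op R I" for x y
    using lift[of "e * x" y] e that by blast
  then have "(e * y) * x \<in> w_op R I" if "x \<in> w_op R I" "y \<in> w_op R I" for x y
    using lift[of "e * y" x] that by (metis mult.assoc mult.commute)
  then show ?thesis unfolding colon_endo_iff by blast
qed

text \<open>The ideal is scaled such that it generates the unit ideal of \<open>K[X]\<close>. Its extension to \<open>Na_v R\<close>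
  controls the maximal \<open>t\<close>-ideals of \<open>R[X]\<close> extended from \<open>R\<close>; the remaining ones are handled by a
  nonzero constant in the inverse, which exists because the ideal is \<open>w\<close>-finite over its endomorphism
  ring.\<close>
lemma stable_Na_v_imp_w_stable_normalized:
  assumes st: "stable_domain (Na_v R)"
    and I: "I \<in> nonzero_ideals (polynomial_ring R)" "1 \<in> I" "I \<subseteq> range to_fract"
  defines "W \<equiv> w_op (polynomial_ring R) I"
  shows "1 \<in> w_op (polynomial_ring R) (ideal_product W (ideal_colon (endo_ring W) W))"
proof -
  interpret P: nonfield_domain "polynomial_ring R" by (rule nonfield_domain_polynomial_ring)
  have Is: "is_submodule (polynomial_ring R) I" by (rule nonzero_ideals_submodule[OF I(1)])
  have Ws: "is_submodule (polynomial_ring R) W" unfolding W_def by (rule P.submodule_w_op[OF Is])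
  have WW: "w_op (polynomial_ring R) W = W" unfolding W_def by (rule P.w_op_idem[OF Is])
  have IW: "I \<subseteq> W" unfolding W_def by (rule P.w_op_superset[OF Is])
  define J where "J = fractions_with I (to_fract ` N_v R)"
  have J: "is_submodule (Na_v R) J" unfolding J_def by (rule submodule_Na_v[OF Is])
  have mem_J: "z \<in> J \<longleftrightarrow> (\<exists>h\<in>N_v R. to_fract h * z \<in> I)" for z
    unfolding J_def by (rule mem_fractions_N_v[OF Is])
  have IJ: "I \<subseteq> J" unfolding J_def by (rule fractions_with_incl[OF N_v_fract(2)])
  obtain d where d: "d \<in> polynomial_ring R" "d \<noteq> 0" "\<And>y. y \<in> I \<Longrightarrow> d * y \<in> polynomial_ring R"
    using nonzero_ideals_obtain[OF I(1)] by metis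
  have "J \<in> nonzero_ideals (Na_v R)"
  proof (rule nonzero_idealsI[OF J, of 1 d])
    show "d * y \<in> Na_v R" if "y \<in> J" for y
      unfolding mem_Na_v using that d(3) mem_J by (metis mult.left_commute)
  qed (use I(2) IJ d polynomial_ring_subset_Na_v in auto)
  then have 1: "1 \<in> ideal_product J (ideal_colon (endo_ring J) J)"
    using st stable_ideal_iff[OF J] by (simp add: stable_domain_def)
  have poly_multiple: "\<exists>c. c \<in> R \<and> c \<noteq> 0 \<and> to_fract [:c:] * to_fract q \<in> polynomial_ring R" for q
  proof -
    obtain c where c: "c \<in> R" "c \<noteq> 0" "[:c:] * q \<in> polys_over R"
      using clear_denominators[OF dwqf, of q] by auto
    have "to_fract [:c:] * to_fract q \<in> polynomial_ring R"
      using c(3) unfolding to_fract_mult[symmetric] to_fract_mem_polynomial_ring .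
    with c show ?thesis by blast
  qed
  \<comment> \<open>Since 1 lies in \<open>I\<close>, a constant that clears \<open>x\<close> moves
    it into \<open>I\<close>. Together with the multiplier \<open>h\<close> it forms a
    Glaz-Vasconcelos pair.\<close>
  have mem_W: "x \<in> W" if x: "x \<in> J" "x \<in> range to_fract" for x
  proof -
    obtain h where h: "h \<in> N_v R" "to_fract h * x \<in> I" using x mem_J by blast
    obtain c where c: "c \<in> R" "c \<noteq> 0" "to_fract [:c:] * x \<in> polynomial_ring R"
      using poly_multiple x(2) by blast
    have "to_fract [:c:] * x * 1 \<in> I" by (rule submodule_scale[OF Is c(3) I(2)])
    then show ?thesis
      unfolding W_def P.w_op_iff[OF Is] using GV_const_N_v[OF c(1,2) h(1)] h(2) by auto
  qed
  define C where "C = ideal_colon (endo_ring W) W"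
  \<comment> \<open>The aim is an element of \<open>N_v R\<close> in \<open>I C\<close>, the first
    half of a Glaz-Vasconcelos pair in \<open>W C\<close>.\<close>
  define N where "N = {y. \<exists>h\<in>N_v R. to_fract h * y \<in> ideal_product I C}"
  have IC: "is_submodule (polynomial_ring R) (ideal_product I C)"
    by (rule submodule_ideal_product[OF Is])
  have "x + y \<in> N" if "x \<in> N" "y \<in> N" for x y
  proof -
    obtain g h where gh: "g \<in> N_v R" "to_fract g * x \<in> ideal_product I C"
      "h \<in> N_v R" "to_fract h * y \<in> ideal_product I C"
      using \<open>x \<in> N\<close> \<open>y \<in> N\<close> unfolding N_def by blast
    have "to_fract g \<in> polynomial_ring R" "to_fract h \<in> polynomial_ring R"
      using N_v_fract(1) gh by auto
    then have "to_fract h * (to_fract g * x) + to_fract g * (to_fract h * y) \<in> ideal_product I C"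
      using submodule_add[OF IC] submodule_scale[OF IC] gh(2,4) by blast
    then have "to_fract (g * h) * (x + y) \<in> ideal_product I C" by (simp add: algebra_simps)
    then show ?thesis unfolding N_def using N_v_mult gh by blast
  qed
  moreover have "a * e \<in> N" if a: "a \<in> J" and e: "e \<in> ideal_colon (endo_ring J) J" for a e
  proof -
    obtain h where h: "h \<in> N_v R" "to_fract h * a \<in> I" using a mem_J by blast
    have eJ: "e * x * y \<in> J" if "x \<in> J" "y \<in> J" for x y using e that colon_endo_iff by blast
    \<comment> \<open>Evaluation at 1 and 1 puts \<open>e\<close> into \<open>J\<close>. Some
      multiple \<open>g e\<close> is therefore a polynomial in \<open>I\<close>, which is what makes
      \<open>mem_W\<close> applicable.\<close>
    then have "e \<in> J" using I(2) IJ by (metis mult.right_neutral subsetD)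
    then obtain g where g: "g \<in> N_v R" "to_fract g * e \<in> I" using mem_J by blast
    have "to_fract g * e \<in> C"
      unfolding C_def W_def
    proof (rule P.colon_endo_w_op[OF Is], fold W_def, rule mem_W)
      fix x y assume xy: "x \<in> I" "y \<in> I"
      have "to_fract g \<in> Na_v R" using N_v_fract(1) polynomial_ring_subset_Na_v g(1) by blast
      then have "to_fract g * (e * x * y) \<in> J"
        using eJ[of x y] xy IJ by (intro submodule_scale[OF J, of "to_fract g" "e * x * y"]) auto
      then show "to_fract g * e * x * y \<in> J" by (simp add: mult.assoc)
      obtain u v w where "to_fract g * e = to_fract u" "x = to_fract v" "y = to_fract w"
        using g(2) xy I(3) by blast
      then show "to_fract g * e * x * y \<in> range to_fract" by (metis rangeI to_fract_mult)
    qed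
    then have "(to_fract h * a) * (to_fract g * e) \<in> ideal_product I C"
      by (rule ideal_product_memI[OF h(2)])
    then have "to_fract (h * g) * (a * e) \<in> ideal_product I C" by (simp add: ac_simps)
    then show ?thesis unfolding N_def using N_v_mult h g by blast
  qed
  moreover have "0 \<in> N" unfolding N_def using N_v_one ideal_product_0 by auto
  ultimately have "ideal_product J (ideal_colon (endo_ring J) J) \<subseteq> N"
    by (intro ideal_product_subset)
  with 1 obtain h where h: "h \<in> N_v R" "to_fract h \<in> ideal_product I C"
    unfolding N_def by auto
  obtain n :: nat and a e where ae: "to_fract h = (\<Sum>i<n. a i * e i)" "\<And>i. i < n \<Longrightarrow> a i \<in> I"
    "\<And>i. i < n \<Longrightarrow> e i \<in> C"
    using h(2) unfolding ideal_product_def by blast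
  have "\<forall>i<n. \<exists>q. a i = to_fract q" using ae(2) I(3) by blast
  then obtain q where q: "\<And>i. i < n \<Longrightarrow> a i = to_fract (q i)" by metis
  obtain c where c: "c \<in> R" "c \<noteq> 0" "\<And>i. i < n \<Longrightarrow> smult c (q i) \<in> polys_over R"
    using common_denominator[of "q ` {..<n}"] by auto
  define z where "z = to_fract [:c:]"
  have zP: "z \<in> polynomial_ring R" using c(1) by (simp add: z_def polys_over_const[OF submodule_R])
  have za: "z * a i \<in> polynomial_ring R" if "i < n" for i
    using c(3)[OF that] by (simp add: z_def q[OF that] flip: to_fract_mult)
  \<comment> \<open>The constant \<open>z\<close> is the other half of the pair, as
    \<open>z = 1 * z\<close>. Multiplied by \<open>h\<close>, the value \<open>z x y\<close> becomes
    a combination of elements of \<open>W\<close> with coefficients \<open>z a_i\<close> in the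
    polynomial ring; a constant that clears \<open>x\<close> also moves it into
    \<open>W\<close>.\<close>
  have "z \<in> C"
    unfolding C_def W_def
  proof (rule P.colon_endo_w_op[OF Is], fold W_def)
    fix x y assume xy: "x \<in> I" "y \<in> I"
    have "e i * x * y \<in> W" if "i < n" for i
      using ae(3)[OF that] xy IW unfolding C_def colon_endo_iff by blast
    then have "(\<Sum>i<n. (z * a i) * (e i * x * y)) \<in> W"
      using za by (intro submodule_sum[OF Ws]) (rule submodule_scale[OF Ws], auto)
    moreover have "(\<Sum>i<n. (z * a i) * (e i * x * y)) = to_fract h * (z * x * y)"
      unfolding ae(1) sum_distrib_right by (intro sum.cong) (auto simp: ac_simps)
    ultimately have 2: "to_fract h * (z * x * y) \<in> W" by simp
    obtain c' where c': "c' \<in> R" "c' \<noteq> 0" "to_fract [:c':] * x \<in> polynomial_ring R"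
      using poly_multiple xy(1) I(3) by blast
    have "(to_fract [:c':] * x) * (z * y) \<in> W"
      using IW xy zP c' by (intro submodule_scale[OF Ws]) auto
    then have "to_fract [:c':] * (z * x * y) \<in> W" by (simp add: ac_simps)
    with 2 have "z * x * y \<in> w_op (polynomial_ring R) W"
      unfolding P.w_op_iff[OF Ws] using GV_const_N_v[OF c'(1,2) h(1)] by blast
    then show "z * x * y \<in> W" by (simp add: WW)
  qed
  then have "z \<in> ideal_product W C"
    using ideal_product_memI[of 1 W z C] I(2) IW by auto
  moreover have "to_fract h \<in> ideal_product W C"
    using h(2) ideal_product_mono[OF IW, of C C] by blast
  ultimately show ?thesis
    unfolding P.w_op_iff[OF submodule_ideal_product[OF Ws]] C_def[symmetric] z_def
    using GV_const_N_v[OF c(1,2) h(1)] by auto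
qed

lemma w_op_scaled:
  assumes I: "is_submodule R I" and "g \<noteq> 0"
  shows "w_op R ((*) g ` I) = (*) g ` w_op R I"
proof -
  have mem: "x \<in> (*) g ` A \<longleftrightarrow> x / g \<in> A" for x A
    using \<open>g \<noteq> 0\<close> by (auto simp: image_iff intro: bexI[of _ "x / g"])
  have "x \<in> w_op R ((*) g ` I) \<longleftrightarrow> x \<in> (*) g ` w_op R I" for x
    unfolding w_op_iff[OF submodule_scaled[OF I]] mem w_op_iff[OF I] by simp
  then show ?thesis by blast
qed

lemma stable_Na_v_imp_w_stable:
  assumes st: "stable_domain (Na_v R)"
  shows "w_stable_domain (polynomial_ring R)"
  unfolding w_stable_domain_def
proof
  interpret P: nonfield_domain "polynomial_ring R" by (rule nonfield_domain_polynomial_ring)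
  fix I assume I: "I \<in> nonzero_ideals (polynomial_ring R)"
  have Is: "is_submodule (polynomial_ring R) I" by (rule nonzero_ideals_submodule[OF I])
  obtain y d where y: "y \<in> I" "y \<noteq> 0" and d: "d \<in> polynomial_ring R" "d \<noteq> 0"
    "\<And>y. y \<in> I \<Longrightarrow> d * y \<in> polynomial_ring R"
    using nonzero_ideals_obtain[OF I] by metis
  obtain u where u: "d = to_fract u" using d(1) by (auto simp: polynomial_ring_def)
  obtain p0 where p0: "d * y = to_fract p0" using d(3)[OF y(1)] by (auto simp: polynomial_ring_def)
  have "p0 \<noteq> 0" using p0 y d by auto
  moreover have "to_fract p0 \<in> (*) d ` I" using p0 y by (metis image_eqI)
  ultimately obtain p where p: "p \<noteq> 0" "to_fract p \<in> (*) d ` I"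
    "\<And>g. to_fract g \<in> (*) d ` I \<Longrightarrow> p dvd g"
    using least_degree_dvd[OF submodule_scaled[OF Is]] by blast
  \<comment> \<open>Multiplication by \<open>d\<close> makes the ideal integral. As \<open>p\<close>
    divides all of its members over the field, division by \<open>p\<close> keeps them polynomial
    and brings in 1.\<close>
  define f where "f = d / to_fract p"
  define I' where "I' = (*) f ` I"
  have f: "f \<noteq> 0" using d p by (simp add: f_def)
  have Is': "is_submodule (polynomial_ring R) I'" unfolding I'_def by (rule submodule_scaled[OF Is])
  have one: "1 \<in> I'"
  proof -
    obtain x where "x \<in> I" "to_fract p = d * x" using p(2) by blast
    then show ?thesis using p(1) d(2) by (auto simp: I'_def f_def image_iff intro!: bexI[of _ x])
  qed
  have rng: "I' \<subseteq> range to_fract"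
  proof
    fix z assume "z \<in> I'"
    then obtain x where x: "x \<in> I" "z = f * x" by (auto simp: I'_def)
    obtain g where g: "d * x = to_fract g" using d(3)[OF x(1)] by (auto simp: polynomial_ring_def)
    then have "p dvd g" using p(3) x by (metis image_eqI)
    then obtain k where "g = p * k" by (elim dvdE)
    then have "z = to_fract k" using x g p(1) by (simp add: f_def)
    then show "z \<in> range to_fract" by blast
  qed
  have "I' \<in> nonzero_ideals (polynomial_ring R)"
  proof (rule nonzero_idealsI[OF Is' one, of "to_fract p0 * to_fract p"])
    obtain x where x: "x \<in> I" "to_fract p = d * x" using p(2) by blast
    show "to_fract p0 * to_fract p \<in> polynomial_ring R"
      using P.R_mult d(3)[OF y(1)] d(3)[OF x(1)] p0 x(2) by metis
    show "to_fract p0 * to_fract p * z \<in> polynomial_ring R" if "z \<in> I'" for z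
    proof -
      obtain x where "x \<in> I" "z = f * x" using \<open>z \<in> I'\<close> unfolding I'_def by blast
      then have "to_fract p0 * to_fract p * z = (d * y) * (d * x)"
        using p(1) p0 by (simp add: f_def)
      then show ?thesis using P.R_mult d(3)[OF y(1)] d(3)[OF \<open>x \<in> I\<close>] by simp
    qed
  qed (use \<open>p0 \<noteq> 0\<close> p(1) in auto)
  from stable_Na_v_imp_w_stable_normalized[OF st this one rng]
  show "w_stable_ideal (polynomial_ring R) I"
    unfolding P.w_stable_ideal_iff[OF Is] I'_def P.w_op_scaled[OF Is f] product_colon_endo_scaled[OF f] .
qed

lemma stable_Na_v_imp_w_stable_base:
  assumes st: "stable_domain (Na_v R)"
  shows "w_stable_domain R"
  unfolding w_stable_domain_def
proof
  fix I assume I: "I \<in> nonzero_ideals R"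
  have Is: "is_submodule R I" by (rule nonzero_ideals_submodule[OF I])
  obtain w0 d where w0: "w0 \<in> I" "w0 \<noteq> 0" and d: "d \<in> R" "d \<noteq> 0" "\<And>y. y \<in> I \<Longrightarrow> d * y \<in> R"
    using nonzero_ideals_obtain[OF I] by metis
  define W where "W = w_op R I"
  have W: "is_submodule R W" unfolding W_def by (rule submodule_w_op[OF Is])
  have WW: "w_op R W = W" unfolding W_def by (rule w_op_idem[OF Is])
  have w0W: "w0 \<in> W" using w0(1) w_op_superset[OF Is] by (auto simp: W_def)
  have dW: "d * w \<in> R" if "w \<in> W" for w
  proof -
    obtain B where "GV R B" "\<And>b. b \<in> B \<Longrightarrow> b * w \<in> I"
      using \<open>w \<in> W\<close> unfolding W_def w_op_iff[OF Is] by blast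
    then have "d * w \<in> w_op R R"
      unfolding w_op_iff[OF submodule_R] using d(3) by (metis mult.left_commute)
    then show ?thesis by (simp add: w_op_R)
  qed
  have WX: "is_submodule (polynomial_ring R) (polynomial_ring W)"
    by (rule submodule_polynomial_ring[OF W])
  define J where "J = fractions_with (polynomial_ring W) (to_fract ` N_v R)"
  have J: "is_submodule (Na_v R) J" unfolding J_def by (rule submodule_Na_v[OF WX])
  have mem_J: "z \<in> J \<longleftrightarrow> (\<exists>h\<in>N_v R. to_fract h * z \<in> polynomial_ring W)" for z
    unfolding J_def by (rule mem_fractions_N_v[OF WX])
  have "polynomial_ring W \<subseteq> J" unfolding J_def by (rule fractions_with_incl[OF N_v_fract(2)])
  then have const_J: "to_fract [:w:] \<in> J" if "w \<in> W" for w
    using that polys_over_const[OF W] by auto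
  have "J \<in> nonzero_ideals (Na_v R)"
  proof (rule nonzero_idealsI[OF J const_J[OF w0W], of "to_fract [:d:]"])
    show "to_fract [:d:] * z \<in> Na_v R" if "z \<in> J" for z
    proof -
      obtain h p where h: "h \<in> N_v R" "to_fract h * z = to_fract p" "p \<in> polys_over W"
        using \<open>z \<in> J\<close> mem_J by (auto simp: polynomial_ring_def)
      have "to_fract h * (to_fract [:d:] * z) = to_fract ([:d:] * p)"
        unfolding to_fract_mult h(2)[symmetric] by (simp add: ac_simps)
      moreover have "[:d:] * p \<in> polys_over R" using h(3) dW by (auto simp: polys_over_def)
      ultimately show ?thesis unfolding mem_Na_v using h(1) to_fract_mem_polynomial_ring by metis
    qed
    show "to_fract [:d:] \<in> Na_v R"
      using polynomial_ring_subset_Na_v polys_over_const[OF submodule_R] d(1) by auto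
  qed (use w0 d in auto)
  then have 1: "1 \<in> ideal_product J (ideal_colon (endo_ring J) J)"
    using st stable_ideal_iff[OF J] by (simp add: stable_domain_def)
  define C where "C = ideal_colon (endo_ring W) W"
  define A where "A = ideal_product W C"
  have A: "is_submodule R A" unfolding A_def by (rule submodule_ideal_product[OF W])
  have AX: "is_submodule (polynomial_ring R) (polynomial_ring A)"
    by (rule submodule_polynomial_ring[OF A])
  define N where "N = fractions_with (polynomial_ring A) (to_fract ` N_v R)"
  have N: "is_submodule (Na_v R) N" unfolding N_def by (rule submodule_Na_v[OF AX])
  have mem_N: "z \<in> N \<longleftrightarrow> (\<exists>h\<in>N_v R. to_fract h * z \<in> polynomial_ring A)" for z
    unfolding N_def by (rule mem_fractions_N_v[OF AX])
  have "a * e \<in> N" if a: "a \<in> J" and e: "e \<in> ideal_colon (endo_ring J) J" for a e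
  proof -
    obtain h p where h: "h \<in> N_v R" "to_fract h * a = to_fract p" "p \<in> polys_over W"
      using a mem_J by (auto simp: polynomial_ring_def)
    have eJ: "e * x * y \<in> J" if "x \<in> J" "y \<in> J" for x y using e that colon_endo_iff by blast
    \<comment> \<open>The value of \<open>e\<close> on the constant \<open>w0\<close>, taken twice,
      shows that some \<open>g\<close> makes \<open>g e\<close> a polynomial \<open>r\<close> over
      the field, so that it has coefficients.\<close>
    obtain g q where g: "g \<in> N_v R" "to_fract g * (e * to_fract [:w0:] * to_fract [:w0:]) = to_fract q"
      using eJ[OF const_J[OF w0W] const_J[OF w0W]] mem_J by (auto simp: polynomial_ring_def)
    have "(to_fract g * e) * to_fract [:w0 * w0:] = to_fract q"
    proof -
      have "to_fract [:w0 * w0:] = to_fract [:w0:] * to_fract [:w0:]"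
        by (simp flip: to_fract_mult)
      then show ?thesis using g(2) by (simp add: ac_simps)
    qed
    from to_fract_divide_const[OF this] obtain r where r: "to_fract g * e = to_fract r"
      using w0(2) by auto
    \<comment> \<open>Constants \<open>x\<close> and \<open>y\<close> from \<open>W\<close> test all
      coefficients of \<open>r\<close> at once; the factor \<open>h'\<close> from
      \<open>N_v R\<close> is divided out because \<open>W\<close> is
      \<open>w\<close>-closed.\<close>
    have "r \<in> polys_over C"
    proof -
      have "coeff r i * x * y \<in> W" if xy: "x \<in> W" "y \<in> W" for i x y
      proof -
        have "e * to_fract [:x:] * to_fract [:y:] \<in> J" by (intro eJ const_J xy)
        moreover have "to_fract g \<in> Na_v R"
          using N_v_fract(1) polynomial_ring_subset_Na_v g(1) by blast
        ultimately have "to_fract g * (e * to_fract [:x:] * to_fract [:y:]) \<in> J"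
          by (rule submodule_scale[OF J, rotated])
        moreover have "to_fract g * (e * to_fract [:x:] * to_fract [:y:]) = to_fract (smult (x * y) r)"
        proof -
          have eq: "smult (x * y) r = r * ([:x:] * [:y:])" by (simp add: mult.commute)
          show ?thesis unfolding eq to_fract_mult r[symmetric] by (simp only: mult.assoc)
        qed
        ultimately obtain h' where h': "h' \<in> N_v R"
          "to_fract h' * to_fract (smult (x * y) r) \<in> polynomial_ring W"
          using mem_J by auto
        then have "to_fract (h' * smult (x * y) r) \<in> polynomial_ring W"
          unfolding to_fract_mult by simp
        then have "h' * smult (x * y) r \<in> polys_over W" unfolding to_fract_mem_polynomial_ring .
        then have "smult (x * y) r \<in> polys_over W" using w_op_coeffs[OF W h'(1)] WW by metis
        then have "coeff (smult (x * y) r) i \<in> W" unfolding polys_over_def by blast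
        then show ?thesis by (simp add: ac_simps)
      qed
      then show ?thesis by (simp add: polys_over_def C_def colon_endo_iff)
    qed
    with h(3) have "p * r \<in> polys_over A"
      by (auto simp: polys_over_def coeff_mult A_def intro!: submodule_sum[OF A[unfolded A_def]]
          ideal_product_memI)
    moreover have "to_fract (h * g) * (a * e) = to_fract (p * r)"
      unfolding to_fract_mult h(2)[symmetric] r[symmetric] by (simp add: ac_simps)
    ultimately show ?thesis unfolding mem_N
      using N_v_mult[OF h(1) g(1)] to_fract_mem_polynomial_ring by metis
  qed
  then have "ideal_product J (ideal_colon (endo_ring J) J) \<subseteq> N"
    using submodule_0[OF N] submodule_add[OF N] by (intro ideal_product_subset)
  with 1 have "1 \<in> N" by blast
  then obtain h where h: "h \<in> N_v R" "to_fract h \<in> polynomial_ring A"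
    unfolding mem_N by auto
  \<comment> \<open>The coefficients of \<open>h\<close> form a Glaz-Vasconcelos set inside
    \<open>A\<close>, which is the criterion for 1 to lie in \<open>w_op R A\<close>.\<close>
  then have "\<forall>a\<in>set (coeffs h). a * 1 \<in> A"
    by (auto simp: polys_over_iff_coeffs submodule_0[OF A])
  then have "1 \<in> w_op R A" unfolding w_op_iff[OF A] using h(1) N_v_iff by blast
  then show "w_stable_ideal R I"
    unfolding w_stable_ideal_iff[OF Is] by (simp add: A_def C_def W_def)
qed

end

section \<open>Stable domains: finite character and localization\<close>

text \<open>A relation 1 = sum a_i b_i acts as a partition of unity: \<open>z\<close> is the sum of
  the terms a_i b_i z.\<close>

lemma ideal_product_one_cancel:
  fixes z :: "'k::field"
  assumes "1 \<in> ideal_product I J" "is_submodule R N" "\<And>a b. a \<in> I \<Longrightarrow> b \<in> J \<Longrightarrow> a * b * z \<in> N"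
  shows "z \<in> N"
proof -
  have "ideal_product I J \<subseteq> {y. y * z \<in> N}"
    using assms(2,3) by (intro ideal_product_subset) (auto simp: is_submodule_def distrib_right)
  with assms(1) show ?thesis by auto
qed

text \<open>Maximality is encoded as invertibility modulo \<open>M\<close> of the elements outside
  \<open>M\<close>, the form in which it is used.\<close>

definition max_ideal_of :: "'k::field set \<Rightarrow> 'k set \<Rightarrow> bool" where
  "max_ideal_of R M \<longleftrightarrow> is_submodule R M \<and> M \<subseteq> R \<and> 1 \<notin> M \<and> (\<forall>t\<in>R - M. \<exists>r\<in>R. 1 - r * t \<in> M)"

context field_subring
begin

lemma max_ideal_prime:
  assumes "max_ideal_of R M"
  shows "prime_ideal_of R M"
proof -
  have M: "is_submodule R M" "M \<subseteq> R" "1 \<notin> M" "\<forall>t\<in>R - M. \<exists>r\<in>R. 1 - r * t \<in> M"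
    using assms by (auto simp: max_ideal_of_def)
  have "b \<in> M" if ab: "a \<in> R" "b \<in> R" "a * b \<in> M" "a \<notin> M" for a b
  proof -
    obtain r where r: "r \<in> R" "1 - r * a \<in> M" using M(4) ab by blast
    have "b * (1 - r * a) + r * (a * b) \<in> M"
      using submodule_add[OF M(1) submodule_scale[OF M(1) ab(2) r(2)] submodule_scale[OF M(1) r(1) ab(3)]] .
    then show ?thesis by (simp add: algebra_simps)
  qed
  with M show ?thesis unfolding prime_ideal_of_def by blast
qed

lemma max_ideal_antichain:
  assumes "max_ideal_of R M" "max_ideal_of R M'" "M' \<subseteq> M"
  shows "M' = M"
proof (rule ccontr)
  have M: "is_submodule R M" "M \<subseteq> R" "1 \<notin> M" "is_submodule R M'" "\<forall>t\<in>R - M'. \<exists>r\<in>R. 1 - r * t \<in> M'"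
    using assms by (auto simp: max_ideal_of_def)
  assume "M' \<noteq> M"
  with assms(3) obtain t where t: "t \<in> M" "t \<notin> M'" by blast
  then obtain r where r: "r \<in> R" "1 - r * t \<in> M'" using M(2,5) by blast
  then have "(1 - r * t) + r * t \<in> M"
    using submodule_add[OF M(1)] submodule_scale[OF M(1) r(1) t(1)] assms(3) by blast
  with M(3) show False by simp
qed

lemma common_multiplier:
  assumes M: "prime_ideal_of R M" and "finite V"
    and "\<And>v. v \<in> V \<Longrightarrow> is_submodule R (N v)"
    and "\<And>v. v \<in> V \<Longrightarrow> \<exists>s\<in>R - M. s * z v \<in> N v"
  shows "\<exists>s\<in>R - M. \<forall>v\<in>V. s * z v \<in> N v"
  using assms(2-)
proof (induction V rule: finite_induct)
  case empty
  then show ?case using prime_compl(2)[OF M] by blast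
next
  case (insert v V)
  then obtain s where s: "s \<in> R - M" "\<forall>v\<in>V. s * z v \<in> N v" by blast
  obtain t where t: "t \<in> R - M" "t * z v \<in> N v" using insert.prems(2)[of v] by blast
  have "s * (t * z v) \<in> N v" using insert.prems(1)[of v] s t by (blast intro: submodule_scale)
  moreover have "t * (s * z u) \<in> N u" if "u \<in> V" for u
    using insert.prems(1)[of u] s t that by (blast intro: submodule_scale)
  ultimately have "\<forall>u\<in>insert v V. (s * t) * z u \<in> N u" by (auto simp: ac_simps)
  then show ?case using prime_compl(4)[OF M s(1) t(1)] by blast
qed

text \<open>The module \<open>(R : M\<^sup>2)\<close> contains an inverse \<open>C\<close> of \<open>M\<close> over \<open>(M : M)\<close>. If it were a ring, then
  \<open>M\<^sup>2 C\<^sup>2 = (M : M)\<close> would be contained in \<open>R\<close>, and then so would \<open>M\<^sup>2 C\<^sup>4 = C\<^sup>2\<close>.\<close>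
lemma colon_square_not_ring:
  assumes M: "max_ideal_of R M" and st: "stable_ideal M"
  defines "L \<equiv> {z. \<forall>m\<in>M. \<forall>m'\<in>M. z * m * m' \<in> R}"
  shows "\<exists>y\<in>L. \<exists>y'\<in>L. y * y' \<notin> L"
proof (rule ccontr)
  assume "\<not> (\<exists>y\<in>L. \<exists>y'\<in>L. y * y' \<notin> L)"
  then have LL: "\<And>y y'. y \<in> L \<Longrightarrow> y' \<in> L \<Longrightarrow> y * y' \<in> L" by blast
  have Ms: "is_submodule R M" "M \<subseteq> R" "1 \<notin> M" using M by (auto simp: max_ideal_of_def)
  define C where "C = ideal_colon (endo_ring M) M"
  have 1: "1 \<in> ideal_product M C" using st stable_ideal_iff[OF Ms(1)] by (simp add: C_def)
  have CL: "C \<subseteq> L" using Ms(2) by (auto simp: L_def C_def colon_endo_iff)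
  \<comment> \<open>Two cancellations of \<open>1 \<in> M C\<close>: membership of \<open>z\<close>
    in \<open>R\<close> is tested after multiplication by two elements of \<open>M\<close> and two
    of \<open>C\<close>, which matches membership in \<open>L\<close>.\<close>
  have R2: "z \<in> R" if *: "\<And>m e m' e'. m \<in> M \<Longrightarrow> e \<in> C \<Longrightarrow> m' \<in> M \<Longrightarrow> e' \<in> C \<Longrightarrow> (e * e') * z * m * m' \<in> R" for z
  proof (rule ideal_product_one_cancel[OF 1 submodule_R])
    fix m e assume "m \<in> M" "e \<in> C"
    show "m * e * z \<in> R"
    proof (rule ideal_product_one_cancel[OF 1 submodule_R])
      fix m' e' assume "m' \<in> M" "e' \<in> C"
      then have "(e * e') * z * m * m' \<in> R" using * \<open>m \<in> M\<close> \<open>e \<in> C\<close> by blast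
      then show "m' * e' * (m * e * z) \<in> R" by (simp add: ac_simps)
    qed
  qed
  have ER: "b \<in> R" if b: "b \<in> endo_ring M" for b
  proof (rule R2)
    fix m e m' e' assume "m \<in> M" "e \<in> C" "m' \<in> M" "e' \<in> C"
    then have "e * e' \<in> L" "b * m \<in> M" using LL CL b by (auto simp: endo_ring_iff)
    then have "(e * e') * (b * m) * m' \<in> R" using \<open>m' \<in> M\<close> unfolding L_def by blast
    then show "(e * e') * b * m * m' \<in> R" by (simp add: mult.assoc)
  qed
  have CC: "e * e' \<in> R" if e: "e \<in> C" "e' \<in> C" for e e'
  proof (rule R2)
    fix m f m' f' assume "m \<in> M" "f \<in> C" "m' \<in> M" "f' \<in> C"
    then have "f \<in> L" "f' \<in> L" "e \<in> L" "e' \<in> L" using CL e by auto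
    then have "(f * f') * (e * e') \<in> L" by (intro LL)
    then show "(f * f') * (e * e') * m * m' \<in> R" using \<open>m \<in> M\<close> \<open>m' \<in> M\<close> unfolding L_def by blast
  qed
  \<comment> \<open>Products of two elements of \<open>C\<close> lie in \<open>R\<close>, so one
    more cancellation squeezes \<open>C\<close> into \<open>M\<close>; then 1 would lie in
    \<open>M\<close>.\<close>
  have "C \<subseteq> M"
  proof
    fix e' assume e': "e' \<in> C"
    show "e' \<in> M"
    proof (rule ideal_product_one_cancel[OF 1 Ms(1)])
      fix m e assume "m \<in> M" "e \<in> C"
      then have "(e * e') * m \<in> M" using CC[OF _ e'] by (blast intro: submodule_scale[OF Ms(1)])
      then show "m * e * e' \<in> M" by (simp add: ac_simps)
    qed
  qed
  then have "ideal_product M C \<subseteq> M"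
    using Ms by (intro ideal_product_subset) (auto intro: submodule_0 submodule_add submodule_scale)
  with 1 Ms(3) show False by blast
qed

text \<open>Otherwise the sum of the modules \<open>(R : M\<^sup>2)\<close> would be a stable fractional ideal. At almost all
  \<open>M\<close> it is generated over its endomorphism ring by elements of \<open>R\<^sub>M\<close>, so it is locally a ring
  there, although it agrees locally with \<open>(R : M\<^sup>2)\<close>.\<close>
theorem stable_domain_finite_character:
  assumes st: "stable_domain R" and x: "x \<in> R" "x \<noteq> 0"
    and \<M>: "\<And>M. M \<in> \<M> \<Longrightarrow> max_ideal_of R M" "\<And>M. M \<in> \<M> \<Longrightarrow> x \<in> M"
  shows "finite \<M>"
proof (rule ccontr)
  assume inf: "infinite \<M>"
  define L where "L M = {z. \<forall>m\<in>M. \<forall>m'\<in>M. z * m * m' \<in> R}" for M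
  have Ms: "is_submodule R M" "M \<subseteq> R" "prime_ideal_of R M" if "M \<in> \<M>" for M
    using \<M>(1)[OF that] max_ideal_prime by (auto simp: max_ideal_of_def)
  have Ls: "is_submodule R (L M)" for M
    by (auto simp: L_def is_submodule_def distrib_right mult.assoc R_add R_mult)
  have RL: "R \<subseteq> L M" if "M \<in> \<M>" for M
    using Ms(2)[OF that] by (auto simp: L_def intro!: R_mult)
  define I where "I = ideal_generated R (\<Union>M\<in>\<M>. L M)"
  have Is: "is_submodule R I" unfolding I_def by (rule is_submodule_ideal_generated)
  have LI: "L M \<subseteq> I" if "M \<in> \<M>" for M
    using that ideal_generated_superset[of "\<Union>M\<in>\<M>. L M" R] unfolding I_def by blast
  \<comment> \<open>At a different maximal ideal \<open>M\<close>, the module \<open>L M'\<close> is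
    locally inside \<open>R\<close>: the square of an element of \<open>M'\<close> outside
    \<open>M\<close> is a denominator.\<close>
  have off: "\<exists>s\<in>R - M. s * z \<in> R" if MM: "M \<in> \<M>" "M' \<in> \<M>" "M \<noteq> M'" and z: "z \<in> L M'" for M M' z
  proof -
    obtain u where u: "u \<in> M'" "u \<notin> M"
      using max_ideal_antichain[OF \<M>(1)[OF MM(1)] \<M>(1)[OF MM(2)]] MM(3) by blast
    then have "u \<in> R - M" using Ms(2)[OF MM(2)] by blast
    then have "u * u \<in> R - M" using prime_compl(4)[OF Ms(3)[OF MM(1)]] by blast
    moreover have "(u * u) * z \<in> R" using z u(1) unfolding L_def by (auto simp: ac_simps)
    ultimately show ?thesis by blast
  qed
  have loc: "\<exists>s\<in>R - M. s * z \<in> L M" if M: "M \<in> \<M>" and "z \<in> I" for M z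
  proof -
    have "I \<subseteq> fractions_with (L M) (R - M)"
      unfolding I_def
    proof (rule ideal_generated_least)
      have "is_submodule (localization R M) (fractions_with (L M) (R - M))"
        unfolding localization_def
        by (rule submodule_fractions_with[OF Ls prime_compl[OF Ms(3)[OF M]]])
      moreover have "R \<subseteq> localization R M"
        unfolding localization_def by (rule fractions_with_incl[OF prime_compl(2)[OF Ms(3)[OF M]]])
      ultimately show "is_submodule R (fractions_with (L M) (R - M))"
        unfolding is_submodule_def by blast
      show "(\<Union>M\<in>\<M>. L M) \<subseteq> fractions_with (L M) (R - M)"
      proof
        fix z assume "z \<in> (\<Union>M\<in>\<M>. L M)"
        then obtain M' where M': "M' \<in> \<M>" "z \<in> L M'" by blast
        have "\<exists>s\<in>R - M. s * z \<in> L M"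
        proof (cases "M' = M")
          case True
          then show ?thesis using M' prime_compl(2)[OF Ms(3)[OF M]] by (intro bexI[of _ 1]) auto
        next
          case False
          then show ?thesis using off[OF M M'(1) _ M'(2)] RL[OF M] by blast
        qed
        then show "z \<in> fractions_with (L M) (R - M)"
          unfolding mem_fractions_prime[OF Ms(3)[OF M] Ls] .
      qed
    qed
    with \<open>z \<in> I\<close> show ?thesis using mem_fractions_prime[OF Ms(3)[OF M] Ls] by blast
  qed
  \<comment> \<open>These are the elements that lie in the localization of \<open>R\<close> at all
    but finitely many members of the family.\<close>
  define N where "N = {z. \<exists>F. finite F \<and> (\<forall>M\<in>\<M> - F. \<exists>s\<in>R - M. s * z \<in> R)}"
  have "I \<subseteq> N"
    unfolding I_def
  proof (rule ideal_generated_least)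
    have "a + b \<in> N" if "a \<in> N" "b \<in> N" for a b
    proof -
      obtain F where F: "finite F" "\<And>M. M \<in> \<M> - F \<Longrightarrow> \<exists>s\<in>R - M. s * a \<in> R"
        using \<open>a \<in> N\<close> unfolding N_def by blast
      obtain G where G: "finite G" "\<And>M. M \<in> \<M> - G \<Longrightarrow> \<exists>s\<in>R - M. s * b \<in> R"
        using \<open>b \<in> N\<close> unfolding N_def by blast
      have "\<exists>s\<in>R - M. s * (a + b) \<in> R" if M: "M \<in> \<M> - (F \<union> G)" for M
      proof -
        have "\<exists>s\<in>R - M. \<forall>v\<in>{a, b}. s * v \<in> R"
          using M F(2)[of M] G(2)[of M] Ms(3)[of M] submodule_R by (intro common_multiplier) auto
        then show ?thesis using R_add by (auto simp: distrib_left)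
      qed
      with F(1) G(1) show ?thesis unfolding N_def by blast
    qed
    moreover have "r * a \<in> N" if "r \<in> R" "a \<in> N" for r a
    proof -
      obtain F where F: "finite F" "\<And>M. M \<in> \<M> - F \<Longrightarrow> \<exists>s\<in>R - M. s * a \<in> R"
        using \<open>a \<in> N\<close> unfolding N_def by blast
      have "\<exists>s\<in>R - M. s * (r * a) \<in> R" if "M \<in> \<M> - F" for M
        using F(2)[OF that] R_mult[OF \<open>r \<in> R\<close>] by (metis mult.left_commute)
      with F(1) show ?thesis unfolding N_def by blast
    qed
    moreover have "0 \<in> N"
      using prime_compl(2)[OF Ms(3)] unfolding N_def
      by (intro CollectI exI[of _ "{}"] conjI ballI bexI[of _ 1]) auto
    ultimately show "is_submodule R N" unfolding is_submodule_def by blast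
    show "(\<Union>M\<in>\<M>. L M) \<subseteq> N"
    proof
      fix z assume "z \<in> (\<Union>M\<in>\<M>. L M)"
      then obtain M' where M': "M' \<in> \<M>" "z \<in> L M'" by blast
      have "\<forall>M\<in>\<M> - {M'}. \<exists>s\<in>R - M. s * z \<in> R" using off[OF _ M'(1) _ M'(2)] by blast
      then show "z \<in> N" unfolding N_def by blast
    qed
  qed
  \<comment> \<open>The common element \<open>x\<close> lies in every \<open>M\<close>, so
    \<open>x * x\<close> is a uniform denominator and the sum is a fractional ideal.\<close>
  have xI: "x * x * z \<in> R" if "z \<in> I" for z
  proof -
    have "I \<subseteq> {z. x * x * z \<in> R}"
      unfolding I_def
    proof (rule ideal_generated_least)
      show "is_submodule R {z. x * x * z \<in> R}"
        by (auto simp: is_submodule_def distrib_left R_add mult.left_commute[of "x * x"] R_mult)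
      show "(\<Union>M\<in>\<M>. L M) \<subseteq> {z. x * x * z \<in> R}"
        using \<M>(2) by (auto simp: L_def ac_simps)
    qed
    with that show ?thesis by blast
  qed
  obtain M0 where "M0 \<in> \<M>" using inf by (metis finite.emptyI ex_in_conv)
  then have "1 \<in> I" using RL LI R_1 by blast
  then have "I \<in> nonzero_ideals R"
    using xI x by (intro nonzero_idealsI[OF Is, of 1 "x * x"]) (auto intro: R_mult)
  then have "1 \<in> ideal_product I (ideal_colon (endo_ring I) I)"
    using st stable_ideal_iff[OF Is] by (simp add: stable_domain_def)
  then obtain n :: nat and a b where ab: "1 = (\<Sum>i<n. a i * b i)" "\<And>i. i < n \<Longrightarrow> a i \<in> I"
    "\<And>i. i < n \<Longrightarrow> b i \<in> ideal_colon (endo_ring I) I"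
    unfolding ideal_product_def by blast
  have "\<forall>i<n. \<exists>F. finite F \<and> (\<forall>M\<in>\<M> - F. \<exists>s\<in>R - M. s * a i \<in> R)"
    using ab(2) \<open>I \<subseteq> N\<close> unfolding N_def by blast
  then obtain F where F: "\<And>i. i < n \<Longrightarrow> finite (F i)"
    "\<And>i M. i < n \<Longrightarrow> M \<in> \<M> - F i \<Longrightarrow> \<exists>s\<in>R - M. s * a i \<in> R" by metis
  have "finite (\<Union>i<n. F i)" using F(1) by auto
  \<comment> \<open>Only finitely many \<open>a i\<close> occur in the relation for 1, so an
    infinite family leaves an \<open>M\<close> at which all of them are locally in \<open>R\<close>.
    There the relation makes \<open>L M\<close> closed under products.\<close>
  then obtain M where M: "M \<in> \<M>" "M \<notin> (\<Union>i<n. F i)"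
    using inf by (metis finite_subset subsetI)
  have "\<exists>s\<in>R - M. \<forall>i\<in>{..<n}. s * a i \<in> R"
    using F(2) M submodule_R by (intro common_multiplier[OF Ms(3)[OF M(1)]]) auto
  then obtain s where s: "s \<in> R - M" "\<And>i. i < n \<Longrightarrow> s * a i \<in> R" by auto
  have "y * y' \<in> L M" if y: "y \<in> L M" "y' \<in> L M" for y y'
  proof -
    have "(s * a i) * (b i * y * y') \<in> I" if "i < n" for i
    proof (rule submodule_scale[OF Is s(2)[OF that]])
      show "b i * y * y' \<in> I" using ab(3)[OF that] y LI[OF M(1)] unfolding colon_endo_iff by blast
    qed
    then have "(\<Sum>i<n. (s * a i) * (b i * y * y')) \<in> I"
      by (intro submodule_sum[OF Is]) auto
    moreover have "(\<Sum>i<n. (s * a i) * (b i * y * y')) = s * (y * y') * (\<Sum>i<n. a i * b i)"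
      unfolding sum_distrib_left by (intro sum.cong) (auto simp: ac_simps)
    ultimately have "s * (y * y') \<in> I" unfolding ab(1)[symmetric] by simp
    then obtain s' where s': "s' \<in> R - M" "s' * (s * (y * y')) \<in> L M"
      using loc[OF M(1)] by blast
    define t where "t = s' * s"
    have t: "t \<in> R - M" unfolding t_def by (rule prime_compl(4)[OF Ms(3)[OF M(1)] s'(1) s(1)])
    then obtain r where r: "r \<in> R" "1 - r * t \<in> M"
      using \<M>(1)[OF M(1)] unfolding max_ideal_of_def by blast
    \<comment> \<open>In \<open>1 = (r + u * r) * t + u * u\<close> the first summand is handled by
      the multiplier \<open>t\<close>; in the second, one factor \<open>u\<close> is absorbed by
      \<open>y\<close> and the other by \<open>y'\<close>.\<close>
    define u where "u = 1 - r * t"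
    have u: "u \<in> M" "u \<in> R" using r Ms(2)[OF M(1)] by (auto simp: u_def)
    have "y * y' * m * m' \<in> R" if m: "m \<in> M" "m' \<in> M" for m m'
    proof -
      have 1: "t * (y * y') * m * m' \<in> R" using s'(2) m unfolding L_def t_def by (auto simp: mult.assoc)
      have 2: "(r + u * r) * (t * (y * y') * m * m') + (y * u * m) * (y' * u * m') \<in> R"
      proof (rule R_add)
        show "(r + u * r) * (t * (y * y') * m * m') \<in> R"
          by (rule R_mult[OF R_add[OF r(1) R_mult[OF u(2) r(1)]] 1])
        have "y * u * m \<in> R" "y' * u * m' \<in> R" using y m u(1) unfolding L_def by blast+
        then show "(y * u * m) * (y' * u * m') \<in> R" by (rule R_mult)
      qed
      have "1 = (r + u * r) * t + u * u" by (simp add: u_def algebra_simps)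
      then have "y * y' * m * m' = ((r + u * r) * t + u * u) * (y * y' * m * m')"
        by (metis mult_1)
      also have "\<dots> = (r + u * r) * (t * (y * y') * m * m') + (y * u * m) * (y' * u * m')"
        by (simp add: algebra_simps)
      finally have "y * y' * m * m' = (r + u * r) * (t * (y * y') * m * m') + (y * u * m) * (y' * u * m')" .
      with 2 show ?thesis by (simp only:)
    qed
    then show ?thesis unfolding L_def by blast
  qed
  moreover have "M \<in> nonzero_ideals R"
    using Ms(1,2)[OF M(1)] \<M>(2)[OF M(1)] x by (intro nonzero_idealsI[of R M x 1]) auto
  then have "stable_ideal M" using st by (simp add: stable_domain_def)
  ultimately show False
    using colon_square_not_ring[OF \<M>(1)[OF M(1)]] unfolding L_def by blast
qed

text \<open>The part of \<open>J\<close> that \<open>p\<close> sends into \<open>R\<close> is stable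
  and generates \<open>J\<close> over \<open>T\<close>. Hypothesis \<open>fr\<close> fixes no
  multiplicative set, so localizations of the polynomial ring count as rings of fractions of
  \<open>Na_v R\<close>.\<close>

lemma stable_domain_fractions:
  assumes st: "stable_domain R" and T: "subring_of_field T" "R \<subseteq> T"
    and fr: "\<And>z. z \<in> T \<Longrightarrow> \<exists>s\<in>R. s \<noteq> 0 \<and> 1 / s \<in> T \<and> s * z \<in> R"
  shows "stable_domain T"
  unfolding stable_domain_def
proof
  interpret T: field_subring T by (rule field_subring.intro[OF T(1)])
  fix J assume J: "J \<in> nonzero_ideals T"
  have Js: "is_submodule T J" by (rule nonzero_ideals_submodule[OF J])
  obtain y0 d where y0: "y0 \<in> J" "y0 \<noteq> 0" and d: "d \<in> T" "d \<noteq> 0" "\<And>y. y \<in> J \<Longrightarrow> d * y \<in> T"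
    using nonzero_ideals_obtain[OF J] by metis
  obtain t where t: "t \<in> R" "t \<noteq> 0" "t * d \<in> R" using fr[OF d(1)] by blast
  define p where "p = t * d"
  have p: "p \<in> R" "p \<noteq> 0" using t d by (auto simp: p_def)
  have pJ: "p * y \<in> T" if "y \<in> J" for y
    using T.R_mult[OF _ d(3)[OF that], of t] t(1) T(2) by (auto simp: p_def mult.assoc)
  define I where "I = {y \<in> J. p * y \<in> R}"
  have Is: "is_submodule R I"
    using Js T(2) unfolding I_def is_submodule_def
    by (auto simp: distrib_left mult.left_commute[of p] R_add R_mult)
  have f: "\<exists>s. s \<noteq> 0 \<and> 1 / s \<in> T \<and> s * y \<in> I" if "y \<in> J" for y
  proof -
    obtain s where "s \<in> R" "s \<noteq> 0" "1 / s \<in> T" "s * (p * y) \<in> R" using fr[OF pJ[OF \<open>y \<in> J\<close>]] by blast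
    moreover from this have "s * y \<in> J" using submodule_scale[OF Js _ that] T(2) by blast
    ultimately show ?thesis by (auto simp: I_def mult.left_commute)
  qed
  obtain s where s: "s \<noteq> 0" "s * y0 \<in> I" using f[OF y0(1)] by blast
  have "I \<in> nonzero_ideals R"
    by (rule nonzero_idealsI[OF Is s(2), of p]) (use p s(1) y0(2) in \<open>auto simp: I_def\<close>)
  then have "1 \<in> ideal_product I (ideal_colon (endo_ring I) I)"
    using st stable_ideal_iff[OF Is] by (simp add: stable_domain_def)
  moreover have "I \<subseteq> J" by (auto simp: I_def)
  ultimately show "stable_ideal J"
    using product_colon_endo_fractions[OF Js _ f] stable_ideal_iff[OF Js] by blast
qed

text \<open>If \<open>P\<close> and \<open>P'\<close> both lie in the family, an element of \<open>(J\<^sub>P : J\<^sub>P)\<close> can be moved into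
  \<open>(J\<^sub>P\<^sub>' : J\<^sub>P\<^sub>')\<close> by a multiplier outside \<open>P\<close>, because \<open>J\<^sub>P\<^sub>'\<close> is invertible over its endomorphism ring.
  By finite character it follows that the endomorphism ring and the inverse of \<open>J\<close> localize well.\<close>
lemma locally_stable_ideal:
  assumes primes: "\<And>P. P \<in> \<M> \<Longrightarrow> prime_ideal_of R P"
    and Js: "is_submodule R J" and Jloc: "\<And>P. P \<in> \<M> \<Longrightarrow> J \<subseteq> localization R P"
    and Jint: "\<And>y. (\<And>P. P \<in> \<M> \<Longrightarrow> \<exists>s\<in>R - P. s * y \<in> J) \<Longrightarrow> y \<in> J"
    and x: "x \<in> J" "x \<in> R" "x \<noteq> 0" "finite {P \<in> \<M>. x \<in> P}"
    and st: "\<And>P. P \<in> \<M> \<Longrightarrow> stable_domain (localization R P)"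
    and M: "M \<in> \<M>"
  shows "\<exists>s\<in>R - M. s \<in> ideal_product J (ideal_colon (endo_ring J) J)"
proof -
  define JL where "JL P = fractions_with J (R - P)" for P
  define E where "E P = endo_ring (JL P)" for P
  define C where "C P = ideal_colon (E P) (JL P)" for P
  have mem: "y \<in> JL P \<longleftrightarrow> (\<exists>s\<in>R - P. s * y \<in> J)" if "P \<in> \<M>" for y P
    unfolding JL_def by (rule mem_fractions_prime[OF primes[OF that] Js])
  have JLs: "is_submodule (localization R P) (JL P)" if "P \<in> \<M>" for P
    unfolding JL_def localization_def
    by (rule submodule_fractions_with[OF Js prime_compl[OF primes[OF that]]])
  have RT: "R \<subseteq> localization R P" if "P \<in> \<M>" for P
    unfolding localization_def by (rule fractions_with_incl[OF prime_compl(2)[OF primes[OF that]]])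
  have inv: "1 / s \<in> localization R P" if "s \<in> R - P" for s P
    using that R_1 unfolding localization_def fractions_with_def by blast
  have JJL: "J \<subseteq> JL P" if "P \<in> \<M>" for P
    unfolding JL_def by (rule fractions_with_incl[OF prime_compl(2)[OF primes[OF that]]])
  have T: "field_subring (localization R P)" if "P \<in> \<M>" for P
    unfolding localization_def field_subring_def
    by (rule subring_fractions_with[OF prime_compl[OF primes[OF that]]])
  have JLT: "JL P \<subseteq> localization R P" if P: "P \<in> \<M>" for P
  proof
    fix y assume "y \<in> JL P"
    then obtain s where s: "s \<in> R - P" "s * y \<in> J" using mem[OF P] by blast
    have "1 / s * (s * y) \<in> localization R P"
      using field_subring.R_mult[OF T[OF P] inv[OF s(1)]] Jloc[OF P] s(2) by blast
    moreover have "s \<noteq> 0" using s(1) prime_compl(3)[OF primes[OF P]] by metis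
    ultimately show "y \<in> localization R P" by simp
  qed
  have Es: "is_submodule (localization R P) (E P)" if "P \<in> \<M>" for P
    unfolding E_def endo_ring_def by (rule submodule_ideal_colon[OF JLs[OF that]])
  have EsR: "is_submodule R (E P)" if "P \<in> \<M>" for P
    using Es[OF that] RT[OF that] unfolding is_submodule_def by blast
  have Ering: "a * b \<in> E P" if "a \<in> E P" "b \<in> E P" for a b P
    using that unfolding E_def endo_ring_iff by (simp add: mult.assoc)
  have TE: "localization R P \<subseteq> E P" if "P \<in> \<M>" for P
    using submodule_scale[OF JLs[OF that]] by (auto simp: E_def endo_ring_iff)
  have one: "1 \<in> ideal_product (JL P) (C P)" if P: "P \<in> \<M>" for P
  proof -
    have "JL P \<in> nonzero_ideals (localization R P)"
      using JLT[OF P] JJL[OF P] x RT[OF P]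
      by (intro nonzero_idealsI[OF JLs[OF P], of x 1]) auto
    then show ?thesis
      using st[OF P] stable_ideal_iff[OF JLs[OF P]] by (simp add: stable_domain_def C_def E_def)
  qed
  \<comment> \<open>By the relation at \<open>P'\<close> it is enough to treat
    \<open>a * e * z\<close>: \<open>z\<close> sends a multiple of \<open>a\<close> into the
    localization of \<open>J\<close> at \<open>P\<close>, some \<open>s\<close> outside
    \<open>P\<close> returns it to \<open>J\<close>, and \<open>e\<close> sends it into
    \<open>E P'\<close>.\<close>
  have move: "\<exists>s\<in>R - P. s * z \<in> E P'" if P: "P \<in> \<M>" "P' \<in> \<M>" and z: "z \<in> E P" for P P' z
  proof -
    have "z \<in> fractions_with (E P') (R - P)"
    proof (rule ideal_product_one_cancel[OF one[OF P(2)]])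
      show "is_submodule (localization R P) (fractions_with (E P') (R - P))"
        unfolding localization_def
        by (rule submodule_fractions_with[OF EsR[OF P(2)] prime_compl[OF primes[OF P(1)]]])
      fix a e assume a: "a \<in> JL P'" and e: "e \<in> C P'"
      obtain t where t: "t \<in> R - P'" "t * a \<in> J" using a mem[OF P(2)] by blast
      have "t \<noteq> 0" using t(1) prime_compl(3)[OF primes[OF P(2)]] by metis
      have "z * (t * a) \<in> JL P" using z t(2) JJL[OF P(1)] unfolding E_def endo_ring_iff by blast
      then obtain s where s: "s \<in> R - P" "s * (z * (t * a)) \<in> J" using mem[OF P(1)] by blast
      then have "e * (s * (z * (t * a))) \<in> E P'"
        using e JJL[OF P(2)] unfolding C_def ideal_colon_def by blast
      then have "1 / t * (e * (s * (z * (t * a)))) \<in> E P'"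
        by (rule submodule_scale[OF Es[OF P(2)] inv[OF t(1)]])
      moreover have "1 / t * (e * (s * (z * (t * a)))) = s * (a * e * z)"
        using \<open>t \<noteq> 0\<close> by (simp add: ac_simps)
      ultimately have "s * (a * e * z) \<in> E P'" by simp
      with s(1) show "a * e * z \<in> fractions_with (E P') (R - P)"
        unfolding mem_fractions_prime[OF primes[OF P(1)] EsR[OF P(2)]] by blast
    qed
    then show ?thesis unfolding mem_fractions_prime[OF primes[OF P(1)] EsR[OF P(2)]] .
  qed
  define V where "V = {P \<in> \<M>. x \<in> P}"
  \<comment> \<open>Outside the finite set \<open>V\<close> the element \<open>x\<close> is a unit
    of the localization.\<close>
  have off: "y / x \<in> localization R P" if "P \<in> \<M>" "P \<notin> V" "y \<in> localization R P" for y P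
  proof -
    have "x \<in> R - P" using that x by (auto simp: V_def)
    then have "1 / x * y \<in> localization R P"
      using field_subring.R_mult[OF T[OF that(1)] inv that(3)] by blast
    then show ?thesis by simp
  qed
  have EI: "z \<in> endo_ring J" if z: "\<And>P. P \<in> \<M> \<Longrightarrow> z \<in> E P" for z
    unfolding endo_ring_iff
  proof (intro ballI Jint)
    fix y P assume "y \<in> J" "P \<in> \<M>"
    then have "z * y \<in> JL P" using z JJL unfolding E_def endo_ring_iff by blast
    then show "\<exists>s\<in>R - P. s * (z * y) \<in> J" using mem \<open>P \<in> \<M>\<close> by blast
  qed
  have IE: "endo_ring J \<subseteq> E P" if P: "P \<in> \<M>" for P
  proof
    fix z assume z: "z \<in> endo_ring J"
    have "z * y \<in> JL P" if "y \<in> JL P" for y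
      using that z unfolding mem[OF P] endo_ring_iff by (metis mult.left_commute)
    then show "z \<in> E P" unfolding E_def endo_ring_iff by blast
  qed
  \<comment> \<open>The primes in \<open>V\<close> are handled by \<open>move\<close> and a common
    multiplier. At the others \<open>s0 * (z * x) \<in> J\<close> is enough, as \<open>x\<close> is
    a unit there.\<close>
  have E_loc: "\<exists>s\<in>R - M. s * z \<in> endo_ring J" if z: "z \<in> E M" for z
  proof -
    have "z * x \<in> JL M" using z x(1) JJL[OF M] unfolding E_def endo_ring_iff by blast
    then obtain s0 where s0: "s0 \<in> R - M" "s0 * (z * x) \<in> J" using mem[OF M] by blast
    have "\<exists>s\<in>R - M. \<forall>P\<in>V. s * z \<in> E P"
      using move[OF M _ z] EsR x(4) by (intro common_multiplier[OF primes[OF M]]) (auto simp: V_def)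
    then obtain s1 where s1: "s1 \<in> R - M" "\<And>P. P \<in> V \<Longrightarrow> s1 * z \<in> E P" by blast
    have "(s0 * s1) * z \<in> E P" if P: "P \<in> \<M>" for P
    proof (cases "P \<in> V")
      case True
      then show ?thesis using submodule_scale[OF EsR[OF P] _ s1(2)] s0(1) by (auto simp: mult.assoc)
    next
      case False
      have "s0 * (z * x) \<in> localization R P" using s0(2) Jloc[OF P] by blast
      from off[OF P False this] have "s0 * z \<in> E P" using x(3) TE[OF P] by auto
      then have "s1 * (s0 * z) \<in> E P" using submodule_scale[OF EsR[OF P]] s1(1) by blast
      then show ?thesis by (simp add: ac_simps)
    qed
    then have "(s0 * s1) * z \<in> endo_ring J" by (rule EI)
    then show ?thesis using prime_compl(4)[OF primes[OF M] s0(1) s1(1)] by blast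
  qed
  \<comment> \<open>Finite generation from the inverse: \<open>z * y\<close> is the sum of
    \<open>(z * a i) * (e i * y)\<close>, so it is enough to test \<open>z\<close> on the
    \<open>a i\<close>, cleared into \<open>J\<close>.\<close>
  have gen: "\<exists>F\<subseteq>J. finite F \<and> (\<forall>z. (\<forall>f\<in>F. z * f \<in> E P) \<longrightarrow> (\<forall>y\<in>J. z * y \<in> E P))" if P: "P \<in> \<M>" for P
  proof -
    obtain n :: nat and a e where ae: "1 = (\<Sum>i<n. a i * e i)" "\<And>i. i < n \<Longrightarrow> a i \<in> JL P"
      "\<And>i. i < n \<Longrightarrow> e i \<in> C P"
      using one[OF P] unfolding ideal_product_def by blast
    have "\<forall>i<n. \<exists>s. s \<in> R - P \<and> s * a i \<in> J" using ae(2) mem[OF P] by blast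
    then obtain s where s: "\<And>i. i < n \<Longrightarrow> s i \<in> R - P" "\<And>i. i < n \<Longrightarrow> s i * a i \<in> J" by metis
    have "z * y \<in> E P" if z: "\<forall>f\<in>(\<lambda>i. s i * a i) ` {..<n}. z * f \<in> E P" and y: "y \<in> J" for z y
    proof -
      have "a i * e i * (z * y) \<in> E P" if i: "i < n" for i
      proof -
        have "s i \<noteq> 0" using s(1)[OF i] prime_compl(3)[OF primes[OF P]] by metis
        have "z * (s i * a i) \<in> E P" using z i by blast
        then have "1 / s i * (z * (s i * a i)) \<in> E P"
          by (rule submodule_scale[OF Es[OF P] inv[OF s(1)[OF i]]])
        then have "z * a i \<in> E P" using \<open>s i \<noteq> 0\<close> by (simp add: ac_simps)
        moreover have "e i * y \<in> E P" using ae(3)[OF i] y JJL[OF P] unfolding C_def ideal_colon_def by blast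
        ultimately have "(z * a i) * (e i * y) \<in> E P" by (rule Ering)
        then show ?thesis by (simp add: ac_simps)
      qed
      then have "(\<Sum>i<n. a i * e i * (z * y)) \<in> E P" by (intro submodule_sum[OF Es[OF P]]) auto
      then show ?thesis using ae(1) by (simp add: sum_distrib_right[symmetric])
    qed
    moreover have "(\<lambda>i. s i * a i) ` {..<n} \<subseteq> J" using s(2) by auto
    ultimately show ?thesis by (intro exI[of _ "(\<lambda>i. s i * a i) ` {..<n}"]) blast
  qed
  then obtain F where F: "\<And>P. P \<in> \<M> \<Longrightarrow> F P \<subseteq> J" "\<And>P. P \<in> \<M> \<Longrightarrow> finite (F P)"
    "\<And>P z y. P \<in> \<M> \<Longrightarrow> \<forall>f\<in>F P. z * f \<in> E P \<Longrightarrow> y \<in> J \<Longrightarrow> z * y \<in> E P"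
    by metis
  \<comment> \<open>One finite test set for all primes: generators at the primes in
    \<open>V\<close>, and \<open>x\<close> for the rest, where \<open>y / x\<close> lies in the
    localization.\<close>
  define G where "G = insert x (\<Union>P\<in>V. F P)"
  have G: "finite G" "G \<subseteq> J" using F(1,2) x(1,4) by (auto simp: G_def V_def)
  have gens: "z * y \<in> E P" if P: "P \<in> \<M>" and z: "\<And>f. f \<in> G \<Longrightarrow> z * f \<in> E P" and y: "y \<in> J" for P z y
  proof (cases "P \<in> V")
    case True
    then show ?thesis using z by (intro F(3)[OF P _ y]) (auto simp: G_def)
  next
    case False
    have "y / x \<in> E P" using off[OF P False] Jloc[OF P] TE[OF P] y by blast
    moreover have "z * x \<in> E P" using z by (simp add: G_def)
    ultimately have "(z * x) * (y / x) \<in> E P" by (rule Ering[rotated])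
    then show ?thesis using x(3) by simp
  qed
  have Ejs: "is_submodule R (endo_ring J)"
    unfolding endo_ring_def by (rule submodule_ideal_colon[OF Js])
  have C_loc: "\<exists>s\<in>R - M. s * e \<in> ideal_colon (endo_ring J) J" if e: "e \<in> C M" for e
  proof -
    have "\<exists>s\<in>R - M. \<forall>f\<in>G. s * (e * f) \<in> endo_ring J"
    proof (rule common_multiplier[OF primes[OF M] G(1) Ejs])
      fix f assume "f \<in> G"
      then have "e * f \<in> E M" using e G(2) JJL[OF M] unfolding C_def ideal_colon_def by blast
      then show "\<exists>s\<in>R - M. s * (e * f) \<in> endo_ring J" by (rule E_loc)
    qed
    then obtain s where s: "s \<in> R - M" "\<And>f. f \<in> G \<Longrightarrow> s * (e * f) \<in> endo_ring J" by blast
    have "(s * e) * y \<in> endo_ring J" if y: "y \<in> J" for y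
    proof (rule EI, rule gens[OF _ _ y])
      fix P f assume "P \<in> \<M>" "f \<in> G"
      then show "s * e * f \<in> E P" using s(2) IE by (auto simp: mult.assoc)
    qed
    with s(1) show ?thesis unfolding ideal_colon_def by blast
  qed
  define A where "A = ideal_product J (ideal_colon (endo_ring J) J)"
  have As: "is_submodule R A" unfolding A_def by (rule submodule_ideal_product[OF Js])
  have "ideal_product (JL M) (C M) \<subseteq> fractions_with A (R - M)"
  proof (rule ideal_product_subset)
    have "is_submodule (localization R M) (fractions_with A (R - M))"
      unfolding localization_def
      by (rule submodule_fractions_with[OF As prime_compl[OF primes[OF M]]])
    then show "0 \<in> fractions_with A (R - M)"
      "\<And>x y. x \<in> fractions_with A (R - M) \<Longrightarrow> y \<in> fractions_with A (R - M)
        \<Longrightarrow> x + y \<in> fractions_with A (R - M)"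
      by (auto intro: submodule_0 submodule_add)
    fix a e assume "a \<in> JL M" "e \<in> C M"
    then obtain s t where st: "s \<in> R - M" "s * a \<in> J" "t \<in> R - M" "t * e \<in> ideal_colon (endo_ring J) J"
      using mem[OF M] C_loc by blast
    then have "(s * a) * (t * e) \<in> A" unfolding A_def by (blast intro: ideal_product_memI)
    then have "(s * t) * (a * e) \<in> A" by (simp add: ac_simps)
    then show "a * e \<in> fractions_with A (R - M)"
      unfolding mem_fractions_prime[OF primes[OF M] As]
      using prime_compl(4)[OF primes[OF M] st(1,3)] by blast
  qed
  with one[OF M] have "1 \<in> fractions_with A (R - M)" by blast
  then obtain s where "s \<in> R - M" "s * 1 \<in> A"
    unfolding mem_fractions_prime[OF primes[OF M] As] by blast
  then show ?thesis by (auto simp: A_def)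
qed

end

context nonfield_domain
begin

section \<open>Maximal \<open>t\<close>-ideals of polynomial rings\<close>

text \<open>A constant that multiplies the coefficient set \<open>C\<close> of \<open>B\<close> into
  \<open>R\<close> multiplies \<open>y\<close> into the polynomial ring, so the coefficients of
  \<open>y\<close> lie in \<open>v_op R C\<close>, hence in \<open>M\<close>. A larger proper
  \<open>t\<close>-ideal contains a nonzero constant, so it cannot meet \<open>N_v R\<close> and is
  confined to some \<open>M'[X]\<close>.\<close>

lemma t_Max_extended:
  assumes M: "M \<in> t_Max R"
  shows "polynomial_ring M \<in> t_Max (polynomial_ring R)"
proof -
  interpret P: nonfield_domain "polynomial_ring R" by (rule nonfield_domain_polynomial_ring)
  have Ms: "is_submodule R M" "M \<subseteq> R" by (rule t_Max_submodule[OF M], rule t_Max_subset[OF M])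
  have M0: "0 \<in> M" by (rule submodule_0[OF Ms(1)])
  have nzM: "M \<in> nonzero_ideals R" and tM: "t_op R M = M"
    using t_Max_proper[OF M] by (auto simp: proper_integral_t_ideal_def)
  obtain a where a: "a \<in> M" "a \<noteq> 0" using t_Max_nonzero[OF M] by blast
  have MXs: "is_submodule (polynomial_ring R) (polynomial_ring M)"
    by (rule submodule_polynomial_ring[OF Ms(1)])
  have MXR: "polynomial_ring M \<subseteq> polynomial_ring R" by (rule polynomial_ring_mono[OF Ms(2)])
  have aX: "to_fract [:a:] \<in> polynomial_ring M" using a(1) by (simp add: polys_over_const[OF Ms(1)])
  have nz: "polynomial_ring M \<in> nonzero_ideals (polynomial_ring R)"
    by (rule P.integral_nonzero_idealsI[OF MXs MXR aX]) (use a(2) in simp)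
  have "t_op (polynomial_ring R) (polynomial_ring M) \<subseteq> polynomial_ring M"
  proof
    fix y assume "y \<in> t_op (polynomial_ring R) (polynomial_ring M)"
    then obtain B where B: "finite B" "B \<subseteq> polynomial_ring M" "y \<in> v_op (polynomial_ring R) B"
      using P.t_op_iff[OF nz] by blast
    define C where "C = (\<Union>p\<in>to_fract -` B. range (coeff p))"
    have "finite (to_fract -` B)"
      using B(1) by (intro finite_vimageI) (auto simp: inj_on_def)
    then have "finite C" unfolding C_def by (auto simp: range_coeff)
    moreover have "C \<subseteq> M" using B(2) by (auto simp: C_def polys_over_def)
    moreover have yz: "y * to_fract [:z:] \<in> polynomial_ring R" if z: "\<forall>c\<in>C. z * c \<in> R" for z
    proof -
      have "to_fract [:z:] * b \<in> polynomial_ring R" if "b \<in> B" for b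
      proof -
        obtain p where p: "b = to_fract p" using \<open>b \<in> B\<close> B(2) by (auto simp: polynomial_ring_def)
        then have "\<forall>i. z * coeff p i \<in> R" using z \<open>b \<in> B\<close> by (auto simp: C_def)
        then have "[:z:] * p \<in> polys_over R" by (simp add: polys_over_def)
        then show ?thesis unfolding p to_fract_mult[symmetric] to_fract_mem_polynomial_ring .
      qed
      then show ?thesis using B(3) unfolding v_op_iff by blast
    qed
    \<comment> \<open>The multiplier 1 places \<open>y\<close> in the polynomial ring, so that it
      has coefficients.\<close>
    have "y * to_fract [:1:] \<in> polynomial_ring R"
      using \<open>C \<subseteq> M\<close> Ms(2) by (intro yz) auto
    then have "y \<in> polynomial_ring R" by (metis mult.right_neutral one_pCons to_fract_1)
    then obtain p where p: "y = to_fract p" by (auto simp: polynomial_ring_def)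
    have "coeff p i \<in> v_op R C" for i
      unfolding v_op_iff
    proof (intro allI impI)
      fix z assume "\<forall>c\<in>C. z * c \<in> R"
      from yz[OF this] have "p * [:z:] \<in> polys_over R"
        unfolding p to_fract_mult[symmetric] to_fract_mem_polynomial_ring .
      then have "coeff (p * [:z:]) i \<in> R" unfolding polys_over_def by blast
      then show "coeff p i * z \<in> R" by (simp add: mult.commute)
    qed
    then have "\<forall>i. coeff p i \<in> M" using t_op_iff[OF nzM] tM \<open>finite C\<close> \<open>C \<subseteq> M\<close> by blast
    then show "y \<in> polynomial_ring M" by (simp add: p polys_over_def)
  qed
  then have t: "t_op (polynomial_ring R) (polynomial_ring M) = polynomial_ring M"
    using P.subset_t_op[OF nz] by blast
  have "to_fract 1 \<notin> polynomial_ring M"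
    using N_v_not_in_t_Max[OF M N_v_one] unfolding to_fract_mem_polynomial_ring .
  moreover have "to_fract 1 \<in> polynomial_ring R" by simp
  ultimately have "polynomial_ring M \<subset> polynomial_ring R" using MXR by blast
  with nz t have proper: "proper_integral_t_ideal (polynomial_ring R) (polynomial_ring M)"
    unfolding proper_integral_t_ideal_def by blast
  moreover have "I = polynomial_ring M"
    if I: "proper_integral_t_ideal (polynomial_ring R) I" "polynomial_ring M \<subseteq> I" for I
  proof -
    have Is: "is_submodule (polynomial_ring R) I" "I \<subseteq> polynomial_ring R"
      using I(1) nonzero_ideals_submodule unfolding proper_integral_t_ideal_def by blast+
    have "to_fract [:a:] \<in> I" using aX I(2) by blast
    have "[:a:] \<noteq> 0" using a(2) by simp
    from N_v_or_t_Max[OF Is \<open>to_fract [:a:] \<in> I\<close> this] show ?thesis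
    proof (elim disjE bexE)
      fix h assume "h \<in> N_v R" "to_fract h \<in> I"
      then show ?thesis
        using GV_const_N_v[of a h] P.proper_t_ideal_no_GV[OF I(1), of "{to_fract [:a:], to_fract h}"]
          a Ms(2) \<open>to_fract [:a:] \<in> I\<close> by auto
    next
      fix M' assume M': "M' \<in> t_Max R" "I \<subseteq> polynomial_ring M'"
      have "M \<subseteq> M'"
      proof
        fix c assume "c \<in> M"
        then have "to_fract [:c:] \<in> polynomial_ring M" by (simp add: polys_over_const[OF Ms(1)])
        then have "to_fract [:c:] \<in> polynomial_ring M'" using I(2) M'(2) by blast
        then show "c \<in> M'" by (simp add: polys_over_const[OF t_Max_submodule[OF M'(1)]])
      qed
      then have "M = M'" by (rule t_Max_antichain[OF M M'(1)])
      then show ?thesis using M'(2) I(2) by blast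
    qed
  qed
  ultimately show ?thesis unfolding t_Max_def by blast
qed

text \<open>If \<open>N\<close> meets \<open>N_v R\<close>, a nonzero constant would complete a
  Glaz-Vasconcelos pair in it; otherwise \<open>N\<close> is contained in some \<open>M[X]\<close>
  and equals it by maximality.\<close>

lemma t_Max_polynomial_ring_cases:
  assumes N: "N \<in> t_Max (polynomial_ring R)"
  shows "(\<exists>M\<in>t_Max R. N = polynomial_ring M) \<or> (\<forall>a\<in>R. a \<noteq> 0 \<longrightarrow> to_fract [:a:] \<notin> N)"
proof -
  interpret P: nonfield_domain "polynomial_ring R" by (rule nonfield_domain_polynomial_ring)
  note Ns = P.t_Max_submodule[OF N] P.t_Max_subset[OF N]
  obtain x where "x \<in> N" "x \<noteq> 0" using P.t_Max_nonzero[OF N] by blast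
  then obtain p where "to_fract p \<in> N" "p \<noteq> 0" using Ns(2) by (auto simp: polynomial_ring_def)
  from N_v_or_t_Max[OF Ns this] show ?thesis
  proof (elim disjE bexE)
    fix h assume h: "h \<in> N_v R" "to_fract h \<in> N"
    have "to_fract [:a:] \<notin> N" if "a \<in> R" "a \<noteq> 0" for a
      using P.t_Max_no_GV[OF N _, of "{to_fract [:a:], to_fract h}"] GV_const_N_v[OF that h(1)] h(2)
      by blast
    then show ?thesis by blast
  next
    fix M assume M: "M \<in> t_Max R" "N \<subseteq> polynomial_ring M"
    then show ?thesis using P.t_Max_antichain[OF N t_Max_extended[OF M(1)]] by blast
  qed
qed

text \<open>These are the \<open>t\<close>-maximal uppers to zero, which correspond to irreducible factors of \<open>p\<close> over
  the quotient field.\<close>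
lemma finite_t_Max_uppers:
  assumes "p \<in> polys_over R" "p \<noteq> 0"
  shows "finite {N \<in> t_Max (polynomial_ring R).
    to_fract p \<in> N \<and> (\<forall>a\<in>R. a \<noteq> 0 \<longrightarrow> to_fract [:a:] \<notin> N)}"
  using assms
proof (induction "degree p" arbitrary: p rule: less_induct)
  case less
  interpret P: nonfield_domain "polynomial_ring R" by (rule nonfield_domain_polynomial_ring)
  define U where "U p = {N \<in> t_Max (polynomial_ring R).
    to_fract p \<in> N \<and> (\<forall>a\<in>R. a \<noteq> 0 \<longrightarrow> to_fract [:a:] \<notin> N)}" for p
  have "finite (U p)"
  proof (cases "U p = {}")
    case False
    then obtain N0 where "N0 \<in> U p" by blast
    then have N0: "N0 \<in> t_Max (polynomial_ring R)" "to_fract p \<in> N0"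
      "\<And>a. a \<in> R \<Longrightarrow> a \<noteq> 0 \<Longrightarrow> to_fract [:a:] \<notin> N0" by (auto simp: U_def)
    obtain q where q: "q \<noteq> 0" "to_fract q \<in> N0" "\<And>g. to_fract g \<in> N0 \<Longrightarrow> q dvd g"
      using least_degree_dvd[OF P.t_Max_submodule[OF N0(1)] N0(2) less.prems(2)] by blast
    have qR: "q \<in> polys_over R" using q(2) P.t_Max_subset[OF N0(1)] by auto
    obtain r where r: "p = q * r" using q(3)[OF N0(2)] by (elim dvdE)
    have "degree q \<noteq> 0"
    proof
      assume "degree q = 0"
      then obtain a where a: "q = [:a:]" by (rule degree_eq_zeroE)
      then have "a \<in> R" "a \<noteq> 0" using qR q(1) by (auto simp: polys_over_const[OF submodule_R])
      with N0(3) q(2) a show False by blast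
    qed
    obtain d where d: "d \<in> R" "d \<noteq> 0" "smult d r \<in> polys_over R"
      using clear_denominators[OF dwqf] by blast
    have "degree (smult d r) < degree p"
      using d(2) r less.prems(2) \<open>degree q \<noteq> 0\<close> by (auto simp: degree_mult_eq)
    then have fin: "finite (U (smult d r))"
      unfolding U_def using less.hyps d r less.prems(2) by auto
    \<comment> \<open>By primeness each such ideal contains \<open>q\<close>, and then is
      \<open>N0\<close>, or it contains the cleared cofactor, which has smaller degree.\<close>
    have "U p \<subseteq> insert N0 (U (smult d r))"
    proof
      fix N assume "N \<in> U p"
      then have N: "N \<in> t_Max (polynomial_ring R)" "to_fract p \<in> N"
        "\<And>a. a \<in> R \<Longrightarrow> a \<noteq> 0 \<Longrightarrow> to_fract [:a:] \<notin> N" by (auto simp: U_def)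
      note Ns = P.t_Max_submodule[OF N(1)]
      have prime: "f \<in> polys_over R \<Longrightarrow> g \<in> polys_over R \<Longrightarrow> to_fract (f * g) \<in> N
          \<Longrightarrow> to_fract f \<in> N \<or> to_fract g \<in> N" for f g
        using P.t_Max_prime[OF N(1)] unfolding prime_ideal_of_def to_fract_mult
        by (metis to_fract_mem_polynomial_ring)
      have const: "[:c:] \<in> polys_over R" if "c \<in> R" for c
        using that by (simp add: polys_over_const[OF submodule_R])
      have "to_fract ([:d:] * p) \<in> N"
        unfolding to_fract_mult using const[OF d(1)] by (intro submodule_scale[OF Ns] N(2)) simp
      moreover have "[:d:] * p = q * smult d r" by (simp add: r)
      ultimately consider "to_fract q \<in> N" | "to_fract (smult d r) \<in> N"
        using prime[OF qR d(3)] by auto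
      then show "N \<in> insert N0 (U (smult d r))"
      proof cases
        case 1
        \<comment> \<open>\<open>q\<close> divides a member of \<open>N0\<close> only over the
          field; the constant \<open>e\<close> that clears the cofactor lies outside the prime
          \<open>N\<close> and is cancelled there.\<close>
        have "N0 \<subseteq> N"
        proof
          fix y assume y: "y \<in> N0"
          then obtain g where g: "y = to_fract g" "g \<in> polys_over R"
            using P.t_Max_subset[OF N0(1)] by (auto simp: polynomial_ring_def)
          then obtain k where k: "g = q * k" using q(3) y by (metis dvdE)
          obtain e where e: "e \<in> R" "e \<noteq> 0" "smult e k \<in> polys_over R"
            using clear_denominators[OF dwqf] by blast
          have "to_fract (smult e k * q) \<in> N"
            unfolding to_fract_mult using e(3) by (intro submodule_scale[OF Ns] 1) simp
          moreover have "smult e k * q = [:e:] * g" by (simp add: k mult.commute)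
          ultimately show "y \<in> N" using prime[OF const[OF e(1)] g(2)] N(3)[OF e(1,2)] g(1) by auto
        qed
        then show ?thesis using P.t_Max_antichain[OF N0(1) N(1)] by blast
      next
        case 2
        then show ?thesis using N by (auto simp: U_def)
      qed
    qed
    then show ?thesis using fin by (rule finite_subset[OF _ finite_insert[THEN iffD2]])
  qed simp
  then show ?case by (simp add: U_def)
qed

text \<open>The multipliers of \<open>y\<close> into \<open>J\<close> are contained in no
  \<open>M[X]\<close>, so they meet \<open>N_v R\<close>, whose elements are units of
  \<open>Na_v R\<close>.\<close>

lemma Na_v_local:
  assumes J: "is_submodule (Na_v R) J"
    and loc: "\<And>M. M \<in> t_Max R \<Longrightarrow> \<exists>s\<in>polynomial_ring R - polynomial_ring M. s * y \<in> J"
  shows "y \<in> J"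
proof -
  interpret P: nonfield_domain "polynomial_ring R" by (rule nonfield_domain_polynomial_ring)
  define A where "A = {r \<in> polynomial_ring R. r * y \<in> J}"
  have JP: "is_submodule (polynomial_ring R) J"
    by (rule submodule_restrict[OF J polynomial_ring_subset_Na_v])
  have A: "is_submodule (polynomial_ring R) A" "A \<subseteq> polynomial_ring R"
    using JP by (auto simp: A_def is_submodule_def P.R_add P.R_mult distrib_right mult.assoc)
  have no: "\<not> A \<subseteq> polynomial_ring M" if "M \<in> t_Max R" for M
    using loc[OF that] by (auto simp: A_def)
  obtain M where M: "M \<in> t_Max R" using t_Max_nonempty by blast
  have "0 \<in> polynomial_ring M"
    by (rule submodule_0[OF submodule_polynomial_ring[OF t_Max_submodule[OF M]]])
  with no[OF M] obtain x where "x \<in> A" "x \<noteq> 0" by blast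
  then obtain p where "to_fract p \<in> A" "p \<noteq> 0" using A(2) by (auto simp: polynomial_ring_def)
  with N_v_or_t_Max[OF A] no obtain h where "h \<in> N_v R" "to_fract h \<in> A" by blast
  then show ?thesis using Na_v_divide[OF J] by (auto simp: A_def)
qed

text \<open>For \<open>t = q / g\<close> outside the ideal, \<open>M[X] + q R[X]\<close> exceeds
  \<open>M[X]\<close> and so meets \<open>N_v R\<close>. A relation \<open>h = m + r q\<close> shows
  that \<open>r g / h\<close> inverts \<open>t\<close> modulo the ideal.\<close>

lemma max_ideal_Na_v:
  assumes M: "M \<in> t_Max R"
  shows "max_ideal_of (Na_v R) (fractions_with (polynomial_ring M) (to_fract ` N_v R))"
proof -
  interpret P: nonfield_domain "polynomial_ring R" by (rule nonfield_domain_polynomial_ring)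
  let ?M = "fractions_with (polynomial_ring M) (to_fract ` N_v R)"
  have MXs: "is_submodule (polynomial_ring R) (polynomial_ring M)"
    by (rule submodule_polynomial_ring[OF t_Max_submodule[OF M]])
  have MXR: "polynomial_ring M \<subseteq> polynomial_ring R" by (rule polynomial_ring_mono[OF t_Max_subset[OF M]])
  note mem = mem_fractions_N_v[OF MXs]
  have "?M \<subseteq> Na_v R" using MXR unfolding fractions_with_def Na_v_def by blast
  moreover have "1 \<notin> ?M" using N_v_not_in_t_Max[OF M] by (auto simp: mem)
  moreover have "\<exists>r\<in>Na_v R. 1 - r * t \<in> ?M" if t: "t \<in> Na_v R - ?M" for t
  proof -
    obtain g q where g: "g \<in> N_v R" "to_fract g * t = to_fract q" "q \<in> polys_over R"
      using t mem_Na_v by (auto simp: polynomial_ring_def)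
    have qM: "q \<notin> polys_over M" using t g(1,2) to_fract_mem_polynomial_ring mem by fastforce
    define A where "A = {x + r * to_fract q | x r. x \<in> polynomial_ring M \<and> r \<in> polynomial_ring R}"
    have A: "is_submodule (polynomial_ring R) A" unfolding A_def by (rule P.submodule_adjoin[OF MXs])
    have AR: "A \<subseteq> polynomial_ring R"
      using MXR g(3) unfolding A_def by (auto intro!: P.R_add P.R_mult)
    have MA: "polynomial_ring M \<subseteq> A"
    proof
      fix m assume "m \<in> polynomial_ring M"
      then have "m + 0 * to_fract q \<in> A" unfolding A_def using P.R_0 by blast
      then show "m \<in> A" by simp
    qed
    have "0 + 1 * to_fract q \<in> A" unfolding A_def using submodule_0[OF MXs] P.R_1 by blast
    then have qA: "to_fract q \<in> A" by simp
    have "q \<noteq> 0" using qM polys_over_0[OF t_Max_submodule[OF M]] by metis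
    from N_v_or_t_Max[OF A AR qA this] show ?thesis
    proof (elim disjE bexE)
      fix h assume h: "h \<in> N_v R" "to_fract h \<in> A"
      then obtain m r where m: "to_fract h = m + r * to_fract q" "m \<in> polynomial_ring M"
        "r \<in> polynomial_ring R" unfolding A_def by blast
      define r' where "r' = r * to_fract g / to_fract h"
      have "r * to_fract g \<in> polynomial_ring R" using m(3) N_v_polys[OF g(1)] by (simp add: P.R_mult)
      then have "r' \<in> Na_v R" unfolding r'_def Na_v_def fractions_with_def using h(1) by blast
      moreover have "to_fract h * (1 - r' * t) = m"
      proof -
        have "to_fract h * r' = r * to_fract g" using N_v_nonzero[OF h(1)] by (simp add: r'_def)
        then have "to_fract h * (1 - r' * t) = to_fract h - r * to_fract g * t"
          by (simp add: right_diff_distrib mult.assoc[symmetric])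
        also have "\<dots> = to_fract h - r * to_fract q" by (simp add: mult.assoc g(2))
        finally show ?thesis using m(1) by simp
      qed
      then have "1 - r' * t \<in> ?M" unfolding mem using h(1) m(2) by metis
      ultimately show ?thesis by blast
    next
      fix M' assume M': "M' \<in> t_Max R" "A \<subseteq> polynomial_ring M'"
      then have "polynomial_ring M = polynomial_ring M'"
        using P.t_Max_antichain[OF t_Max_extended[OF M] t_Max_extended[OF M'(1)]] MA by blast
      then have "to_fract q \<in> polynomial_ring M" using qA M'(2) by blast
      with qM show ?thesis by simp
    qed
  qed
  ultimately show ?thesis unfolding max_ideal_of_def using submodule_Na_v[OF MXs] by blast
qed

text \<open>Contraction to constants recovers \<open>M\<close>: if \<open>h * [:a:]\<close> lies
  over the prime \<open>M'\<close> and some coefficient of \<open>h\<close> is outside it, then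
  \<open>a\<close> is in \<open>M'\<close>.\<close>

lemma t_Max_fractions_inj:
  "inj_on (\<lambda>M. fractions_with (polynomial_ring M) (to_fract ` N_v R)) (t_Max R)"
proof (rule inj_onI, rule t_Max_antichain)
  fix M M' assume M: "M \<in> t_Max R" "M' \<in> t_Max R"
    and eq: "fractions_with (polynomial_ring M) (to_fract ` N_v R)
      = fractions_with (polynomial_ring M') (to_fract ` N_v R)"
  show "M \<subseteq> M'"
  proof
    fix a assume a: "a \<in> M"
    then have "to_fract [:a:] \<in> polynomial_ring M"
      by (simp add: polys_over_const[OF t_Max_submodule[OF M(1)]])
    then have "to_fract [:a:] \<in> fractions_with (polynomial_ring M') (to_fract ` N_v R)"
      using fractions_with_incl[OF N_v_fract(2)] eq by blast
    then obtain h where h: "h \<in> N_v R" "to_fract h * to_fract [:a:] \<in> polynomial_ring M'"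
      using mem_fractions_N_v[OF submodule_polynomial_ring[OF t_Max_submodule[OF M(2)]]] by blast
    from h(2) have "h * [:a:] \<in> polys_over M'"
      unfolding to_fract_mult[symmetric] to_fract_mem_polynomial_ring .
    then have ha: "a * coeff h i \<in> M'" for i by (simp add: polys_over_def)
    obtain i where "coeff h i \<notin> M'"
      using N_v_not_in_t_Max[OF M(2) h(1)] by (auto simp: polys_over_def)
    moreover have "coeff h i \<in> R" "a \<in> R"
      using N_v_polys[OF h(1)] a t_Max_subset[OF M(1)] by (auto simp: polys_over_def)
    ultimately show "a \<in> M'"
      using ha[of i] t_Max_prime[OF M(2)] unfolding prime_ideal_of_def by blast
  qed
qed (assumption+)

lemma stable_Na_v_imp_t_finite_character:
  assumes st: "stable_domain (Na_v R)"
  shows "t_finite_character (polynomial_ring R)"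
  unfolding t_finite_character_def
proof (intro ballI impI)
  fix x assume x: "x \<in> polynomial_ring R" "x \<noteq> 0"
  then obtain p where p: "x = to_fract p" "p \<in> polys_over R" "p \<noteq> 0"
    by (auto simp: polynomial_ring_def)
  define T where "T = {M \<in> t_Max R. x \<in> polynomial_ring M}"
  let ?F = "\<lambda>M. fractions_with (polynomial_ring M) (to_fract ` N_v R)"
  have "finite (?F ` T)"
  proof (rule field_subring.stable_domain_finite_character[OF field_subring_Na_v st _ x(2)])
    show "x \<in> Na_v R" using x(1) polynomial_ring_subset_Na_v by blast
    show "max_ideal_of (Na_v R) N" if "N \<in> ?F ` T" for N
      using that max_ideal_Na_v by (auto simp: T_def)
    show "x \<in> N" if "N \<in> ?F ` T" for N
      using that fractions_with_incl[OF N_v_fract(2)] unfolding T_def by blast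
  qed
  then have "finite T"
    by (rule finite_imageD) (rule inj_on_subset[OF t_Max_fractions_inj], auto simp: T_def)
  moreover have "{N \<in> t_Max (polynomial_ring R). x \<in> N} \<subseteq> polynomial_ring ` T \<union>
      {N \<in> t_Max (polynomial_ring R). to_fract p \<in> N \<and> (\<forall>a\<in>R. a \<noteq> 0 \<longrightarrow> to_fract [:a:] \<notin> N)}"
    using t_Max_polynomial_ring_cases p(1) unfolding T_def by blast
  ultimately show "finite {N \<in> t_Max (polynomial_ring R). x \<in> N}"
    using finite_t_Max_uppers[OF p(2,3)] by (meson finite_UnI finite_imageI finite_subset)
qed

text \<open>Over the localization at \<open>M\<close>, a polynomial has unit content exactly when,
  after a denominator outside \<open>M\<close> is cleared, some coefficient is outside
  \<open>M\<close>. This turns \<open>D_M(X)\<close> into a ring of fractions of the polynomial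
  ring.\<close>

lemma Nagata_ring_localization:
  assumes M: "M \<in> t_Max R"
  shows "Nagata_ring (localization R M) = localization (polynomial_ring R) (polynomial_ring M)"
proof -
  interpret P: nonfield_domain "polynomial_ring R" by (rule nonfield_domain_polynomial_ring)
  define T where "T = localization R M"
  note prime = t_Max_prime[OF M]
  note primeX = P.t_Max_prime[OF t_Max_extended[OF M]]
  have Ms: "is_submodule R M" by (rule t_Max_submodule[OF M])
  have "field_subring T"
    unfolding T_def localization_def field_subring_def by (rule subring_fractions_with[OF prime_compl[OF prime]])
  then interpret T: field_subring T .
  have RT: "R \<subseteq> T" unfolding T_def localization_def by (rule fractions_with_incl[OF prime_compl(2)[OF prime]])
  have MT: "is_submodule T (fractions_with M (R - M))"
    unfolding T_def localization_def by (rule submodule_fractions_with[OF Ms prime_compl[OF prime]])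
  have denom: "\<exists>d\<in>R - M. smult d p \<in> polys_over R" if "p \<in> polys_over T" for p
  proof -
    have "\<exists>d\<in>R - M. \<forall>i\<in>{..degree p}. d * coeff p i \<in> R"
    proof (rule common_multiplier[OF prime _ submodule_R])
      fix i
      have "coeff p i \<in> fractions_with R (R - M)"
        using that unfolding polys_over_def T_def localization_def by blast
      then show "\<exists>d\<in>R - M. d * coeff p i \<in> R"
        unfolding mem_fractions_prime[OF prime submodule_R] .
    qed simp
    then obtain d where d: "d \<in> R - M" "\<And>i. i \<le> degree p \<Longrightarrow> d * coeff p i \<in> R" by auto
    have "d * coeff p i \<in> R" for i
      using d(2)[of i] by (cases "i \<le> degree p") (auto simp: coeff_eq_0)
    with d(1) show ?thesis by (auto simp: polys_over_def)
  qed
  show ?thesis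
  proof
    show "Nagata_ring (localization R M) \<subseteq> localization (polynomial_ring R) (polynomial_ring M)"
    proof
      fix z assume "z \<in> Nagata_ring (localization R M)"
      then obtain p h where z: "z = to_fract p / to_fract h" "p \<in> polys_over T" "h \<in> polys_over T"
        "content_ideal T h = T"
        unfolding Nagata_ring_def T_def[symmetric] fractions_with_def polynomial_ring_def by blast
      obtain d where d: "d \<in> R - M" "smult d p \<in> polys_over R" using denom[OF z(2)] by blast
      obtain e where e: "e \<in> R - M" "smult e h \<in> polys_over R" using denom[OF z(3)] by blast
      have nz: "d \<noteq> 0" "e \<noteq> 0" using d e prime_compl(3)[OF prime] by metis+
      have "smult e h \<notin> polys_over M"
      proof
        assume eh: "smult e h \<in> polys_over M"
        have "content_ideal T h \<subseteq> fractions_with M (R - M)"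
          unfolding content_ideal_def
        proof (rule ideal_generated_least[OF MT], rule subsetI)
          fix c assume "c \<in> set (coeffs h)"
          then obtain i where "c = coeff h i" using range_coeff[of h] by (metis imageE insertI2)
          then have "e * c \<in> M" using eh by (simp add: polys_over_def)
          then show "c \<in> fractions_with M (R - M)"
            unfolding mem_fractions_prime[OF prime Ms] using e(1) by blast
        qed
        then have "1 \<in> fractions_with M (R - M)" using z(4) T.R_1 by blast
        then show False unfolding mem_fractions_prime[OF prime Ms] by auto
      qed
      then have "to_fract (smult e h) \<in> polynomial_ring R - polynomial_ring M" using e(2) by simp
      moreover have const: "to_fract [:d:] \<in> polynomial_ring R - polynomial_ring M"
        using d(1) by (simp add: polys_over_const[OF submodule_R] polys_over_const[OF Ms])
      ultimately have "to_fract [:d:] * to_fract (smult e h) \<in> polynomial_ring R - polynomial_ring M"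
        using P.prime_compl(4)[OF primeX] by blast
      moreover have "to_fract [:e:] * to_fract (smult d p) \<in> polynomial_ring R"
        using e(1) d(2) by (intro P.R_mult) (auto simp: polys_over_const[OF submodule_R])
      moreover have "z = to_fract [:e:] * to_fract (smult d p) / (to_fract [:d:] * to_fract (smult e h))"
      proof -
        have "[:e:] * smult d p = [:d * e:] * p" "[:d:] * smult e h = [:d * e:] * h"
          by (simp_all add: mult.commute)
        moreover have "to_fract ([:d * e:] * p) / to_fract ([:d * e:] * h) = z"
          unfolding z(1) to_fract_mult by (rule mult_divide_mult_cancel_left) (use nz in simp)
        ultimately show ?thesis unfolding to_fract_mult[symmetric] by (simp only:)
      qed
      ultimately show "z \<in> localization (polynomial_ring R) (polynomial_ring M)"
        unfolding localization_def fractions_with_def by blast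
    qed
    show "localization (polynomial_ring R) (polynomial_ring M) \<subseteq> Nagata_ring (localization R M)"
    proof
      fix z assume "z \<in> localization (polynomial_ring R) (polynomial_ring M)"
      then obtain p s where z: "z = to_fract p / to_fract s" "p \<in> polys_over R" "s \<in> polys_over R"
        "s \<notin> polys_over M"
        unfolding localization_def fractions_with_def by (auto simp: polynomial_ring_def)
      obtain i where i: "coeff s i \<notin> M" using z(4) by (auto simp: polys_over_def)
      define c where "c = coeff s i"
      have c: "c \<in> R - M" using i z(3) by (auto simp: polys_over_def c_def)
      have "c \<noteq> 0" using c prime_compl(3)[OF prime] by metis
      have "1 / c \<in> T" unfolding T_def localization_def fractions_with_def using c R_1 by blast
      moreover have "c \<in> content_ideal T s"
        using ideal_generated_superset[of "set (coeffs s)" T] range_coeff[of s] \<open>c \<noteq> 0\<close>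
        unfolding content_ideal_def c_def by auto
      ultimately have "1 / c * c \<in> content_ideal T s"
        unfolding content_ideal_def by (rule submodule_scale[OF is_submodule_ideal_generated])
      then have "1 \<in> content_ideal T s" using \<open>c \<noteq> 0\<close> by simp
      then have "T \<subseteq> content_ideal T s"
        using submodule_scale[OF is_submodule_ideal_generated, of _ T 1] unfolding content_ideal_def by auto
      moreover have "content_ideal T s \<subseteq> T"
        unfolding content_ideal_def using z(3) RT
        by (intro ideal_generated_least[OF T.submodule_R]) (auto simp: polys_over_iff_coeffs)
      ultimately have "content_ideal T s = T" by blast
      moreover have "p \<in> polys_over T" "s \<in> polys_over T" using z(2,3) polys_over_mono[OF RT] by blast+
      ultimately show "z \<in> Nagata_ring (localization R M)"
        unfolding Nagata_ring_def T_def[symmetric] fractions_with_def polynomial_ring_def z(1) by blast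
    qed
  qed
qed

lemma Na_v_subset_localization:
  assumes M: "M \<in> t_Max R"
  shows "Na_v R \<subseteq> localization (polynomial_ring R) (polynomial_ring M)"
proof
  fix z assume "z \<in> Na_v R"
  then obtain r h where "z = r / to_fract h" "r \<in> polynomial_ring R" "h \<in> N_v R"
    unfolding Na_v_def fractions_with_def by blast
  moreover from this have "to_fract h \<in> polynomial_ring R - polynomial_ring M"
    using N_v_polys N_v_not_in_t_Max[OF M] by simp
  ultimately show "z \<in> localization (polynomial_ring R) (polynomial_ring M)"
    unfolding localization_def fractions_with_def by blast
qed

lemma stable_Na_v_imp_stable_Nagata_ring:
  assumes st: "stable_domain (Na_v R)" and M: "M \<in> t_Max R"
  shows "stable_domain (Nagata_ring (localization R M))"
  unfolding Nagata_ring_localization[OF M]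
proof (rule field_subring.stable_domain_fractions[OF field_subring_Na_v st _ Na_v_subset_localization[OF M]])
  interpret P: nonfield_domain "polynomial_ring R" by (rule nonfield_domain_polynomial_ring)
  note S = P.prime_compl[OF P.t_Max_prime[OF t_Max_extended[OF M]]]
  show "subring_of_field (localization (polynomial_ring R) (polynomial_ring M))"
    unfolding localization_def by (rule P.subring_fractions_with[OF S])
  fix z assume "z \<in> localization (polynomial_ring R) (polynomial_ring M)"
  then obtain a s where z: "z = a / s" "a \<in> polynomial_ring R" "s \<in> polynomial_ring R - polynomial_ring M"
    unfolding localization_def fractions_with_def by blast
  have "s \<noteq> 0" using z(3) S(3) by metis
  moreover have "1 / s \<in> localization (polynomial_ring R) (polynomial_ring M)"
    unfolding localization_def fractions_with_def using z(3) P.R_1 by blast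
  ultimately show "\<exists>s\<in>Na_v R. s \<noteq> 0 \<and> 1 / s \<in> localization (polynomial_ring R) (polynomial_ring M)
      \<and> s * z \<in> Na_v R"
    using z polynomial_ring_subset_Na_v by (intro bexI[of _ s]) auto
qed

text \<open>\<open>locally_stable_ideal\<close> is applied over the polynomial ring with the primes
  \<open>M[X]\<close>, since finite character is given there. \<open>Na_v_local\<close> says that an
  ideal of \<open>Na_v R\<close> is the intersection of its localizations, and it also glues the
  multipliers obtained to 1.\<close>

lemma locally_stable_imp_stable_Na_v:
  assumes fc: "t_finite_character (polynomial_ring R)"
    and st: "\<And>M. M \<in> t_Max R \<Longrightarrow> stable_domain (Nagata_ring (localization R M))"
  shows "stable_domain (Na_v R)"
  unfolding stable_domain_def
proof
  interpret P: nonfield_domain "polynomial_ring R" by (rule nonfield_domain_polynomial_ring)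
  fix J assume J: "J \<in> nonzero_ideals (Na_v R)"
  have Js: "is_submodule (Na_v R) J" by (rule nonzero_ideals_submodule[OF J])
  obtain p where p: "p \<noteq> 0" "\<And>y. y \<in> J \<Longrightarrow> to_fract p * y \<in> Na_v R"
    using Na_v_ideal_denominator[OF J] by metis
  define I where "I = (*) (to_fract p) ` J"
  have IN: "I \<subseteq> Na_v R" using p(2) by (auto simp: I_def)
  have Is: "is_submodule (Na_v R) I" unfolding I_def by (rule submodule_scaled[OF Js])
  have IP: "is_submodule (polynomial_ring R) I"
    by (rule submodule_restrict[OF Is polynomial_ring_subset_Na_v])
  obtain y where "y \<in> J" "y \<noteq> 0" using nonzero_ideals_obtain[OF J] by metis
  then have y: "to_fract p * y \<in> I" "to_fract p * y \<noteq> 0" using p(1) by (auto simp: I_def)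
  then obtain h where h: "h \<in> N_v R" "to_fract h * (to_fract p * y) \<in> polynomial_ring R"
    using IN mem_Na_v by blast
  \<comment> \<open>Multiplication by \<open>h\<close> moves a nonzero element of \<open>I\<close>
    into the polynomial ring, where finite character applies.\<close>
  define x where "x = to_fract h * (to_fract p * y)"
  have x: "x \<in> I" "x \<in> polynomial_ring R" "x \<noteq> 0"
    using submodule_scale[OF IP _ y(1), of "to_fract h"] N_v_polys[OF h(1)] N_v_nonzero[OF h(1)] h(2) y(2)
    by (auto simp: x_def)
  define A where "A = ideal_product I (ideal_colon (endo_ring I) I)"
  have "\<exists>s\<in>polynomial_ring R - polynomial_ring M. s * 1 \<in> A" if M: "M \<in> t_Max R" for M
  proof -
    have "\<exists>s\<in>polynomial_ring R - polynomial_ring M. s \<in> A"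
      unfolding A_def
    proof (rule P.locally_stable_ideal[of "polynomial_ring ` t_Max R" I x])
      show "prime_ideal_of (polynomial_ring R) P" if "P \<in> polynomial_ring ` t_Max R" for P
        using that P.t_Max_prime t_Max_extended by blast
      show "I \<subseteq> localization (polynomial_ring R) P" if "P \<in> polynomial_ring ` t_Max R" for P
        using that IN Na_v_subset_localization by blast
      show "y \<in> I" if "\<And>P. P \<in> polynomial_ring ` t_Max R \<Longrightarrow> \<exists>s\<in>polynomial_ring R - P. s * y \<in> I" for y
        using that by (intro Na_v_local[OF Is]) blast
      show "finite {P \<in> polynomial_ring ` t_Max R. x \<in> P}"
      proof (rule finite_subset)
        show "{P \<in> polynomial_ring ` t_Max R. x \<in> P} \<subseteq> {P \<in> t_Max (polynomial_ring R). x \<in> P}"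
          using t_Max_extended by blast
        show "finite {P \<in> t_Max (polynomial_ring R). x \<in> P}"
          using fc x(2,3) by (simp add: t_finite_character_def)
      qed
      show "stable_domain (localization (polynomial_ring R) P)" if "P \<in> polynomial_ring ` t_Max R" for P
        using that st Nagata_ring_localization by auto
    qed (use IP x M in auto)
    then show ?thesis by simp
  qed
  moreover have "is_submodule (Na_v R) A" unfolding A_def by (rule submodule_ideal_product[OF Is])
  ultimately have "1 \<in> A" using Na_v_local by blast
  then show "stable_ideal J"
    unfolding A_def I_def stable_ideal_iff[OF Js] using product_colon_endo_scaled[of "to_fract p" J] p(1)
    by simp
qed

end

theorem proposition3p14:
  fixes D :: "'k::field set"
  assumes "domain_with_quotient_field D"
    and "\<not> is_subfield D"
  shows "(w_stable_domain (polynomial_ring D) \<longleftrightarrow> stable_domain (Na_v D))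
       \<and> (stable_domain (Na_v D) \<longleftrightarrow>
            t_finite_character (polynomial_ring D)
            \<and> (\<forall>M\<in>t_Max D. stable_domain (Nagata_ring (localization D M))))
       \<and> (w_stable_domain (polynomial_ring D)
          \<or> stable_domain (Na_v D)
          \<or> (t_finite_character (polynomial_ring D)
             \<and> (\<forall>M\<in>t_Max D. stable_domain (Nagata_ring (localization D M))))
          \<longrightarrow> w_stable_domain D)"
proof -
  interpret nonfield_domain D
    using assms unfolding domain_with_quotient_field_def nonfield_domain_def
      nonfield_domain_axioms_def field_subring_def by blast
  have "w_stable_domain (polynomial_ring D) \<longleftrightarrow> stable_domain (Na_v D)"
    using w_stable_imp_stable_Na_v stable_Na_v_imp_w_stable by blast
  moreover have "stable_domain (Na_v D) \<longleftrightarrow> t_finite_character (polynomial_ring D)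
      \<and> (\<forall>M\<in>t_Max D. stable_domain (Nagata_ring (localization D M)))"
    using stable_Na_v_imp_t_finite_character stable_Na_v_imp_stable_Nagata_ring
      locally_stable_imp_stable_Na_v by blast
  ultimately show ?thesis using stable_Na_v_imp_w_stable_base by blast
qed

end
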